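(* Let $\mathcal G = (\mathcal X\times \mathcal Y\times \mathcal Z,\ \mathcal A \times \mathcal B \times \mathcal C,\ Q,\ V)$ be a 3-player game with $\mathcal X = \mathcal Y = \mathcal Z = \{0,1\}$, arbitrary finite answer sets $\mathcal A,\mathcal B,\mathcal C$, and $Q$ the uniform distribution over $\mathcal S = \{(0,0,0), (1,0,0), (0,1,0), (1,1,1)\} = \{(x,y,z)\in\{0,1\}^3 : z = x\wedge y\}$, and such that $\mathrm{val}(\mathcal G)<1$. Then there exists a constant $c=c(\mathcal G)>0$ such that for every $n\in\mathbb N$, $\mathrm{val}(\mathcal G^{\otimes n})\le n^{-c}$.
   Context: For a $k$-player game with finite question set $\mathcal X=\prod_j\mathcal X^j$, answer set $\mathcal A=\prod_j\mathcal A^j$, distribution $Q$ on $\mathcal X$ and predicate $V:\mathcal X\times\mathcal A\to\{0,1\}$, the value $\mathrm{val}$ is the maximum over deterministic strategies $f^j:\mathcal X^j\to\mathcal A^j$ of $\Pr_{x\sim Q}[V(x,(f^j(x^j))_j)=1]$. The $n$-fold parallel repetition $\mathcal G^{\otimes n}$ draws $n$ i.i.d. question tuples from $Q$; player $j$ receives its $n$ questions and outputs $n$ answers, and the players win iff $V$ holds in every coordinate. *)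

theory Defs
  imports "HOL-Probability.Probability"
begin

record ('x, 'y, 'z, 'a, 'b, 'c) game3 =
  qset1 :: "'x set"
  qset2 :: "'y set"
  qset3 :: "'z set"
  aset1 :: "'a set"
  aset2 :: "'b set"
  aset3 :: "'c set"
  qdist :: "('x \<times> 'y \<times> 'z) pmf"
  wins  :: "'x \<times> 'y \<times> 'z \<Rightarrow> 'a \<times> 'b \<times> 'c \<Rightarrow> bool"

text \<open>
  Answer sets are nonempty, so that strategies exist and the maximum in the value is defined.
  Question sets are nonempty because they carry a probability distribution.
\<close>

definition is_game3 :: "('x, 'y, 'z, 'a, 'b, 'c) game3 \<Rightarrow> bool" where
  "is_game3 G \<longleftrightarrow>
     finite (qset1 G) \<and> finite (qset2 G) \<and> finite (qset3 G) \<and>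
     finite (aset1 G) \<and> finite (aset2 G) \<and> finite (aset3 G) \<and>
     aset1 G \<noteq> {} \<and> aset2 G \<noteq> {} \<and> aset3 G \<noteq> {} \<and>
     set_pmf (qdist G) \<subseteq> qset1 G \<times> qset2 G \<times> qset3 G"

definition win_prob ::
    "('x, 'y, 'z, 'a, 'b, 'c) game3 \<Rightarrow> ('x \<Rightarrow> 'a) \<Rightarrow> ('y \<Rightarrow> 'b) \<Rightarrow> ('z \<Rightarrow> 'c) \<Rightarrow> real" where
  "win_prob G f g h =
     measure_pmf.prob (qdist G) {(x, y, z). wins G (x, y, z) (f x, g y, h z)}"

definition val :: "('x, 'y, 'z, 'a, 'b, 'c) game3 \<Rightarrow> real" where
  "val G = Max {win_prob G f g h | f g h.
     f \<in> qset1 G \<rightarrow>\<^sub>E aset1 G \<and> g \<in> qset2 G \<rightarrow>\<^sub>E aset2 G \<and> h \<in> qset3 G \<rightarrow>\<^sub>E aset3 G}"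

definition tuples :: "nat \<Rightarrow> 'a set \<Rightarrow> 'a list set" where
  "tuples n A = {xs. length xs = n \<and> set xs \<subseteq> A}"

text \<open>
  The \<open>n\<close> question triples are drawn independently from the question distribution, and the
  resulting list of triples is transposed into the triple of the players' question lists.
\<close>

definition repetition ::
    "nat \<Rightarrow> ('x, 'y, 'z, 'a, 'b, 'c) game3 \<Rightarrow>
     ('x list, 'y list, 'z list, 'a list, 'b list, 'c list) game3" where
  "repetition n G = \<lparr>
     qset1 = tuples n (qset1 G), qset2 = tuples n (qset2 G), qset3 = tuples n (qset3 G),
     aset1 = tuples n (aset1 G), aset2 = tuples n (aset2 G), aset3 = tuples n (aset3 G),
     qdist = map_pmf (\<lambda>qs. (map fst qs, map (fst \<circ> snd) qs, map (snd \<circ> snd) qs))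
               (replicate_pmf n (qdist G)),
     wins = (\<lambda>(xs, ys, zs) (as, bs, cs).
               \<forall>i<n. wins G (xs ! i, ys ! i, zs ! i) (as ! i, bs ! i, cs ! i)) \<rparr>"

lemma finite_tuples: "finite A \<Longrightarrow> finite (tuples n A)"
  unfolding tuples_def by (rule finite_subset[OF _ finite_lists_length_eq[of A n]]) auto

lemma tuples_nonempty: "A \<noteq> {} \<Longrightarrow> tuples n A \<noteq> {}"
proof -
  assume "A \<noteq> {}"
  then obtain a where "a \<in> A" by blast
  then have "replicate n a \<in> tuples n A" by (auto simp: tuples_def)
  then show ?thesis by blast
qed

lemma is_game3_repetition:
  assumes "is_game3 G"
  shows "is_game3 (repetition n G)"
proof -
  have D: "set_pmf (qdist (repetition n G)) \<subseteq>
      tuples n (qset1 G) \<times> tuples n (qset2 G) \<times> tuples n (qset3 G)"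
  proof
    fix r assume "r \<in> set_pmf (qdist (repetition n G))"
    then obtain qs where r: "r = (map fst qs, map (fst \<circ> snd) qs, map (snd \<circ> snd) qs)"
      and len: "length qs = n" and qs: "set qs \<subseteq> set_pmf (qdist G)"
      by (auto simp: repetition_def set_replicate_pmf in_lists_conv_set)
    have Q: "q \<in> qset1 G \<times> qset2 G \<times> qset3 G" if "q \<in> set qs" for q
      using assms qs that unfolding is_game3_def by blast
    have "map fst qs \<in> tuples n (qset1 G)" "map (fst \<circ> snd) qs \<in> tuples n (qset2 G)"
      "map (snd \<circ> snd) qs \<in> tuples n (qset3 G)"
      using len by (auto simp: tuples_def dest: Q)
    then show "r \<in> tuples n (qset1 G) \<times> tuples n (qset2 G) \<times> tuples n (qset3 G)"
      by (simp add: r)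
  qed
  have "qset1 (repetition n G) = tuples n (qset1 G)" "qset2 (repetition n G) = tuples n (qset2 G)"
    "qset3 (repetition n G) = tuples n (qset3 G)" "aset1 (repetition n G) = tuples n (aset1 G)"
    "aset2 (repetition n G) = tuples n (aset2 G)" "aset3 (repetition n G) = tuples n (aset3 G)"
    by (simp_all add: repetition_def)
  with D assms show ?thesis
    unfolding is_game3_def by (simp only: finite_tuples tuples_nonempty simp_thms)
qed

lemma finite_win_probs:
  assumes "is_game3 G"
  shows "finite {win_prob G f g h | f g h.
     f \<in> qset1 G \<rightarrow>\<^sub>E aset1 G \<and> g \<in> qset2 G \<rightarrow>\<^sub>E aset2 G \<and> h \<in> qset3 G \<rightarrow>\<^sub>E aset3 G}" (is "finite ?W")
proof -
  have "?W \<subseteq> (\<lambda>(f, g, h). win_prob G f g h) `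
      ((qset1 G \<rightarrow>\<^sub>E aset1 G) \<times> (qset2 G \<rightarrow>\<^sub>E aset2 G) \<times> (qset3 G \<rightarrow>\<^sub>E aset3 G))"
  proof
    fix p assume "p \<in> ?W"
    then obtain f g h where "p = win_prob G f g h"
      "(f, g, h) \<in> (qset1 G \<rightarrow>\<^sub>E aset1 G) \<times> (qset2 G \<rightarrow>\<^sub>E aset2 G) \<times> (qset3 G \<rightarrow>\<^sub>E aset3 G)"
      by blast
    then show "p \<in> (\<lambda>(f, g, h). win_prob G f g h) `
      ((qset1 G \<rightarrow>\<^sub>E aset1 G) \<times> (qset2 G \<rightarrow>\<^sub>E aset2 G) \<times> (qset3 G \<rightarrow>\<^sub>E aset3 G))"
      by (intro image_eqI[of _ _ "(f, g, h)"]) simp_all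
  qed
  moreover have "finite ((qset1 G \<rightarrow>\<^sub>E aset1 G) \<times> (qset2 G \<rightarrow>\<^sub>E aset2 G) \<times> (qset3 G \<rightarrow>\<^sub>E aset3 G))"
    using assms by (intro finite_cartesian_product finite_PiE) (simp_all add: is_game3_def)
  ultimately show ?thesis
    by (rule finite_subset[OF _ finite_imageI])
qed

lemma win_probs_nonempty:
  assumes "is_game3 G"
  shows "{win_prob G f g h | f g h.
     f \<in> qset1 G \<rightarrow>\<^sub>E aset1 G \<and> g \<in> qset2 G \<rightarrow>\<^sub>E aset2 G \<and> h \<in> qset3 G \<rightarrow>\<^sub>E aset3 G} \<noteq> {}"
proof -
  have "(qset1 G \<rightarrow>\<^sub>E aset1 G) \<noteq> {}" "(qset2 G \<rightarrow>\<^sub>E aset2 G) \<noteq> {}" "(qset3 G \<rightarrow>\<^sub>E aset3 G) \<noteq> {}"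
    using assms by (auto simp: is_game3_def PiE_eq_empty_iff)
  then show ?thesis by blast
qed

end

theory Submission
  imports Defs
begin

text \<open>
  A question triple is a pair of independent uniform bits \<open>x\<close>, \<open>y\<close> together with \<open>z = x \<and> y\<close>. It
  suffices to find, for every product event \<open>E\<close> (\<open>x \<in> A\<close>, \<open>y \<in> B\<close>, \<open>z \<in> C\<close>) of probability at least
  an inverse power of \<open>n\<close>, a coordinate that is lost with constant probability given \<open>E\<close>.

  Each coordinate is generated by first drawing a cell that determines \<open>z\<close> and leaves at most one
  of \<open>x\<close>, \<open>y\<close> free; given all cells, the questions of the first two players are independent. By
  Bessel's inequality, the conditional probability of an event about \<open>x\<close> alone (or \<open>y\<close> alone), as a
  function of the cells, is almost insensitive to all but polynomially few coordinates. At an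
  insensitive coordinate \<open>i\<close> one may sample \<open>x\<close> and \<open>y\<close> independently with either value at \<open>i\<close>. Since
  four answers cannot win on all four questions, winning at \<open>i\<close> on the three questions with \<open>z = 0\<close>
  makes the answers of the first two players to \<open>(1, 1)\<close> hopeless, whatever the third player says.
  The probability of hopeless answers does not react to the other coordinates of a set \<open>J\<close> of
  mutually insensitive ones. Finally, once \<open>J\<close> is hidden, \<open>z \<in> C\<close> carries almost no information
  about \<open>z i\<close> for a typical \<open>i \<in> J\<close> (Bessel again), so the event \<open>E\<close> cannot avoid \<open>z i = 1\<close>.
\<close>

section \<open>Averages over product weights\<close>

text \<open>The coordinates outside \<open>I\<close> stay frozen at \<open>\<rho>\<close>, so
  \<open>avg I w f\<close> is a conditional expectation and again a function of the configuration.
  Averages over different coordinate sets can therefore be nested and compared.\<close>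

definition avg :: "'i set \<Rightarrow> ('i \<Rightarrow> 's::finite \<Rightarrow> real) \<Rightarrow> (('i \<Rightarrow> 's) \<Rightarrow> real) \<Rightarrow> ('i \<Rightarrow> 's) \<Rightarrow> real" where
  "avg I w f \<rho> = (\<Sum>\<tau>\<in>PiE I (\<lambda>_. UNIV). (\<Prod>i\<in>I. w i (\<tau> i)) * f (override_on \<rho> \<tau> I))"

definition is_weight :: "('s::finite \<Rightarrow> real) \<Rightarrow> bool" where
  "is_weight p \<longleftrightarrow> (\<forall>s. p s \<ge> 0) \<and> (\<Sum>s\<in>UNIV. p s) = 1"

lemma is_weight_nonneg: "is_weight p \<Longrightarrow> p s \<ge> 0"
  and is_weight_sum: "is_weight p \<Longrightarrow> (\<Sum>s\<in>UNIV. p s) = 1"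
  by (auto simp: is_weight_def)

lemma avg_empty [simp]: "avg {} w f \<rho> = f \<rho>"
  by (simp add: avg_def)

text \<open>Fubini for one coordinate; the inductions on the index set run through it.\<close>

lemma avg_insert:
  fixes I :: "'i set" and w :: "'i \<Rightarrow> 's::finite \<Rightarrow> real"
  assumes "finite I" "i \<notin> I"
  shows "avg (insert i I) w f \<rho> = (\<Sum>s\<in>UNIV. w i s * avg I w f (\<rho>(i := s)))"
proof -
  have inj: "inj_on (\<lambda>(s, \<tau>). \<tau>(i := s)) (UNIV \<times> PiE I (\<lambda>_. UNIV :: 's set))"
  proof (rule inj_onI)
    fix p q :: "'s \<times> ('i \<Rightarrow> 's)"
    assume p: "p \<in> UNIV \<times> PiE I (\<lambda>_. UNIV)" and q: "q \<in> UNIV \<times> PiE I (\<lambda>_. UNIV)"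
      and "(\<lambda>(s, \<tau>). \<tau>(i := s)) p = (\<lambda>(s, \<tau>). \<tau>(i := s)) q"
    then have e: "(snd p)(i := fst p) = (snd q)(i := fst q)"
      by (simp only: case_prod_unfold)
    \<comment> \<open>Extensional functions on \<open>I\<close> all take the value
      \<open>undefined\<close> at \<open>i\<close>, so overwriting them there destroys no
      information.\<close>
    have "snd p i = undefined" "snd q i = undefined"
      using p q assms(2) by (auto intro: PiE_arb)
    then have "snd p j = snd q j" for j
      using fun_cong[OF e, of j] by (cases "j = i") simp_all
    moreover have "fst p = fst q" using fun_cong[OF e, of i] by simp
    ultimately show "p = q" by (auto simp: prod_eq_iff)
  qed
  have "avg (insert i I) w f \<rho> =
      (\<Sum>(s, \<tau>)\<in>UNIV \<times> PiE I (\<lambda>_. UNIV).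
        (\<Prod>j\<in>insert i I. w j ((\<tau>(i := s)) j)) * f (override_on \<rho> (\<tau>(i := s)) (insert i I)))"
  proof -
    have "PiE (insert i I) (\<lambda>_. UNIV) = (\<lambda>(s, \<tau>). \<tau>(i := s)) ` (UNIV \<times> PiE I (\<lambda>_. UNIV :: 's set))"
      by (simp only: PiE_insert_eq)
    then show ?thesis
      unfolding avg_def by (simp only: sum.reindex[OF inj] o_def) (simp only: case_prod_unfold)
  qed
  also have "\<dots> = (\<Sum>(s, \<tau>)\<in>UNIV \<times> PiE I (\<lambda>_. UNIV).
        w i s * ((\<Prod>j\<in>I. w j (\<tau> j)) * f (override_on (\<rho>(i := s)) \<tau> I)))"
  proof (intro sum.cong refl, clarify)
    fix s \<tau>
    have "(\<Prod>j\<in>insert i I. w j ((\<tau>(i := s)) j)) = w i s * (\<Prod>j\<in>I. w j ((\<tau>(i := s)) j))"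
      by (subst prod.insert[OF assms]) simp
    also have "(\<Prod>j\<in>I. w j ((\<tau>(i := s)) j)) = (\<Prod>j\<in>I. w j (\<tau> j))"
      using assms(2) by (intro prod.cong) auto
    finally have 1: "(\<Prod>j\<in>insert i I. w j ((\<tau>(i := s)) j)) = w i s * (\<Prod>j\<in>I. w j (\<tau> j))" .
    have "override_on \<rho> (\<tau>(i := s)) (insert i I) = override_on (\<rho>(i := s)) \<tau> I"
      unfolding override_on_def fun_eq_iff using assms(2) by auto
    then show "(\<Prod>j\<in>insert i I. w j ((\<tau>(i := s)) j)) * f (override_on \<rho> (\<tau>(i := s)) (insert i I))
      = w i s * ((\<Prod>j\<in>I. w j (\<tau> j)) * f (override_on (\<rho>(i := s)) \<tau> I))"
      by (simp only: 1 mult.assoc)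
  qed
  also have "\<dots> = (\<Sum>s\<in>UNIV. w i s * avg I w f (\<rho>(i := s)))"
    unfolding avg_def sum_distrib_left by (rule sum.cartesian_product[symmetric])
  finally show ?thesis .
qed

lemma avg_remove:
  assumes "finite I" "i \<in> I"
  shows "avg I w f \<rho> = (\<Sum>s\<in>UNIV. w i s * avg (I - {i}) w f (\<rho>(i := s)))"
  using avg_insert[of "I - {i}" i w f \<rho>] assms by (simp add: insert_absorb)

lemma avg_add: "avg I w (\<lambda>\<xi>. f \<xi> + g \<xi>) \<rho> = avg I w f \<rho> + avg I w g \<rho>"
  by (simp add: avg_def algebra_simps sum.distrib)

lemma avg_diff: "avg I w (\<lambda>\<xi>. f \<xi> - g \<xi>) \<rho> = avg I w f \<rho> - avg I w g \<rho>"
  by (simp add: avg_def algebra_simps sum_subtractf)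

lemma avg_minus: "avg I w (\<lambda>\<xi>. - f \<xi>) \<rho> = - avg I w f \<rho>"
  by (simp add: avg_def sum_negf)

lemma avg_zero [simp]: "avg I w (\<lambda>\<xi>. 0) \<rho> = 0"
  by (simp add: avg_def)

lemma avg_cmult: "avg I w (\<lambda>\<xi>. c * f \<xi>) \<rho> = c * avg I w f \<rho>"
  by (simp add: avg_def sum_distrib_left mult.left_commute)

lemma avg_multc: "avg I w (\<lambda>\<xi>. f \<xi> * c) \<rho> = avg I w f \<rho> * c"
  using avg_cmult[of I w c f \<rho>] by (simp add: mult.commute)

lemma avg_divide: "avg I w (\<lambda>\<xi>. f \<xi> / c) \<rho> = avg I w f \<rho> / c"
  using avg_multc[of I w f "1 / c" \<rho>] by simp

lemma avg_sum: "avg I w (\<lambda>\<xi>. \<Sum>k\<in>K. f k \<xi>) \<rho> = (\<Sum>k\<in>K. avg I w (f k) \<rho>)"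
  by (simp add: avg_def sum_distrib_left sum.swap[of _ K])

lemma avg_cong:
  assumes "\<And>\<xi>. (\<And>j. j \<notin> I \<Longrightarrow> \<xi> j = \<rho> j) \<Longrightarrow> f \<xi> = g \<xi>" "\<And>i s. i \<in> I \<Longrightarrow> w i s = w' i s"
  shows "avg I w f \<rho> = avg I w' g \<rho>"
  unfolding avg_def using assms by (intro sum.cong arg_cong2[of _ _ _ _ "(*)"] prod.cong refl) auto

lemma avg_mono:
  assumes "\<And>i. i \<in> I \<Longrightarrow> is_weight (w i)" "\<And>\<xi>. f \<xi> \<le> g \<xi>"
  shows "avg I w f \<rho> \<le> avg I w g \<rho>"
  unfolding avg_def using assms
  by (intro sum_mono mult_left_mono prod_nonneg) (auto simp: is_weight_nonneg)

lemma avg_nonneg: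
  assumes "\<And>i. i \<in> I \<Longrightarrow> is_weight (w i)" "\<And>\<xi>. 0 \<le> f \<xi>"
  shows "0 \<le> avg I w f \<rho>"
  using avg_mono[of I w "\<lambda>_. 0" f] assms by simp

lemma avg_const:
  assumes "finite I" "\<And>i. i \<in> I \<Longrightarrow> is_weight (w i)"
  shows "avg I w (\<lambda>_. c) \<rho> = c"
  using assms
proof (induction I arbitrary: \<rho> rule: finite_induct)
  case (insert i I)
  then have "(\<Sum>s\<in>UNIV. w i s * c) = c"
    by (simp add: sum_distrib_right[symmetric] is_weight_sum)
  with insert show ?case by (simp add: avg_insert)
qed simp

lemma avg_le:
  assumes "finite I" "\<And>i. i \<in> I \<Longrightarrow> is_weight (w i)" "\<And>\<xi>. f \<xi> \<le> c"
  shows "avg I w f \<rho> \<le> c"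
  using avg_mono[of I w f "\<lambda>_. c" \<rho>] assms by (simp add: avg_const)

lemma avg_abs_le:
  assumes "\<And>i. i \<in> I \<Longrightarrow> is_weight (w i)"
  shows "\<bar>avg I w f \<rho>\<bar> \<le> avg I w (\<lambda>\<xi>. \<bar>f \<xi>\<bar>) \<rho>"
proof -
  have "avg I w f \<rho> \<le> avg I w (\<lambda>\<xi>. \<bar>f \<xi>\<bar>) \<rho>" "avg I w (\<lambda>\<xi>. - f \<xi>) \<rho> \<le> avg I w (\<lambda>\<xi>. \<bar>f \<xi>\<bar>) \<rho>"
    by (auto intro!: avg_mono assms)
  then show ?thesis by (simp add: avg_minus abs_le_iff)
qed

lemma avg_Un:
  assumes "finite I" "finite J" "I \<inter> J = {}"
  shows "avg (I \<union> J) w f \<rho> = avg I w (avg J w f) \<rho>"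
  using assms
proof (induction I arbitrary: \<rho> rule: finite_induct)
  case (insert i I)
  then show ?case by (simp add: avg_insert)
qed simp

text \<open>Averaging over \<open>J\<close> forgets the coordinates in \<open>J\<close>. With this,
  \<open>avg_pull\<close> and \<open>avg_avg\<close> give the usual calculus of conditional
  expectations: taking out known factors and the tower property.\<close>

lemma avg_override:
  assumes "\<And>j. j \<notin> J \<Longrightarrow> \<xi> j = \<rho> j"
  shows "avg J w f \<xi> = avg J w f \<rho>"
proof -
  have "override_on \<xi> \<tau> J = override_on \<rho> \<tau> J" for \<tau>
    using assms by (auto simp: override_on_def fun_eq_iff)
  then show ?thesis by (simp add: avg_def)
qed

lemma avg_pull:
  assumes "\<And>\<xi>. (\<And>j. j \<notin> J \<Longrightarrow> \<xi> j = \<rho> j) \<Longrightarrow> g \<xi> = g \<rho>"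
  shows "avg J w (\<lambda>\<xi>. f \<xi> * g \<xi>) \<rho> = avg J w f \<rho> * g \<rho>"
proof -
  have "avg J w (\<lambda>\<xi>. f \<xi> * g \<xi>) \<rho> = avg J w (\<lambda>\<xi>. f \<xi> * g \<rho>) \<rho>"
  proof (rule avg_cong[OF _ refl])
    fix \<xi> :: "'a \<Rightarrow> 'b"
    assume "\<And>j. j \<notin> J \<Longrightarrow> \<xi> j = \<rho> j"
    then have "g \<xi> = g \<rho>" by (rule assms)
    then show "f \<xi> * g \<xi> = f \<xi> * g \<rho>" by simp
  qed
  then show ?thesis by (simp add: avg_multc)
qed

lemma avg_avg:
  assumes "finite I" "J \<subseteq> I" "\<And>i. i \<in> I \<Longrightarrow> is_weight (w i)"
  shows "avg I w (avg J w f) \<rho> = avg I w f \<rho>"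
proof -
  have fin: "finite J" "finite (I - J)" using assms by (auto intro: finite_subset)
  have idem: "avg J w (avg J w f) \<xi> = avg J w f \<xi>" for \<xi>
  proof -
    have "avg J w (avg J w f) \<xi> = avg J w (\<lambda>_. avg J w f \<xi>) \<xi>"
      by (rule avg_cong) (auto intro: avg_override)
    then show ?thesis using assms fin by (simp add: avg_const subset_iff)
  qed
  have I: "I = (I - J) \<union> J" using assms by auto
  have split: "avg I w h \<rho> = avg (I - J) w (avg J w h) \<rho>" for h
    using avg_Un[of "I - J" J w h \<rho>] fin I by auto
  have "avg J w (avg J w f) = avg J w f" by (rule ext) (rule idem)
  then show ?thesis using split[of "avg J w f"] split[of f] by simp
qed

lemma avg_singleton: "avg {i} w f \<rho> = (\<Sum>s\<in>UNIV. w i s * f (\<rho>(i := s)))"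
  using avg_insert[of "{}" i w f \<rho>] by simp

section \<open>Resampling one coordinate, and Bessel's inequality\<close>

lemma avg_resample:
  assumes "finite I" "i \<in> I" "\<And>i. i \<in> I \<Longrightarrow> is_weight (w i)"
  shows "avg I w f \<rho> = avg I w (\<lambda>\<xi>. \<Sum>s\<in>UNIV. w i s * f (\<xi>(i := s))) \<rho>"
proof -
  have "avg {i} w f = (\<lambda>\<xi>. \<Sum>s\<in>UNIV. w i s * f (\<xi>(i := s)))"
    by (rule ext) (rule avg_singleton)
  then show ?thesis using avg_avg[of I "{i}" w f \<rho>] assms by simp
qed

lemma avg_coord_indep:
  assumes "finite I" "i \<in> I" "\<And>i. i \<in> I \<Longrightarrow> is_weight (w i)"
    and "\<And>\<xi> s. g (\<xi>(i := s)) = g \<xi>"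
  shows "avg I w (\<lambda>\<xi>. \<phi> (\<xi> i) * g \<xi>) \<rho> = (\<Sum>s\<in>UNIV. w i s * \<phi> s) * avg I w g \<rho>"
  by (subst avg_resample[OF assms(1,2,3)])
    (simp_all add: assms(4) avg_cmult sum_distrib_right[symmetric] mult.assoc[symmetric])

text \<open>Mean-zero functions of distinct coordinates are orthogonal by independence. With
  \<open>c i\<close> the correlation of \<open>g\<close> with the \<open>i\<close>-th function and
  \<open>S\<close> the sum of these functions weighted by \<open>c i\<close>, the second moment of
  \<open>S\<close> is at most \<open>v\<close> times the sum of the \<open>(c i)\<^sup>2\<close>.
  Expanding the nonnegative average of \<open>(v * g - S)\<^sup>2\<close> gives \<open>v\<close>
  times the claim.\<close>

lemma bessel:
  assumes fin: "finite I" and w: "\<And>i. i \<in> I \<Longrightarrow> is_weight (w i)"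
    and K: "K \<subseteq> I"
    and mean: "\<And>i. i \<in> K \<Longrightarrow> (\<Sum>s\<in>UNIV. w i s * \<phi> i s) = 0"
    and var: "\<And>i. i \<in> K \<Longrightarrow> (\<Sum>s\<in>UNIV. w i s * (\<phi> i s)\<^sup>2) \<le> v" and v: "v > 0"
  shows "(\<Sum>i\<in>K. (avg I w (\<lambda>\<xi>. \<phi> i (\<xi> i) * g \<xi>) \<rho>)\<^sup>2) \<le> v * avg I w (\<lambda>\<xi>. (g \<xi>)\<^sup>2) \<rho>"
proof -
  define c where "c i = avg I w (\<lambda>\<xi>. \<phi> i (\<xi> i) * g \<xi>) \<rho>" for i
  define S where "S \<xi> = (\<Sum>i\<in>K. c i * \<phi> i (\<xi> i))" for \<xi>
  have finK: "finite K" using K fin finite_subset by blast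
  have orth: "avg I w (\<lambda>\<xi>. \<phi> i (\<xi> i) * \<phi> j (\<xi> j)) \<rho> = 0" if "i \<in> K" "j \<in> K" "i \<noteq> j" for i j
    using avg_coord_indep[of I i w "\<lambda>\<xi>. \<phi> j (\<xi> j)" "\<phi> i" \<rho>] that fin w K mean by auto
  have diag: "avg I w (\<lambda>\<xi>. \<phi> i (\<xi> i) * \<phi> i (\<xi> i)) \<rho> \<le> v" if "i \<in> K" for i
    using avg_coord_indep[of I i w "\<lambda>_. 1" "\<lambda>s. (\<phi> i s)\<^sup>2" \<rho>] that fin w K var[of i]
    by (auto simp: avg_const power2_eq_square)
  have gS: "avg I w (\<lambda>\<xi>. g \<xi> * S \<xi>) \<rho> = (\<Sum>i\<in>K. (c i)\<^sup>2)"
  proof -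
    have "g \<xi> * S \<xi> = (\<Sum>i\<in>K. c i * (\<phi> i (\<xi> i) * g \<xi>))" for \<xi>
      by (simp add: S_def sum_distrib_left mult_ac)
    then show ?thesis by (simp add: avg_sum avg_cmult c_def[symmetric] power2_eq_square)
  qed
  have "avg I w (\<lambda>\<xi>. S \<xi> * S \<xi>) \<rho> =
      (\<Sum>i\<in>K. \<Sum>j\<in>K. c i * (c j * avg I w (\<lambda>\<xi>. \<phi> i (\<xi> i) * \<phi> j (\<xi> j)) \<rho>))"
  proof -
    have "S \<xi> * S \<xi> = (\<Sum>i\<in>K. \<Sum>j\<in>K. c i * (c j * (\<phi> i (\<xi> i) * \<phi> j (\<xi> j))))" for \<xi>
      by (simp add: S_def sum_product mult_ac)
    then show ?thesis by (simp add: avg_sum avg_cmult)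
  qed
  also have "\<dots> = (\<Sum>i\<in>K. c i * (c i * avg I w (\<lambda>\<xi>. \<phi> i (\<xi> i) * \<phi> i (\<xi> i)) \<rho>))"
  proof (rule sum.cong[OF refl])
    fix i assume i: "i \<in> K"
    have "(\<Sum>j\<in>K. c i * (c j * avg I w (\<lambda>\<xi>. \<phi> i (\<xi> i) * \<phi> j (\<xi> j)) \<rho>)) =
      (\<Sum>j\<in>K. if j = i then c i * (c i * avg I w (\<lambda>\<xi>. \<phi> i (\<xi> i) * \<phi> i (\<xi> i)) \<rho>) else 0)"
      using i by (intro sum.cong) (auto simp: orth)
    then show "(\<Sum>j\<in>K. c i * (c j * avg I w (\<lambda>\<xi>. \<phi> i (\<xi> i) * \<phi> j (\<xi> j)) \<rho>)) =
      c i * (c i * avg I w (\<lambda>\<xi>. \<phi> i (\<xi> i) * \<phi> i (\<xi> i)) \<rho>)"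
      using i finK by simp
  qed
  also have "\<dots> \<le> (\<Sum>i\<in>K. v * (c i)\<^sup>2)"
  proof (rule sum_mono)
    fix i assume i: "i \<in> K"
    have "(c i)\<^sup>2 * avg I w (\<lambda>\<xi>. \<phi> i (\<xi> i) * \<phi> i (\<xi> i)) \<rho> \<le> (c i)\<^sup>2 * v"
      by (intro mult_left_mono diag i) simp
    then show "c i * (c i * avg I w (\<lambda>\<xi>. \<phi> i (\<xi> i) * \<phi> i (\<xi> i)) \<rho>) \<le> v * (c i)\<^sup>2"
      by (simp add: power2_eq_square mult_ac)
  qed
  finally have SS: "avg I w (\<lambda>\<xi>. S \<xi> * S \<xi>) \<rho> \<le> v * (\<Sum>i\<in>K. (c i)\<^sup>2)"
    by (simp add: sum_distrib_left)
  have "0 \<le> avg I w (\<lambda>\<xi>. (v * g \<xi> - S \<xi>)\<^sup>2) \<rho>"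
    by (rule avg_nonneg) (auto intro: w)
  also have "(\<lambda>\<xi>. (v * g \<xi> - S \<xi>)\<^sup>2) = (\<lambda>\<xi>. v\<^sup>2 * (g \<xi>)\<^sup>2 - (2 * v) * (g \<xi> * S \<xi>) + S \<xi> * S \<xi>)"
    by (simp add: fun_eq_iff power2_eq_square algebra_simps)
  also have "avg I w \<dots> \<rho> = v\<^sup>2 * avg I w (\<lambda>\<xi>. (g \<xi>)\<^sup>2) \<rho> - 2 * v * (\<Sum>i\<in>K. (c i)\<^sup>2)
      + avg I w (\<lambda>\<xi>. S \<xi> * S \<xi>) \<rho>"
    by (simp add: avg_add avg_diff avg_cmult gS)
  finally have "v * (\<Sum>i\<in>K. (c i)\<^sup>2) \<le> v * (v * avg I w (\<lambda>\<xi>. (g \<xi>)\<^sup>2) \<rho>)"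
    using SS by (simp add: power2_eq_square)
  then show ?thesis using v by (simp add: c_def)
qed

text \<open>Replace the coordinates of \<open>J\<close> by fresh samples one at a time.\<close>
lemma avg_deviation:
  assumes fin: "finite I" and J: "J \<subseteq> I" and w: "\<And>i. i \<in> I \<Longrightarrow> is_weight (w i)"
  shows "avg I w (\<lambda>\<xi>. \<bar>f \<xi> - avg J w f \<xi>\<bar>) \<rho> \<le> (\<Sum>j\<in>J. avg I w (\<lambda>\<xi>. \<bar>f \<xi> - avg {j} w f \<xi>\<bar>) \<rho>)"
proof -
  have "finite J" using J fin finite_subset by blast
  then show ?thesis using J
  proof (induction J rule: finite_induct)
    case empty
    then show ?case by simp
  next
    case (insert j J)
    have "avg (insert j J) w f \<xi> = avg {j} w (avg J w f) \<xi>" for \<xi>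
      using avg_Un[of "{j}" J w f \<xi>] insert by simp
    then have "\<bar>f \<xi> - avg (insert j J) w f \<xi>\<bar> \<le>
        \<bar>f \<xi> - avg {j} w f \<xi>\<bar> + avg {j} w (\<lambda>\<xi>. \<bar>f \<xi> - avg J w f \<xi>\<bar>) \<xi>" for \<xi>
      using avg_abs_le[of "{j}" w "\<lambda>\<xi>. f \<xi> - avg J w f \<xi>" \<xi>] insert.prems w
      by (auto simp: avg_diff)
    then have "avg I w (\<lambda>\<xi>. \<bar>f \<xi> - avg (insert j J) w f \<xi>\<bar>) \<rho> \<le>
        avg I w (\<lambda>\<xi>. \<bar>f \<xi> - avg {j} w f \<xi>\<bar> + avg {j} w (\<lambda>\<xi>. \<bar>f \<xi> - avg J w f \<xi>\<bar>) \<xi>) \<rho>"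
      by (intro avg_mono w)
    \<comment> \<open>The tower property removes the outer average over \<open>j\<close>, which
      leaves the quantity of the induction hypothesis.\<close>
    also have "\<dots> = avg I w (\<lambda>\<xi>. \<bar>f \<xi> - avg {j} w f \<xi>\<bar>) \<rho> + avg I w (\<lambda>\<xi>. \<bar>f \<xi> - avg J w f \<xi>\<bar>) \<rho>"
      using avg_avg[of I "{j}" w _ \<rho>] insert.prems fin w by (simp add: avg_add)
    finally show ?case using insert by simp
  qed
qed

section \<open>Decoupling the two free players\<close>

text \<open>
  Draw \<open>x\<close> and \<open>y\<close> uniformly, reveal \<open>z = x \<and> y\<close>, and toss a fair coin to reveal \<open>x\<close> or \<open>y\<close>. In
  \<open>FreeX\<close> the revealed bit is \<open>y = 0\<close>, which leaves \<open>x\<close> uniform; \<open>Pt10\<close> is the case where \<open>x = 1\<close> and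
  \<open>z = 0\<close> were revealed.
\<close>
datatype cell = FreeX | FreeY | Pt11 | Pt10 | Pt01

lemma UNIV_cell: "(UNIV :: cell set) = {FreeX, FreeY, Pt11, Pt10, Pt01}"
  using cell.exhaust by auto

instance cell :: finite
  by standard (simp add: UNIV_cell)

text \<open>For the bits \<open>(1, 0)\<close>, of probability \<open>1/4\<close>, the coin must
  also reveal \<open>x\<close> to give \<open>Pt10\<close>, hence \<open>1/8\<close>; otherwise the
  cell is \<open>FreeX\<close>. For \<open>(1, 1)\<close> both outcomes of the coin determine the
  triple and are merged into \<open>Pt11\<close>.\<close>

fun cellw :: "cell \<Rightarrow> real" where
  "cellw FreeX = 1/4" | "cellw FreeY = 1/4" | "cellw Pt11 = 1/4" | "cellw Pt10 = 1/8" | "cellw Pt01 = 1/8"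

text \<open>\<open>kerX c\<close> and \<open>kerY c\<close> are the conditional laws of the two bits
  given the cell \<open>c\<close>. At least one of them is a point mass, so the bits are independent
  given the cell.\<close>

fun kerX :: "cell \<Rightarrow> bool \<Rightarrow> real" where
  "kerX FreeX b = 1/2" | "kerX FreeY b = of_bool (\<not> b)" | "kerX Pt11 b = of_bool b"
| "kerX Pt10 b = of_bool b" | "kerX Pt01 b = of_bool (\<not> b)"

fun kerY :: "cell \<Rightarrow> bool \<Rightarrow> real" where
  "kerY FreeX b = of_bool (\<not> b)" | "kerY FreeY b = 1/2" | "kerY Pt11 b = of_bool b"
| "kerY Pt10 b = of_bool (\<not> b)" | "kerY Pt01 b = of_bool b"

abbreviation coin :: "bool \<Rightarrow> real" where "coin \<equiv> \<lambda>_. 1/2"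

lemma sum_cell: "(\<Sum>s\<in>UNIV. f s) = f FreeX + f FreeY + f Pt11 + f Pt10 + f Pt01" for f :: "cell \<Rightarrow> real"
  by (simp add: UNIV_cell)

lemma is_weight_cellw [simp]: "is_weight cellw"
proof -
  have "cellw c \<ge> 0" for c by (cases c) simp_all
  then show ?thesis by (simp add: is_weight_def sum_cell)
qed

lemma is_weight_kerX [simp]: "is_weight (kerX c)" and is_weight_kerY [simp]: "is_weight (kerY c)"
  by (cases c; simp add: is_weight_def UNIV_bool)+

lemma is_weight_coin [simp]: "is_weight coin"
  by (simp add: is_weight_def UNIV_bool)

text \<open>The base point \<open>FreeX\<close> has \<open>z = 0\<close>, in agreement with the base
  point \<open>False\<close> of \<open>Ecoin\<close>; this is the consistency outside
  \<open>I\<close> that \<open>decoupling_base\<close> asks for.\<close>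

abbreviation Ecell :: "'i set \<Rightarrow> (('i \<Rightarrow> cell) \<Rightarrow> real) \<Rightarrow> real" where
  "Ecell I f \<equiv> avg I (\<lambda>_. cellw) f (\<lambda>_. FreeX)"

abbreviation Ecoin :: "'i set \<Rightarrow> (('i \<Rightarrow> bool) \<Rightarrow> real) \<Rightarrow> real" where
  "Ecoin I f \<equiv> avg I (\<lambda>_. coin) f (\<lambda>_. False)"

definition kavg :: "(cell \<Rightarrow> bool \<Rightarrow> real) \<Rightarrow> 'i set \<Rightarrow> (('i \<Rightarrow> bool) \<Rightarrow> real) \<Rightarrow> ('i \<Rightarrow> cell) \<Rightarrow> real" where
  "kavg k I \<phi> \<rho> = avg I (\<lambda>i. k (\<rho> i)) \<phi> (\<lambda>_. False)"

definition zpart :: "('i \<Rightarrow> cell) \<Rightarrow> 'i \<Rightarrow> bool" where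
  "zpart \<rho> = (\<lambda>i. \<rho> i = Pt11)"

lemma decoupling_base:
  assumes "finite I" "\<And>i. i \<notin> I \<Longrightarrow> (\<rho> i = Pt11) = (x i \<and> y i)"
  shows "avg I (\<lambda>_. cellw) (\<lambda>\<rho>. avg I (\<lambda>i. kerX (\<rho> i)) (\<lambda>x. avg I (\<lambda>i. kerY (\<rho> i)) (\<lambda>y. \<Psi> x y (zpart \<rho>)) y) x) \<rho>
    = avg I (\<lambda>_. coin) (\<lambda>x. avg I (\<lambda>_. coin) (\<lambda>y. \<Psi> x y (\<lambda>i. x i \<and> y i)) y) x"
  using assms
proof (induction I arbitrary: x y \<rho> rule: finite_induct)
  case empty
  then have "zpart \<rho> = (\<lambda>i. x i \<and> y i)" by (auto simp: zpart_def)
  then show ?case by simp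
next
  case (insert i I)
  define F where "F \<rho> x y = avg I (\<lambda>_. cellw) (\<lambda>\<rho>. avg I (\<lambda>i. kerX (\<rho> i)) (\<lambda>x. avg I (\<lambda>i. kerY (\<rho> i)) (\<lambda>y. \<Psi> x y (zpart \<rho>)) y) x) \<rho>"
    for \<rho> x y
  define H where "H x y = avg I (\<lambda>_. coin) (\<lambda>x. avg I (\<lambda>_. coin) (\<lambda>y. \<Psi> x y (\<lambda>i. x i \<and> y i)) y) x" for x y
  have IH: "F (\<rho>(i := c)) (x(i := a)) (y(i := b)) = H (x(i := a)) (y(i := b))"
    if "(c = Pt11) = (a \<and> b)" for a b c
    unfolding F_def H_def by (rule insert.IH) (use insert.prems that in auto)
  have step: "avg I (\<lambda>_. cellw) (\<lambda>\<rho>. avg (insert i I) (\<lambda>j. kerX (\<rho> j)) (\<lambda>x. avg (insert i I) (\<lambda>j. kerY (\<rho> j)) (\<lambda>y. \<Psi> x y (zpart \<rho>)) y) x) (\<rho>(i := c))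
     = (\<Sum>a\<in>UNIV. kerX c a * (\<Sum>b\<in>UNIV. kerY c b * F (\<rho>(i := c)) (x(i := a)) (y(i := b))))" for c
  proof -
    have "avg I (\<lambda>_. cellw) (\<lambda>\<rho>. avg (insert i I) (\<lambda>j. kerX (\<rho> j)) (\<lambda>x. avg (insert i I) (\<lambda>j. kerY (\<rho> j)) (\<lambda>y. \<Psi> x y (zpart \<rho>)) y) x) (\<rho>(i := c))
      = avg I (\<lambda>_. cellw) (\<lambda>\<rho>. \<Sum>a\<in>UNIV. kerX c a * (\<Sum>b\<in>UNIV. kerY c b *
          avg I (\<lambda>j. kerX (\<rho> j)) (\<lambda>x. avg I (\<lambda>j. kerY (\<rho> j)) (\<lambda>y. \<Psi> x y (zpart \<rho>)) (y(i := b))) (x(i := a)))) (\<rho>(i := c))"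
    proof (rule avg_cong[OF _ refl])
      fix \<xi> :: "'a \<Rightarrow> cell" assume "\<And>j. j \<notin> I \<Longrightarrow> \<xi> j = (\<rho>(i := c)) j"
      then have "\<xi> i = c" using insert.hyps by simp
      then show "avg (insert i I) (\<lambda>j. kerX (\<xi> j)) (\<lambda>x. avg (insert i I) (\<lambda>j. kerY (\<xi> j)) (\<lambda>y. \<Psi> x y (zpart \<xi>)) y) x
        = (\<Sum>a\<in>UNIV. kerX c a * (\<Sum>b\<in>UNIV. kerY c b *
          avg I (\<lambda>j. kerX (\<xi> j)) (\<lambda>x. avg I (\<lambda>j. kerY (\<xi> j)) (\<lambda>y. \<Psi> x y (zpart \<xi>)) (y(i := b))) (x(i := a))))"
        using insert.hyps by (simp add: avg_insert avg_sum avg_cmult avg_add UNIV_bool algebra_simps)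
    qed
    then show ?thesis by (simp add: avg_sum avg_cmult F_def)
  qed
  have "avg (insert i I) (\<lambda>_. cellw) (\<lambda>\<rho>. avg (insert i I) (\<lambda>i. kerX (\<rho> i)) (\<lambda>x. avg (insert i I) (\<lambda>i. kerY (\<rho> i)) (\<lambda>y. \<Psi> x y (zpart \<rho>)) y) x) \<rho>
    = (\<Sum>c\<in>UNIV. cellw c * (\<Sum>a\<in>UNIV. kerX c a * (\<Sum>b\<in>UNIV. kerY c b * F (\<rho>(i := c)) (x(i := a)) (y(i := b)))))"
    unfolding avg_insert[OF insert.hyps, of "\<lambda>_. cellw"] step ..
  \<comment> \<open>The kernels vanish on pairs of bits that contradict the cell, so
    \<open>IH\<close> applies to every surviving term. For each pair of bits the surviving weights
    add up to \<open>1/4\<close>.\<close>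
  also have "\<dots> = (\<Sum>a\<in>UNIV. 1/2 * (\<Sum>b\<in>UNIV. 1/2 * H (x(i := a)) (y(i := b))))"
    by (simp add: sum_cell UNIV_bool IH field_simps)
  also have "\<dots> = avg (insert i I) (\<lambda>_. coin) (\<lambda>x. avg (insert i I) (\<lambda>_. coin) (\<lambda>y. \<Psi> x y (\<lambda>i. x i \<and> y i)) y) x"
    using insert.hyps by (simp add: avg_insert avg_add avg_divide H_def UNIV_bool field_simps)
  finally show ?case .
qed

lemma decoupling:
  assumes "finite I"
  shows "Ecell I (\<lambda>\<rho>. kavg kerX I (\<lambda>x. kavg kerY I (\<lambda>y. \<Psi> x y (zpart \<rho>)) \<rho>) \<rho>) =
    Ecoin I (\<lambda>x. Ecoin I (\<lambda>y. \<Psi> x y (\<lambda>i. x i \<and> y i)))"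
  unfolding kavg_def
proof -
  show "Ecell I (\<lambda>\<rho>. avg I (\<lambda>i. kerX (\<rho> i)) (\<lambda>x. avg I (\<lambda>i. kerY (\<rho> i)) (\<lambda>y. \<Psi> x y (zpart \<rho>)) (\<lambda>_. False)) (\<lambda>_. False)) =
    Ecoin I (\<lambda>x. Ecoin I (\<lambda>y. \<Psi> x y (\<lambda>i. x i \<and> y i)))"
    using decoupling_base[OF assms, of "\<lambda>_. FreeX" "\<lambda>_. False" "\<lambda>_. False" \<Psi>] by simp
qed

lemma Ecoin_resample:
  assumes "finite I" "i \<in> I"
  shows "Ecoin I f = (Ecoin I (\<lambda>x. f (x(i := True))) + Ecoin I (\<lambda>x. f (x(i := False)))) / 2"
  by (subst avg_resample[OF assms]) (simp_all add: UNIV_bool avg_add avg_divide add_divide_distrib)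

text \<open>At \<open>i\<close> the sampled bits are overwritten by all four questions, while the
  other coordinates keep their cells. This compares the four questions at \<open>i\<close> under the
  same cells; the factor 4 clears the probability \<open>1/4\<close> of each question.\<close>

lemma decoupling_at:
  assumes "finite I" "i \<in> I"
  shows "4 * Ecoin I (\<lambda>x. Ecoin I (\<lambda>y. \<Psi> x y (\<lambda>j. x j \<and> y j))) =
    Ecell I (\<lambda>\<rho>. \<Sum>a\<in>UNIV. \<Sum>b\<in>UNIV.
      kavg kerX I (\<lambda>x. kavg kerY I (\<lambda>y. \<Psi> (x(i := a)) (y(i := b)) ((zpart \<rho>)(i := a \<and> b))) \<rho>) \<rho>)"
proof -
  have "Ecell I (\<lambda>\<rho>. \<Sum>a\<in>UNIV. \<Sum>b\<in>UNIV.
      kavg kerX I (\<lambda>x. kavg kerY I (\<lambda>y. \<Psi> (x(i := a)) (y(i := b)) ((zpart \<rho>)(i := a \<and> b))) \<rho>) \<rho>) =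
    (\<Sum>a\<in>UNIV. \<Sum>b\<in>UNIV. Ecoin I (\<lambda>x. Ecoin I (\<lambda>y. \<Psi> (x(i := a)) (y(i := b)) ((\<lambda>j. x j \<and> y j)(i := a \<and> b)))))"
    by (simp only: avg_sum decoupling[OF assms(1), of "\<lambda>x y z. \<Psi> (x(i := a)) (y(i := b)) (z(i := a \<and> b))" for a b])
  also have "\<dots> = (\<Sum>a\<in>UNIV. \<Sum>b\<in>UNIV. Ecoin I (\<lambda>x. Ecoin I (\<lambda>y. \<Psi> (x(i := a)) (y(i := b)) (\<lambda>j. (x(i := a)) j \<and> (y(i := b)) j))))"
  proof -
    have "(\<lambda>j. x j \<and> y j)(i := a \<and> b) = (\<lambda>j. (x(i := a)) j \<and> (y(i := b)) j)" for x y a b by auto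
    then show ?thesis by simp
  qed
  also have "\<dots> = (\<Sum>a\<in>UNIV. 2 * Ecoin I (\<lambda>x. Ecoin I (\<lambda>y. \<Psi> (x(i := a)) y (\<lambda>j. (x(i := a)) j \<and> y j))))"
  proof (rule sum.cong[OF refl])
    fix a
    have "2 * Ecoin I (\<lambda>y. \<Psi> (x(i := a)) y (\<lambda>j. (x(i := a)) j \<and> y j)) =
      (\<Sum>b\<in>UNIV. Ecoin I (\<lambda>y. \<Psi> (x(i := a)) (y(i := b)) (\<lambda>j. (x(i := a)) j \<and> (y(i := b)) j)))" for x
      by (subst Ecoin_resample[OF assms]) (simp add: UNIV_bool)
    then show "(\<Sum>b\<in>UNIV. Ecoin I (\<lambda>x. Ecoin I (\<lambda>y. \<Psi> (x(i := a)) (y(i := b)) (\<lambda>j. (x(i := a)) j \<and> (y(i := b)) j)))) =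
      2 * Ecoin I (\<lambda>x. Ecoin I (\<lambda>y. \<Psi> (x(i := a)) y (\<lambda>j. (x(i := a)) j \<and> y j)))"
      by (simp only: avg_sum[symmetric] avg_cmult[symmetric])
  qed
  also have "\<dots> = 4 * Ecoin I (\<lambda>x. Ecoin I (\<lambda>y. \<Psi> x y (\<lambda>j. x j \<and> y j)))"
    by (subst (3) Ecoin_resample[OF assms]) (simp add: UNIV_bool)
  finally show ?thesis by simp
qed

section \<open>Influences\<close>

text \<open>The effect of the player's own bit at \<open>i\<close>, given the cells. Both terms
  overwrite that bit, which is why the cell at \<open>i\<close> drops out in
  \<open>kdiff_upd\<close>.\<close>

definition kdiff :: "(cell \<Rightarrow> bool \<Rightarrow> real) \<Rightarrow> 'i set \<Rightarrow> 'i \<Rightarrow> (('i \<Rightarrow> bool) \<Rightarrow> real) \<Rightarrow> ('i \<Rightarrow> cell) \<Rightarrow> real" where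
  "kdiff k I i \<phi> \<rho> = kavg k I (\<lambda>x. \<phi> (x(i := True))) \<rho> - kavg k I (\<lambda>x. \<phi> (x(i := False))) \<rho>"

text \<open>If \<open>\<phi>\<close> ignores \<open>i\<close>, the kernel at \<open>i\<close>
  integrates to 1 whatever the cell is.\<close>

lemma kavg_fixed_coord:
  assumes "finite I" "i \<in> I" "\<And>c. is_weight (k c)" "\<And>x b. \<phi> (x(i := b)) = \<phi> x"
  shows "kavg k I \<phi> (\<rho>(i := c)) = kavg k I \<phi> \<rho>"
proof -
  have *: "avg I w \<phi> x = avg (I - {i}) w \<phi> x" if "\<And>j. j \<in> I \<Longrightarrow> is_weight (w j)" for w x
  proof -
    have "avg I w \<phi> x = avg (I - {i}) w (avg {i} w \<phi>) x"
      using avg_Un[of "I - {i}" "{i}" w \<phi> x] assms(1,2) by (simp add: insert_absorb)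
    moreover have "avg {i} w \<phi> = \<phi>"
      using that[OF assms(2)] by (simp add: fun_eq_iff avg_singleton assms(4) sum_distrib_right[symmetric] is_weight_sum)
    ultimately show ?thesis by simp
  qed
  show ?thesis
    unfolding kavg_def by (subst (1 2) *) (auto simp: assms(3) intro!: avg_cong split: if_splits)
qed

lemma kdiff_upd:
  assumes "finite I" "i \<in> I" "\<And>c. is_weight (k c)"
  shows "kdiff k I i \<phi> (\<rho>(i := c)) = kdiff k I i \<phi> \<rho>"
  unfolding kdiff_def by (simp add: kavg_fixed_coord[where k = k] assms)

lemma kavg_split:
  assumes "finite I" "i \<in> I" "\<And>c. is_weight (k c)"
  shows "kavg k I \<phi> \<rho> = k (\<rho> i) True * kavg k I (\<lambda>x. \<phi> (x(i := True))) \<rho>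
    + k (\<rho> i) False * kavg k I (\<lambda>x. \<phi> (x(i := False))) \<rho>"
  unfolding kavg_def by (subst avg_resample[OF assms(1,2)]) (simp_all add: UNIV_bool avg_add avg_cmult assms(3))

text \<open>The conditional expectation is affine in the probability of \<open>True\<close> at
  \<open>i\<close>, with slope \<open>kdiff\<close>; changing the cell moves this probability by at
  most 1.\<close>

lemma kavg_change:
  assumes "finite I" "i \<in> I" "\<And>c. is_weight (k c)"
  shows "\<bar>kavg k I \<phi> \<rho> - kavg k I \<phi> (\<rho>(i := c))\<bar> \<le> \<bar>kdiff k I i \<phi> \<rho>\<bar>"
proof -
  define T where "T = kavg k I (\<lambda>x. \<phi> (x(i := True))) \<rho>"
  define F where "F = kavg k I (\<lambda>x. \<phi> (x(i := False))) \<rho>"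
  have w: "k c False = 1 - k c True" "0 \<le> k c True" "k c True \<le> 1" for c
    using is_weight_sum[OF assms(3), of c] is_weight_nonneg[OF assms(3), of c True]
      is_weight_nonneg[OF assms(3), of c False] by (simp_all add: UNIV_bool)
  have "kavg k I \<phi> (\<rho>(i := c)) = k c True * T + k c False * F"
    unfolding kavg_split[OF assms, where \<phi> = \<phi> and \<rho> = "\<rho>(i := c)"] T_def F_def
    by (simp add: kavg_fixed_coord[where k = k] assms)
  moreover have "kavg k I \<phi> \<rho> = k (\<rho> i) True * T + k (\<rho> i) False * F"
    unfolding T_def F_def by (rule kavg_split[OF assms])
  ultimately have "kavg k I \<phi> \<rho> - kavg k I \<phi> (\<rho>(i := c)) = (k (\<rho> i) True - k c True) * (T - F)"
    by (simp add: w(1) algebra_simps)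
  moreover have "\<bar>(k (\<rho> i) True - k c True) * (T - F)\<bar> \<le> 1 * \<bar>T - F\<bar>"
    unfolding abs_mult using w(2,3)[of c] w(2,3)[of "\<rho> i"] by (intro mult_right_mono) auto
  ultimately show ?thesis by (simp add: kdiff_def T_def F_def)
qed

text \<open>
  Given the cells, a player's question is uniform on the free coordinates, so \<open>kdiff\<close> at a free
  coordinate is twice a first-level Fourier coefficient. Since \<open>kdiff\<close> at \<open>i\<close> does not depend on
  the cell at \<open>i\<close>, which is free with probability \<open>1/4\<close>, freeness can be dropped on average.
\<close>
lemma influence_sum:
  assumes fin: "finite I" and k: "\<And>c. is_weight (k c)"
    and free: "\<And>b. k fr b = 1/2" "cellw fr = 1/4" and \<phi>: "\<And>x. \<bar>\<phi> x\<bar> \<le> 1"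
  shows "(\<Sum>i\<in>I. Ecell I (\<lambda>\<rho>. (kdiff k I i \<phi> \<rho>)\<^sup>2)) \<le> 16"
proof -
  \<comment> \<open>At a free coordinate the sign has mean 0 and variance 1, and its correlation
    with \<open>\<phi>\<close> is half of \<open>kdiff\<close>. Bessel thus gives the bound 4 over
    the free coordinates; dividing by the probability \<open>1/4\<close> of being free gives
    16.\<close>
  define sg where "sg b = (if b then 1 else -1 :: real)" for b
  have pt: "(\<Sum>i\<in>I. of_bool (\<rho> i = fr) * (kdiff k I i \<phi> \<rho>)\<^sup>2) \<le> 4" for \<rho>
  proof -
    define K where "K = {i\<in>I. \<rho> i = fr}"
    have "(\<Sum>i\<in>K. (avg I (\<lambda>i. k (\<rho> i)) (\<lambda>x. sg (x i) * \<phi> x) (\<lambda>_. False))\<^sup>2)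
      \<le> 1 * avg I (\<lambda>i. k (\<rho> i)) (\<lambda>x. (\<phi> x)\<^sup>2) (\<lambda>_. False)"
      by (rule bessel[where \<phi> = "\<lambda>_. sg"]) (auto simp: fin k K_def UNIV_bool free sg_def)
    also have "\<dots> \<le> 1"
      using \<phi> by (simp, intro avg_le) (auto simp: fin k abs_square_le_1)
    finally have "(\<Sum>i\<in>K. (avg I (\<lambda>i. k (\<rho> i)) (\<lambda>x. sg (x i) * \<phi> x) (\<lambda>_. False))\<^sup>2) \<le> 1" .
    moreover have "avg I (\<lambda>i. k (\<rho> i)) (\<lambda>x. sg (x i) * \<phi> x) (\<lambda>_. False) = kdiff k I i \<phi> \<rho> / 2" if "i \<in> K" for i
    proof -
      have i: "i \<in> I" "\<rho> i = fr" using that by (auto simp: K_def)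
      have "kavg k I (\<lambda>x. sg (x i) * \<phi> x) \<rho> = kdiff k I i \<phi> \<rho> / 2"
        by (subst kavg_split[OF fin i(1) k]) (simp add: i free kdiff_def sg_def kavg_def avg_minus diff_divide_distrib)
      then show ?thesis by (simp add: kavg_def)
    qed
    ultimately have "(\<Sum>i\<in>K. (kdiff k I i \<phi> \<rho> / 2)\<^sup>2) \<le> 1" by simp
    then have "(\<Sum>i\<in>K. (kdiff k I i \<phi> \<rho>)\<^sup>2) \<le> 4"
      by (simp add: power_divide sum_divide_distrib[symmetric])
    moreover have "(\<Sum>i\<in>I. of_bool (\<rho> i = fr) * (kdiff k I i \<phi> \<rho>)\<^sup>2) = (\<Sum>i\<in>K. (kdiff k I i \<phi> \<rho>)\<^sup>2)"
      unfolding K_def using fin by (intro sum.mono_neutral_cong_right) auto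
    ultimately show ?thesis by simp
  qed
  have "Ecell I (\<lambda>\<rho>. (kdiff k I i \<phi> \<rho>)\<^sup>2) / 4 = Ecell I (\<lambda>\<rho>. of_bool (\<rho> i = fr) * (kdiff k I i \<phi> \<rho>)\<^sup>2)" if i: "i \<in> I" for i
  proof -
    have "Ecell I (\<lambda>\<rho>. of_bool (\<rho> i = fr) * (kdiff k I i \<phi> \<rho>)\<^sup>2) =
      (\<Sum>s\<in>UNIV. cellw s * of_bool (s = fr)) * Ecell I (\<lambda>\<rho>. (kdiff k I i \<phi> \<rho>)\<^sup>2)"
      by (rule avg_coord_indep[OF fin i]) (auto simp: kdiff_upd[OF fin i k])
    also have "(\<Sum>s\<in>UNIV. cellw s * of_bool (s = fr)) = cellw fr"
      by (cases fr) (simp_all add: sum_cell)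
    finally show ?thesis by (simp add: free)
  qed
  then have "(\<Sum>i\<in>I. Ecell I (\<lambda>\<rho>. (kdiff k I i \<phi> \<rho>)\<^sup>2)) / 4 =
      Ecell I (\<lambda>\<rho>. \<Sum>i\<in>I. of_bool (\<rho> i = fr) * (kdiff k I i \<phi> \<rho>)\<^sup>2)"
    by (simp add: avg_sum sum_divide_distrib)
  also have "\<dots> \<le> 4" using pt by (intro avg_le) (auto simp: fin)
  finally show ?thesis by simp
qed

lemma influence_sum_X:
  "finite I \<Longrightarrow> (\<And>x. \<bar>\<phi> x\<bar> \<le> 1) \<Longrightarrow> (\<Sum>i\<in>I. Ecell I (\<lambda>\<rho>. (kdiff kerX I i \<phi> \<rho>)\<^sup>2)) \<le> 16"
  by (rule influence_sum[where fr = FreeX]) auto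

lemma influence_sum_Y:
  "finite I \<Longrightarrow> (\<And>x. \<bar>\<phi> x\<bar> \<le> 1) \<Longrightarrow> (\<Sum>i\<in>I. Ecell I (\<lambda>\<rho>. (kdiff kerY I i \<phi> \<rho>)\<^sup>2)) \<le> 16"
  by (rule influence_sum[where fr = FreeY]) auto

text \<open>A linear form of Cauchy-Schwarz from \<open>(|t| - \<eta>)\<^sup>2 \<ge> 0\<close>. A
  second moment of at most \<open>\<eta>\<^sup>2\<close> gives a first absolute moment of at most
  \<open>\<eta>\<close>.\<close>

lemma avg_abs_le_of_square:
  assumes "finite I" "\<And>i. i \<in> I \<Longrightarrow> is_weight (w i)" "\<eta> > 0"
  shows "avg I w (\<lambda>\<xi>. \<bar>f \<xi>\<bar>) \<rho> \<le> avg I w (\<lambda>\<xi>. (f \<xi>)\<^sup>2) \<rho> / (2 * \<eta>) + \<eta> / 2"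
proof -
  have "\<bar>t\<bar> \<le> t\<^sup>2 / (2 * \<eta>) + \<eta> / 2" for t :: real
    using zero_le_power2[of "\<bar>t\<bar> - \<eta>"] assms(3) by (simp add: power2_diff field_simps power2_eq_square)
  then have "avg I w (\<lambda>\<xi>. \<bar>f \<xi>\<bar>) \<rho> \<le> avg I w (\<lambda>\<xi>. (f \<xi>)\<^sup>2 / (2 * \<eta>) + \<eta> / 2) \<rho>"
    by (intro avg_mono assms(2))
  then show ?thesis by (simp add: avg_add avg_divide avg_const assms)
qed

text \<open>
  With the coordinates in \<open>J - {i}\<close> hidden, the event \<open>z \<in> C\<close> hardly depends on \<open>z i\<close> for a
  typical \<open>i \<in> J\<close>.
\<close>
lemma hidden_coordinate_sum:
  fixes C :: "('i \<Rightarrow> bool) \<Rightarrow> real"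
  assumes fin: "finite I" and J: "J \<subseteq> I" and C: "\<And>z. \<bar>C z\<bar> \<le> 1"
  shows "(\<Sum>i\<in>J. Ecell I (\<lambda>\<rho>. (avg (J - {i}) (\<lambda>_. cellw) (\<lambda>\<xi>. C ((zpart \<xi>)(i := True)) - C ((zpart \<xi>)(i := False))) \<rho>)\<^sup>2)) \<le> 16/3"
proof -
  \<comment> \<open>The centred indicator of \<open>z i = 1\<close>, an event of probability
    \<open>1/4\<close>; its variance is \<open>3/16\<close>.\<close>
  define \<phi> :: "cell \<Rightarrow> real" where "\<phi> s = of_bool (s = Pt11) - 1/4" for s
  define d where "d i \<rho> = avg (J - {i}) (\<lambda>_. cellw) (\<lambda>\<xi>. C ((zpart \<xi>)(i := True)) - C ((zpart \<xi>)(i := False))) \<rho>" for i \<rho>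
  have finJ: "finite J" using J fin finite_subset by blast
  have pt: "(\<Sum>i\<in>J. (d i \<rho>)\<^sup>2) \<le> 16/3" for \<rho>
  proof -
    have "(\<Sum>i\<in>J. (avg J (\<lambda>_. cellw) (\<lambda>\<xi>. \<phi> (\<xi> i) * C (zpart \<xi>)) \<rho>)\<^sup>2)
        \<le> 3/16 * avg J (\<lambda>_. cellw) (\<lambda>\<xi>. (C (zpart \<xi>))\<^sup>2) \<rho>"
      by (rule bessel[where \<phi> = "\<lambda>_. \<phi>"]) (auto simp: finJ sum_cell \<phi>_def power2_eq_square)
    also have "avg J (\<lambda>_. cellw) (\<lambda>\<xi>. (C (zpart \<xi>))\<^sup>2) \<rho> \<le> 1"
      using C by (intro avg_le) (auto simp: finJ abs_square_le_1)
    finally have "(\<Sum>i\<in>J. (avg J (\<lambda>_. cellw) (\<lambda>\<xi>. \<phi> (\<xi> i) * C (zpart \<xi>)) \<rho>)\<^sup>2) \<le> 3/16" by simp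
    \<comment> \<open>The value \<open>3/4\<close> has weight \<open>1/4\<close> and the value
      \<open>-1/4\<close> has weight \<open>3/4\<close>, so the correlation is \<open>3/16\<close>
      times the effect of \<open>z i\<close>. Dividing Bessel's bound \<open>3/16\<close> by the
      square of this factor gives \<open>16/3\<close>.\<close>
    moreover have "avg J (\<lambda>_. cellw) (\<lambda>\<xi>. \<phi> (\<xi> i) * C (zpart \<xi>)) \<rho> = 3/16 * d i \<rho>" if i: "i \<in> J" for i
    proof -
      have z: "zpart (\<xi>(i := s)) = (zpart \<xi>)(i := (s = Pt11))" for \<xi> :: "'i \<Rightarrow> cell" and s
        by (auto simp: zpart_def)
      have "avg (J - {i}) (\<lambda>_. cellw) (\<lambda>\<xi>. \<phi> (\<xi> i) * C (zpart \<xi>)) (\<rho>(i := s)) =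
          avg (J - {i}) (\<lambda>_. cellw) (\<lambda>\<xi>. \<phi> s * C ((zpart \<xi>)(i := (s = Pt11)))) (\<rho>(i := s))" for s
      proof (rule avg_cong[OF _ refl])
        fix \<xi> :: "'i \<Rightarrow> cell" assume "\<And>j. j \<notin> J - {i} \<Longrightarrow> \<xi> j = (\<rho>(i := s)) j"
        then have "\<xi> i = s" by simp
        then have "(zpart \<xi>)(i := (s = Pt11)) = zpart \<xi>" by (auto simp: zpart_def)
        then show "\<phi> (\<xi> i) * C (zpart \<xi>) = \<phi> s * C ((zpart \<xi>)(i := (s = Pt11)))"
          using \<open>\<xi> i = s\<close> by simp
      qed
      moreover have "avg (J - {i}) (\<lambda>_. cellw) (\<lambda>\<xi>. C ((zpart \<xi>)(i := b))) (\<rho>(i := s)) =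
          avg (J - {i}) (\<lambda>_. cellw) (\<lambda>\<xi>. C ((zpart \<xi>)(i := b))) \<rho>" for b s
      proof -
        have "override_on (\<rho>(i := s)) \<tau> (J - {i}) = (override_on \<rho> \<tau> (J - {i}))(i := s)" for \<tau>
          by (auto simp: override_on_def)
        then show ?thesis by (simp add: avg_def z)
      qed
      ultimately have *: "avg (J - {i}) (\<lambda>_. cellw) (\<lambda>\<xi>. \<phi> (\<xi> i) * C (zpart \<xi>)) (\<rho>(i := s)) =
          \<phi> s * avg (J - {i}) (\<lambda>_. cellw) (\<lambda>\<xi>. C ((zpart \<xi>)(i := (s = Pt11)))) \<rho>" for s
        by (simp only: avg_cmult)
      have vals: "\<phi> FreeX = -1/4" "\<phi> FreeY = -1/4" "\<phi> Pt11 = 3/4" "\<phi> Pt10 = -1/4" "\<phi> Pt01 = -1/4"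
        by (simp_all add: \<phi>_def)
      show ?thesis
        unfolding avg_remove[OF finJ i] sum_cell * vals d_def avg_diff by (simp add: field_simps)
    qed
    ultimately have "(\<Sum>i\<in>J. (3/16 * d i \<rho>)\<^sup>2) \<le> 3/16" by simp
    then show ?thesis
      by (simp add: power_mult_distrib sum_distrib_left[symmetric] power2_eq_square sum_divide_distrib[symmetric])
  qed
  have "(\<Sum>i\<in>J. Ecell I (\<lambda>\<rho>. (d i \<rho>)\<^sup>2)) = Ecell I (\<lambda>\<rho>. \<Sum>i\<in>J. (d i \<rho>)\<^sup>2)" by (simp add: avg_sum)
  also have "\<dots> \<le> 16/3" using pt by (intro avg_le) (auto simp: fin)
  finally show ?thesis by (simp add: d_def)
qed

section \<open>Losing at a hidden coordinate\<close>

text \<open>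
  Four independent answers drawn with weights \<open>a\<^sub>0, a\<^sub>1, b\<^sub>0, b\<^sub>1\<close> lose on one of the four questions.
\<close>
lemma four_answers_lose:
  fixes a0 a1 :: "'a \<Rightarrow> real" and b0 b1 :: "'b \<Rightarrow> real" and A :: "'a set" and B :: "'b set"
  defines "S \<equiv> \<lambda>(l :: 'a \<Rightarrow> 'b \<Rightarrow> bool) a b. \<Sum>\<alpha>\<in>A. \<Sum>\<beta>\<in>B. of_bool (l \<alpha> \<beta>) * (a \<alpha> * b \<beta>)"
  assumes nn: "\<And>\<alpha>. a0 \<alpha> \<ge> 0" "\<And>\<alpha>. a1 \<alpha> \<ge> 0" "\<And>\<beta>. b0 \<beta> \<ge> 0" "\<And>\<beta>. b1 \<beta> \<ge> 0"
    and le: "sum a0 A \<le> 1" "sum b0 B \<le> 1"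
    and lose: "\<And>\<alpha>0 \<alpha>1 \<beta>0 \<beta>1. \<lbrakk>\<alpha>0 \<in> A; \<alpha>1 \<in> A; \<beta>0 \<in> B; \<beta>1 \<in> B\<rbrakk> \<Longrightarrow>
      l00 \<alpha>0 \<beta>0 \<or> l10 \<alpha>1 \<beta>0 \<or> l01 \<alpha>0 \<beta>1 \<or> l11 \<alpha>1 \<beta>1"
  shows "sum a0 A * sum b0 B - \<bar>sum a1 A - sum a0 A\<bar> - \<bar>sum b1 B - sum b0 B\<bar>
    \<le> S l00 a0 b0 + S l10 a1 b0 + S l01 a0 b1 + S l11 a1 b1"
proof -
  \<comment> \<open>One answer per player and question is drawn. Each such quadruple loses on one of
    the four questions; that loss involves two of the answers, and the other two sum to a product of
    total masses.\<close>
  define P where "P \<alpha>0 \<alpha>1 \<beta>0 \<beta>1 = a0 \<alpha>0 * a1 \<alpha>1 * b0 \<beta>0 * b1 \<beta>1" for \<alpha>0 \<alpha>1 \<beta>0 \<beta>1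
  have P_nonneg: "P \<alpha>0 \<alpha>1 \<beta>0 \<beta>1 \<ge> 0" for \<alpha>0 \<alpha>1 \<beta>0 \<beta>1
    by (simp add: P_def nn)
  define A0 A1 B0 B1 where d: "A0 = sum a0 A" "A1 = sum a1 A" "B0 = sum b0 B" "B1 = sum b1 B"
  have d_nonneg: "0 \<le> A0" "0 \<le> A1" "0 \<le> B0" "0 \<le> B1" by (auto simp: d sum_nonneg nn)
  have S_nonneg: "S l00 a0 b0 \<ge> 0" "S l10 a1 b0 \<ge> 0" "S l01 a0 b1 \<ge> 0" "S l11 a1 b1 \<ge> 0"
    by (auto simp: S_def nn intro!: sum_nonneg)
  have 0: "A0 * B0 * (A1 * B1) = (\<Sum>\<alpha>0\<in>A. \<Sum>\<alpha>1\<in>A. \<Sum>\<beta>0\<in>B. \<Sum>\<beta>1\<in>B. P \<alpha>0 \<alpha>1 \<beta>0 \<beta>1)"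
    unfolding d P_def sum_product by (simp add: sum_product mult_ac)
  have 1: "S l00 a0 b0 * (A1 * B1) = (\<Sum>\<alpha>0\<in>A. \<Sum>\<alpha>1\<in>A. \<Sum>\<beta>0\<in>B. \<Sum>\<beta>1\<in>B. of_bool (l00 \<alpha>0 \<beta>0) * P \<alpha>0 \<alpha>1 \<beta>0 \<beta>1)"
    unfolding d P_def S_def sum_product by (simp add: sum_product mult_ac)
  have "A0 * B1 * S l10 a1 b0 = (\<Sum>\<alpha>0\<in>A. \<Sum>\<alpha>1\<in>A. \<Sum>\<beta>1\<in>B. \<Sum>\<beta>0\<in>B. of_bool (l10 \<alpha>1 \<beta>0) * P \<alpha>0 \<alpha>1 \<beta>0 \<beta>1)"
    unfolding d P_def S_def sum_product by (simp add: sum_product mult_ac)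
  also have "\<dots> = (\<Sum>\<alpha>0\<in>A. \<Sum>\<alpha>1\<in>A. \<Sum>\<beta>0\<in>B. \<Sum>\<beta>1\<in>B. of_bool (l10 \<alpha>1 \<beta>0) * P \<alpha>0 \<alpha>1 \<beta>0 \<beta>1)"
    by (intro sum.cong refl sum.swap)
  finally have 2: "A0 * B1 * S l10 a1 b0 = (\<Sum>\<alpha>0\<in>A. \<Sum>\<alpha>1\<in>A. \<Sum>\<beta>0\<in>B. \<Sum>\<beta>1\<in>B. of_bool (l10 \<alpha>1 \<beta>0) * P \<alpha>0 \<alpha>1 \<beta>0 \<beta>1)" .
  have "S l01 a0 b1 * (A1 * B0) = (\<Sum>\<alpha>0\<in>A. \<Sum>\<alpha>1\<in>A. \<Sum>\<beta>1\<in>B. \<Sum>\<beta>0\<in>B. of_bool (l01 \<alpha>0 \<beta>1) * P \<alpha>0 \<alpha>1 \<beta>0 \<beta>1)"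
    unfolding d P_def S_def sum_product by (simp add: sum_product mult_ac)
  also have "\<dots> = (\<Sum>\<alpha>0\<in>A. \<Sum>\<alpha>1\<in>A. \<Sum>\<beta>0\<in>B. \<Sum>\<beta>1\<in>B. of_bool (l01 \<alpha>0 \<beta>1) * P \<alpha>0 \<alpha>1 \<beta>0 \<beta>1)"
    by (intro sum.cong refl sum.swap)
  finally have 3: "S l01 a0 b1 * (A1 * B0) = (\<Sum>\<alpha>0\<in>A. \<Sum>\<alpha>1\<in>A. \<Sum>\<beta>0\<in>B. \<Sum>\<beta>1\<in>B. of_bool (l01 \<alpha>0 \<beta>1) * P \<alpha>0 \<alpha>1 \<beta>0 \<beta>1)" .
  have 4: "A0 * B0 * S l11 a1 b1 = (\<Sum>\<alpha>0\<in>A. \<Sum>\<alpha>1\<in>A. \<Sum>\<beta>0\<in>B. \<Sum>\<beta>1\<in>B. of_bool (l11 \<alpha>1 \<beta>1) * P \<alpha>0 \<alpha>1 \<beta>0 \<beta>1)"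
    unfolding d P_def S_def sum_product by (simp add: sum_product mult_ac)
  have "P \<alpha>0 \<alpha>1 \<beta>0 \<beta>1 \<le> of_bool (l00 \<alpha>0 \<beta>0) * P \<alpha>0 \<alpha>1 \<beta>0 \<beta>1 + of_bool (l10 \<alpha>1 \<beta>0) * P \<alpha>0 \<alpha>1 \<beta>0 \<beta>1
      + of_bool (l01 \<alpha>0 \<beta>1) * P \<alpha>0 \<alpha>1 \<beta>0 \<beta>1 + of_bool (l11 \<alpha>1 \<beta>1) * P \<alpha>0 \<alpha>1 \<beta>0 \<beta>1"
    if "\<alpha>0 \<in> A" "\<alpha>1 \<in> A" "\<beta>0 \<in> B" "\<beta>1 \<in> B" for \<alpha>0 \<alpha>1 \<beta>0 \<beta>1
    using lose[OF that] P_nonneg[of \<alpha>0 \<alpha>1 \<beta>0 \<beta>1] by auto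
  then have prod_le: "A0 * B0 * (A1 * B1) \<le>
      S l00 a0 b0 * (A1 * B1) + A0 * B1 * S l10 a1 b0 + S l01 a0 b1 * (A1 * B0) + A0 * B0 * S l11 a1 b1"
    unfolding 0 1 2 3 4 sum.distrib[symmetric] by (intro sum_mono) auto
  define T where "T = S l00 a0 b0 + S l10 a1 b0 + S l01 a0 b1 + S l11 a1 b1"
  \<comment> \<open>In \<open>prod_le\<close> the masses of the uninvolved answers are at most the
    two maxima. As \<open>A0 * A1\<close> is the maximum times the minimum, and likewise for
    \<open>B\<close>, dividing by the maxima leaves the minima.\<close>
  have "min A0 A1 * min B0 B1 \<le> T"
  proof (cases "max A0 A1 * max B0 B1 = 0")
    case True
    then have "min A0 A1 * min B0 B1 = 0" using d_nonneg by (auto simp: max_def min_def split: if_splits)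
    then show ?thesis using S_nonneg unfolding T_def by linarith
  next
    case False
    moreover have "max A0 A1 * max B0 B1 \<ge> 0" using d_nonneg by (intro mult_nonneg_nonneg) auto
    ultimately have pos: "max A0 A1 * max B0 B1 > 0" using False by linarith
    have le: "A * B \<le> max A0 A1 * max B0 B1" if "A \<in> {A0, A1}" "B \<in> {B0, B1}" for A B
      using that d_nonneg by (intro mult_mono) auto
    have "S l00 a0 b0 * (A1 * B1) \<le> S l00 a0 b0 * (max A0 A1 * max B0 B1)"
      "A0 * B1 * S l10 a1 b0 \<le> (max A0 A1 * max B0 B1) * S l10 a1 b0"
      "S l01 a0 b1 * (A1 * B0) \<le> S l01 a0 b1 * (max A0 A1 * max B0 B1)"
      "A0 * B0 * S l11 a1 b1 \<le> (max A0 A1 * max B0 B1) * S l11 a1 b1"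
      using S_nonneg by (auto intro!: mult_left_mono mult_right_mono le)
    then have "A0 * B0 * (A1 * B1) \<le> (max A0 A1 * max B0 B1) * T"
      using prod_le by (simp add: T_def algebra_simps)
    moreover have "A0 * B0 * (A1 * B1) = (max A0 A1 * max B0 B1) * (min A0 A1 * min B0 B1)"
      by (simp add: max_def min_def mult_ac)
    ultimately have "(max A0 A1 * max B0 B1) * (min A0 A1 * min B0 B1) \<le> (max A0 A1 * max B0 B1) * T" by simp
    then show ?thesis using pos by (rule mult_left_le_imp_le)
  qed
  moreover have "A0 * B0 - \<bar>A1 - A0\<bar> - \<bar>B1 - B0\<bar> \<le> min A0 A1 * min B0 B1"
  proof -
    have "A0 * B0 - min A0 A1 * min B0 B1 = (A0 - min A0 A1) * B0 + min A0 A1 * (B0 - min B0 B1)"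
      by (simp add: algebra_simps)
    also have "\<dots> \<le> \<bar>A1 - A0\<bar> * 1 + 1 * \<bar>B1 - B0\<bar>"
      using d_nonneg le by (intro add_mono mult_mono) (auto simp: d min_def)
    finally show ?thesis by simp
  qed
  ultimately show ?thesis by (simp add: d T_def)
qed

text \<open>To be read with \<open>u\<close> the mass of the first two players' events at question
  \<open>(0, 0)\<close>, \<open>v\<close> the mass of hopeless answers to \<open>(1, 1)\<close>, and
  \<open>c0\<close>, \<open>c1\<close> the third player's event at \<open>z i = 0\<close> and
  \<open>z i = 1\<close>; the weights 3 and 1 count the questions with these values. If
  \<open>u\<close> and \<open>v\<close> hardly depend on \<open>J\<close>, they can be replaced by
  their averages \<open>U\<close> and \<open>V\<close> over \<open>J\<close>, and then
  \<open>c0\<close> and \<open>c1\<close> by theirs, which nearly agree. Whatever loss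
  \<open>v\<close> saves at \<open>z i = 0\<close> is then paid at \<open>z i = 1\<close>.\<close>

lemma combine_hidden:
  assumes fin: "finite I" and J: "J \<subseteq> I" and w: "\<And>i. i \<in> I \<Longrightarrow> is_weight (w i)"
    and u: "\<And>\<xi>. 0 \<le> u \<xi>" "\<And>\<xi>. u \<xi> \<le> 1" and v: "\<And>\<xi>. 0 \<le> v \<xi>" and e: "\<And>\<xi>. 0 \<le> e \<xi>"
    and c: "\<And>\<xi>. 0 \<le> c0 \<xi>" "\<And>\<xi>. c0 \<xi> \<le> 1" "\<And>\<xi>. 0 \<le> c1 \<xi>" "\<And>\<xi>. c1 \<xi> \<le> 1"
  shows "avg I w (\<lambda>\<xi>. (3 * c0 \<xi> + c1 \<xi>) * u \<xi>) \<rho> / 4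
     - 3/4 * avg I w (\<lambda>\<xi>. \<bar>avg J w c0 \<xi> - avg J w c1 \<xi>\<bar>) \<rho>
     - 2 * avg I w (\<lambda>\<xi>. \<bar>u \<xi> - avg J w u \<xi>\<bar>) \<rho> - 2 * avg I w (\<lambda>\<xi>. \<bar>v \<xi> - avg J w v \<xi>\<bar>) \<rho> - avg I w e \<rho>
    \<le> avg I w (\<lambda>\<xi>. c0 \<xi> * max 0 (u \<xi> - v \<xi> - e \<xi>) + c1 \<xi> * v \<xi>) \<rho>"
proof -
  define U V C0 C1 where d: "U = avg J w u" "V = avg J w v" "C0 = avg J w c0" "C1 = avg J w c1"
  have finJ: "finite J" using J fin finite_subset by blast
  have wJ: "\<And>i. i \<in> J \<Longrightarrow> is_weight (w i)" using w J by auto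
  have UV: "0 \<le> U \<xi>" "U \<xi> \<le> 1" "0 \<le> V \<xi>" "0 \<le> C0 \<xi>" "C0 \<xi> \<le> 1" "0 \<le> C1 \<xi>" "C1 \<xi> \<le> 1" for \<xi>
    unfolding d using u v c finJ wJ by (auto intro!: avg_nonneg avg_le)
  have inv: "avg J w f \<xi> = avg J w f \<xi>'" if "\<And>j. j \<notin> J \<Longrightarrow> \<xi> j = \<xi>' j" for f \<xi> \<xi>'
    using that by (rule avg_override)
  have pull: "avg I w (\<lambda>\<xi>. f \<xi> * g \<xi>) \<rho> = avg I w (\<lambda>\<xi>. avg J w f \<xi> * g \<xi>) \<rho>"
    if "\<And>\<xi> \<xi>'. (\<And>j. j \<notin> J \<Longrightarrow> \<xi> j = \<xi>' j) \<Longrightarrow> g \<xi> = g \<xi>'" for f g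
  proof -
    have "avg J w (\<lambda>\<xi>. f \<xi> * g \<xi>) \<xi>' = avg J w f \<xi>' * g \<xi>'" for \<xi>'
      by (rule avg_pull) (rule that)
    then have "avg J w (\<lambda>\<xi>. f \<xi> * g \<xi>) = (\<lambda>\<xi>. avg J w f \<xi> * g \<xi>)" by (rule ext)
    then show ?thesis using avg_avg[where I = I and J = J and w = w, OF fin J w, where f = "\<lambda>\<xi>. f \<xi> * g \<xi>" and \<rho> = \<rho>] by simp
  qed
  have UV_inv: "U \<xi> = U \<xi>'" "V \<xi> = V \<xi>'" if "\<And>j. j \<notin> J \<Longrightarrow> \<xi> j = \<xi>' j" for \<xi> \<xi>'
    unfolding d by (rule inv[OF that]; simp)+
  have max_inv: "max 0 (U \<xi> - V \<xi>) = max 0 (U \<xi>' - V \<xi>')" if "\<And>j. j \<notin> J \<Longrightarrow> \<xi> j = \<xi>' j" for \<xi> \<xi>'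
    using UV_inv[OF that] by simp
  have p1: "avg I w (\<lambda>\<xi>. c0 \<xi> * max 0 (U \<xi> - V \<xi>)) \<rho> = avg I w (\<lambda>\<xi>. C0 \<xi> * max 0 (U \<xi> - V \<xi>)) \<rho>"
    unfolding d(3) by (rule pull) (rule max_inv)
  have p2: "avg I w (\<lambda>\<xi>. c1 \<xi> * V \<xi>) \<rho> = avg I w (\<lambda>\<xi>. C1 \<xi> * V \<xi>) \<rho>"
    unfolding d(4) by (rule pull) (rule UV_inv)
  have p3: "avg I w (\<lambda>\<xi>. (3 * c0 \<xi> + c1 \<xi>) * U \<xi>) \<rho> = avg I w (\<lambda>\<xi>. (3 * C0 \<xi> + C1 \<xi>) * U \<xi>) \<rho>"
  proof -
    have "avg J w (\<lambda>\<xi>. 3 * c0 \<xi> + c1 \<xi>) \<xi> = 3 * C0 \<xi> + C1 \<xi>" for \<xi>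
      by (simp add: d avg_add avg_cmult)
    moreover have "avg I w (\<lambda>\<xi>. (3 * c0 \<xi> + c1 \<xi>) * U \<xi>) \<rho> =
        avg I w (\<lambda>\<xi>. avg J w (\<lambda>\<xi>. 3 * c0 \<xi> + c1 \<xi>) \<xi> * U \<xi>) \<rho>"
      by (rule pull) (rule UV_inv)
    ultimately show ?thesis by simp
  qed
  \<comment> \<open>As \<open>c0\<close> and \<open>c1\<close> are at most 1, passing between
    \<open>U\<close>, \<open>V\<close> and \<open>u\<close>, \<open>v\<close> costs only the
    deviations; that of \<open>v\<close> is paid once in each summand.\<close>
  have "c0 \<xi> * max 0 (U \<xi> - V \<xi>) + c1 \<xi> * V \<xi> - \<bar>u \<xi> - U \<xi>\<bar> - 2 * \<bar>v \<xi> - V \<xi>\<bar> - e \<xi>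
      \<le> c0 \<xi> * max 0 (u \<xi> - v \<xi> - e \<xi>) + c1 \<xi> * v \<xi>" for \<xi>
  proof -
    define t where "t = \<bar>u \<xi> - U \<xi>\<bar> + \<bar>v \<xi> - V \<xi>\<bar> + e \<xi>"
    have "c0 \<xi> * max 0 (U \<xi> - V \<xi>) \<le> c0 \<xi> * (max 0 (u \<xi> - v \<xi> - e \<xi>) + t)"
      using e[of \<xi>] c[of \<xi>] by (intro mult_left_mono) (auto simp: t_def)
    also have "\<dots> \<le> c0 \<xi> * max 0 (u \<xi> - v \<xi> - e \<xi>) + t"
      using e[of \<xi>] c[of \<xi>] mult_left_le_one_le[of t "c0 \<xi>"] by (auto simp: t_def distrib_left)
    finally have 1: "c0 \<xi> * max 0 (U \<xi> - V \<xi>) \<le> c0 \<xi> * max 0 (u \<xi> - v \<xi> - e \<xi>) + t" .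
    have "c1 \<xi> * V \<xi> \<le> c1 \<xi> * (v \<xi> + \<bar>v \<xi> - V \<xi>\<bar>)" using c[of \<xi>] by (intro mult_left_mono) auto
    also have "\<dots> \<le> c1 \<xi> * v \<xi> + \<bar>v \<xi> - V \<xi>\<bar>"
      using c[of \<xi>] mult_left_le_one_le[of "\<bar>v \<xi> - V \<xi>\<bar>" "c1 \<xi>"] by (auto simp: distrib_left)
    finally show ?thesis using 1 by (simp add: t_def)
  qed
  then have "avg I w (\<lambda>\<xi>. c0 \<xi> * max 0 (U \<xi> - V \<xi>) + c1 \<xi> * V \<xi> - \<bar>u \<xi> - U \<xi>\<bar> - 2 * \<bar>v \<xi> - V \<xi>\<bar> - e \<xi>) \<rho>
      \<le> avg I w (\<lambda>\<xi>. c0 \<xi> * max 0 (u \<xi> - v \<xi> - e \<xi>) + c1 \<xi> * v \<xi>) \<rho>"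
    by (intro avg_mono w)
  then have s1: "avg I w (\<lambda>\<xi>. C0 \<xi> * max 0 (U \<xi> - V \<xi>)) \<rho> + avg I w (\<lambda>\<xi>. C1 \<xi> * V \<xi>) \<rho>
      - avg I w (\<lambda>\<xi>. \<bar>u \<xi> - U \<xi>\<bar>) \<rho> - 2 * avg I w (\<lambda>\<xi>. \<bar>v \<xi> - V \<xi>\<bar>) \<rho> - avg I w e \<rho>
      \<le> avg I w (\<lambda>\<xi>. c0 \<xi> * max 0 (u \<xi> - v \<xi> - e \<xi>) + c1 \<xi> * v \<xi>) \<rho>"
    by (simp only: avg_add avg_diff avg_cmult p1 p2)
  \<comment> \<open>With \<open>m\<close> the smaller of \<open>C0\<close> and \<open>C1\<close>,
    the right side is at least \<open>m * U\<close>, since \<open>max 0 (U - V) + V \<ge> U\<close>.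
    The mean \<open>(3 * C0 + C1) / 4\<close> exceeds \<open>m\<close> by at most \<open>3/4\<close>
    of the difference.\<close>
  have "((3 * C0 \<xi> + C1 \<xi>) * U \<xi>) * (1/4) - 3/4 * \<bar>C0 \<xi> - C1 \<xi>\<bar>
      \<le> C0 \<xi> * max 0 (U \<xi> - V \<xi>) + C1 \<xi> * V \<xi>" for \<xi>
  proof -
    define m where "m = min (C0 \<xi>) (C1 \<xi>)"
    have "m * U \<xi> \<le> m * (max 0 (U \<xi> - V \<xi>) + V \<xi>)"
      using UV[of \<xi>] by (intro mult_left_mono) (auto simp: m_def)
    also have "\<dots> \<le> C0 \<xi> * max 0 (U \<xi> - V \<xi>) + C1 \<xi> * V \<xi>"
      using UV[of \<xi>] by (auto simp: m_def distrib_left intro!: add_mono mult_right_mono)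
    finally have "m * U \<xi> \<le> C0 \<xi> * max 0 (U \<xi> - V \<xi>) + C1 \<xi> * V \<xi>" .
    moreover have "((3 * C0 \<xi> + C1 \<xi>) * (1/4)) * U \<xi> \<le> (m + 3/4 * \<bar>C0 \<xi> - C1 \<xi>\<bar>) * U \<xi>"
      using UV[of \<xi>] by (intro mult_right_mono) (auto simp: m_def min_def)
    moreover have "3/4 * \<bar>C0 \<xi> - C1 \<xi>\<bar> * U \<xi> \<le> 3/4 * \<bar>C0 \<xi> - C1 \<xi>\<bar> * 1"
      using UV[of \<xi>] by (intro mult_left_mono) auto
    moreover have "((3 * C0 \<xi> + C1 \<xi>) * (1/4)) * U \<xi> = ((3 * C0 \<xi> + C1 \<xi>) * U \<xi>) * (1/4)"
      by (simp only: mult_ac)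
    ultimately show ?thesis unfolding distrib_right[of m] by linarith
  qed
  then have "avg I w (\<lambda>\<xi>. ((3 * C0 \<xi> + C1 \<xi>) * U \<xi>) * (1/4) - 3/4 * \<bar>C0 \<xi> - C1 \<xi>\<bar>) \<rho>
      \<le> avg I w (\<lambda>\<xi>. C0 \<xi> * max 0 (U \<xi> - V \<xi>) + C1 \<xi> * V \<xi>) \<rho>"
    by (intro avg_mono w)
  then have s2: "avg I w (\<lambda>\<xi>. (3 * c0 \<xi> + c1 \<xi>) * U \<xi>) \<rho> * (1/4) - 3/4 * avg I w (\<lambda>\<xi>. \<bar>C0 \<xi> - C1 \<xi>\<bar>) \<rho>
      \<le> avg I w (\<lambda>\<xi>. C0 \<xi> * max 0 (U \<xi> - V \<xi>)) \<rho> + avg I w (\<lambda>\<xi>. C1 \<xi> * V \<xi>) \<rho>"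
    by (simp only: avg_add avg_diff avg_cmult avg_multc p3)
  have "(3 * c0 \<xi> + c1 \<xi>) * u \<xi> - 4 * \<bar>u \<xi> - U \<xi>\<bar> \<le> (3 * c0 \<xi> + c1 \<xi>) * U \<xi>" for \<xi>
  proof -
    have "(3 * c0 \<xi> + c1 \<xi>) * (u \<xi> - U \<xi>) \<le> 4 * \<bar>u \<xi> - U \<xi>\<bar>"
      using c[of \<xi>] by (intro order_trans[OF mult_left_mono[OF abs_ge_self] mult_right_mono]) auto
    then show ?thesis by (simp add: algebra_simps)
  qed
  then have "avg I w (\<lambda>\<xi>. (3 * c0 \<xi> + c1 \<xi>) * u \<xi> - 4 * \<bar>u \<xi> - U \<xi>\<bar>) \<rho> \<le> avg I w (\<lambda>\<xi>. (3 * c0 \<xi> + c1 \<xi>) * U \<xi>) \<rho>"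
    by (intro avg_mono w)
  then have s3: "avg I w (\<lambda>\<xi>. (3 * c0 \<xi> + c1 \<xi>) * u \<xi>) \<rho> - 4 * avg I w (\<lambda>\<xi>. \<bar>u \<xi> - U \<xi>\<bar>) \<rho>
      \<le> avg I w (\<lambda>\<xi>. (3 * c0 \<xi> + c1 \<xi>) * U \<xi>) \<rho>"
    by (simp only: avg_diff avg_cmult)
  from s1 s2 s3 show ?thesis by (simp add: d)
qed

section \<open>The loss on a product event at one coordinate\<close>

lemma kavg_le_1:
  assumes "finite I" "\<And>c. is_weight (k c)" "\<And>x. \<phi> x \<le> 1"
  shows "kavg k I \<phi> \<rho> \<le> 1"
  unfolding kavg_def using assms by (intro avg_le) auto

lemma kavg_nonneg:
  assumes "\<And>c. is_weight (k c)" "\<And>x. 0 \<le> \<phi> x"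
  shows "0 \<le> kavg k I \<phi> \<rho>"
  unfolding kavg_def using assms by (intro avg_nonneg) auto

text \<open>\<open>avg_deviation\<close> reduces the claim to single coordinates, where replacing
  \<open>\<xi> j\<close> by a fresh value moves \<open>f\<close> by at most
  \<open>D j \<xi>\<close>.\<close>

lemma deviation_le:
  fixes \<delta> :: real
  assumes fin: "finite I" and J: "J \<subseteq> I" and w: "\<And>i. i \<in> I \<Longrightarrow> is_weight (w i)"
    and f: "\<And>j \<xi> s. j \<in> J \<Longrightarrow> \<bar>f \<xi> - f (\<xi>(j := s))\<bar> \<le> D j \<xi>"
    and D: "\<And>j. j \<in> J \<Longrightarrow> avg I w (D j) \<rho> \<le> \<delta>"
  shows "avg I w (\<lambda>\<xi>. \<bar>f \<xi> - avg J w f \<xi>\<bar>) \<rho> \<le> card J * \<delta>"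
proof -
  have "avg I w (\<lambda>\<xi>. \<bar>f \<xi> - avg {j} w f \<xi>\<bar>) \<rho> \<le> \<delta>" if j: "j \<in> J" for j
  proof -
    have wj: "is_weight (w j)" using w J j by auto
    have "\<bar>f \<xi> - avg {j} w f \<xi>\<bar> \<le> D j \<xi>" for \<xi>
    proof -
      have "f \<xi> - avg {j} w f \<xi> = (\<Sum>s\<in>UNIV. w j s * (f \<xi> - f (\<xi>(j := s))))"
        using is_weight_sum[OF wj]
        by (simp add: avg_singleton right_diff_distrib sum_subtractf sum_distrib_right[symmetric])
      also have "\<bar>\<dots>\<bar> \<le> (\<Sum>s\<in>UNIV. \<bar>w j s * (f \<xi> - f (\<xi>(j := s)))\<bar>)" by (rule sum_abs)
      also have "\<dots> \<le> (\<Sum>s\<in>UNIV. w j s * D j \<xi>)"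
        using f[OF j, of \<xi>] is_weight_nonneg[OF wj] by (intro sum_mono) (simp add: abs_mult mult_left_mono)
      also have "\<dots> = D j \<xi>" using is_weight_sum[OF wj] by (simp add: sum_distrib_right[symmetric])
      finally show ?thesis .
    qed
    then have "avg I w (\<lambda>\<xi>. \<bar>f \<xi> - avg {j} w f \<xi>\<bar>) \<rho> \<le> avg I w (D j) \<rho>"
      by (intro avg_mono w)
    with D[OF j] show ?thesis by simp
  qed
  then have "(\<Sum>j\<in>J. avg I w (\<lambda>\<xi>. \<bar>f \<xi> - avg {j} w f \<xi>\<bar>) \<rho>) \<le> card J * \<delta>"
    by (intro order_trans[OF sum_bounded_above]) auto
  with avg_deviation[where I = I and J = J and w = w and f = f and \<rho> = \<rho>, OF fin J w] show ?thesis by simp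
qed

lemma prod_diff_le:
  fixes a b a' b' :: real
  assumes "0 \<le> b" "b \<le> 1" "0 \<le> a'" "a' \<le> 1"
  shows "\<bar>a * b - a' * b'\<bar> \<le> \<bar>a - a'\<bar> + \<bar>b - b'\<bar>"
proof -
  have "a * b - a' * b' = (a - a') * b + a' * (b - b')" by (simp add: algebra_simps)
  also have "\<bar>\<dots>\<bar> \<le> \<bar>a - a'\<bar> * b + a' * \<bar>b - b'\<bar>"
    using assms abs_triangle_ineq[of "(a - a') * b" "a' * (b - b')"] by (simp add: abs_mult)
  also have "\<dots> \<le> \<bar>a - a'\<bar> * 1 + 1 * \<bar>b - b'\<bar>"
    using assms by (intro add_mono mult_left_mono mult_right_mono) auto
  finally show ?thesis by simp
qed

text \<open>With the extra predicate \<open>L\<close>, a product event and its winning and losing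
  parts share one notation. Nothing is normalised, so null events need no special care.\<close>

definition event_prob :: "'i set \<Rightarrow> ('i \<Rightarrow> bool) set \<Rightarrow> ('i \<Rightarrow> bool) set \<Rightarrow> ('i \<Rightarrow> bool) set \<Rightarrow>
    (('i \<Rightarrow> bool) \<Rightarrow> ('i \<Rightarrow> bool) \<Rightarrow> bool) \<Rightarrow> real" where
  "event_prob I A B C L = Ecoin I (\<lambda>x. Ecoin I (\<lambda>y.
     of_bool (x \<in> A \<and> y \<in> B \<and> (\<lambda>j. x j \<and> y j) \<in> C \<and> L x y)))"

definition ans :: "('x \<Rightarrow> 'a) \<Rightarrow> 'x set \<Rightarrow> 'a \<Rightarrow> 'x \<Rightarrow> real" where
  "ans f A \<alpha> x = of_bool (x \<in> A \<and> f x = \<alpha>)"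

lemma ans01: "0 \<le> ans f A \<alpha> x" "ans f A \<alpha> x \<le> 1"
  by (auto simp: ans_def)

text \<open>Given the cells, \<open>four_answers_lose\<close> yields a loss of at least
  \<open>u - v - e\<close> on the questions with \<open>z i = 0\<close>, and hopeless answers yield
  a loss of at least \<open>v\<close> at \<open>z i = 1\<close>; \<open>combine_hidden\<close> joins
  the two. The hypotheses control the errors: \<open>self\<close> bounds \<open>e\<close>,
  \<open>X0\<close> and \<open>Y0\<close> bound the deviation of \<open>u\<close>, \<open>X1\<close>
  and \<open>Y1\<close> that of \<open>v\<close>.\<close>

lemma loss_at_hidden_coordinate:
  fixes F :: "('i \<Rightarrow> bool) \<Rightarrow> 'a" and G :: "('i \<Rightarrow> bool) \<Rightarrow> 'b" and H :: "('i \<Rightarrow> bool) \<Rightarrow> 'c"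
    and V :: "bool \<Rightarrow> bool \<Rightarrow> 'a \<Rightarrow> 'b \<Rightarrow> 'c \<Rightarrow> bool" and \<eta> :: real
  assumes fin: "finite I" "finite AS" "finite BS" and i: "i \<in> I" and J: "J \<subseteq> I - {i}"
    and FGH: "\<And>x. F x \<in> AS" "\<And>y. G y \<in> BS" "\<And>z. H z \<in> CS"
    and lose: "\<And>\<alpha>0 \<alpha>1 \<beta>0 \<beta>1 \<gamma>0 \<gamma>1. \<lbrakk>\<alpha>0 \<in> AS; \<alpha>1 \<in> AS; \<beta>0 \<in> BS; \<beta>1 \<in> BS; \<gamma>0 \<in> CS; \<gamma>1 \<in> CS;
        V False False \<alpha>0 \<beta>0 \<gamma>0; V True False \<alpha>1 \<beta>0 \<gamma>0; V False True \<alpha>0 \<beta>1 \<gamma>0; V True True \<alpha>1 \<beta>1 \<gamma>1\<rbrakk> \<Longrightarrow> False"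
    and self: "Ecell I (\<lambda>\<rho>. \<bar>kdiff kerX I i (indicat_real A) \<rho>\<bar>) \<le> \<eta>" "Ecell I (\<lambda>\<rho>. \<bar>kdiff kerY I i (indicat_real B) \<rho>\<bar>) \<le> \<eta>"
    and X0: "\<And>j. j \<in> J \<Longrightarrow> Ecell I (\<lambda>\<rho>. \<bar>kdiff kerX I j (\<lambda>x. indicat_real A (x(i := False))) \<rho>\<bar>) \<le> \<eta>"
    and X1: "\<And>j \<alpha>. j \<in> J \<Longrightarrow> \<alpha> \<in> AS \<Longrightarrow> Ecell I (\<lambda>\<rho>. \<bar>kdiff kerX I j (\<lambda>x. ans F A \<alpha> (x(i := True))) \<rho>\<bar>) \<le> \<eta>"
    and Y0: "\<And>j. j \<in> J \<Longrightarrow> Ecell I (\<lambda>\<rho>. \<bar>kdiff kerY I j (\<lambda>y. indicat_real B (y(i := False))) \<rho>\<bar>) \<le> \<eta>"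
    and Y1: "\<And>j \<beta>. j \<in> J \<Longrightarrow> \<beta> \<in> BS \<Longrightarrow> Ecell I (\<lambda>\<rho>. \<bar>kdiff kerY I j (\<lambda>y. ans G B \<beta> (y(i := True))) \<rho>\<bar>) \<le> \<eta>"
  shows "event_prob I A B C (\<lambda>x y. True)
     - 3/4 * Ecell I (\<lambda>\<rho>. \<bar>avg J (\<lambda>_. cellw) (\<lambda>\<xi>. indicat_real C ((zpart \<xi>)(i := False))) \<rho>
                         - avg J (\<lambda>_. cellw) (\<lambda>\<xi>. indicat_real C ((zpart \<xi>)(i := True))) \<rho>\<bar>)
     - 4 * card J * \<eta> * (1 + card AS * card BS) - 4 * \<eta>
     \<le> 4 * event_prob I A B C (\<lambda>x y. \<not> V (x i) (y i) (F x) (G y) (H (\<lambda>j. x j \<and> y j)))"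
proof -
  define a where "a b \<alpha> \<rho> = kavg kerX I (\<lambda>x. ans F A \<alpha> (x(i := b))) \<rho>" for b \<alpha> \<rho>
  define b where "b t \<beta> \<rho> = kavg kerY I (\<lambda>y. ans G B \<beta> (y(i := t))) \<rho>" for t \<beta> \<rho>
  define a' where "a' s \<rho> = kavg kerX I (\<lambda>x. indicat_real A (x(i := s))) \<rho>" for s \<rho>
  define b' where "b' t \<rho> = kavg kerY I (\<lambda>y. indicat_real B (y(i := t))) \<rho>" for t \<rho>
  define c where "c t \<rho> = indicat_real C ((zpart \<rho>)(i := t))" for t and \<rho> :: "'i \<Rightarrow> cell"
  define S where "S l f g = (\<Sum>\<alpha>\<in>AS. \<Sum>\<beta>\<in>BS. of_bool (l \<alpha> \<beta>) * (f \<alpha> * g \<beta> :: real))" for l :: "'a \<Rightarrow> 'b \<Rightarrow> bool" and f g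
  \<comment> \<open>Demanding defeat against every \<open>\<gamma>\<close> frees \<open>v\<close>
    from the third player's answer, so that the cells enter \<open>v\<close> only through
    \<open>a\<close> and \<open>b\<close>. This is why \<open>v\<close> is insensitive to
    \<open>J\<close>.\<close>
  define bad where "bad \<alpha> \<beta> \<longleftrightarrow> (\<forall>\<gamma>\<in>CS. \<not> V True True \<alpha> \<beta> \<gamma>)" for \<alpha> \<beta>
  define l where "l s t \<rho> \<alpha> \<beta> \<longleftrightarrow> \<not> V s t \<alpha> \<beta> (H ((zpart \<rho>)(i := s \<and> t)))" for s t \<alpha> \<beta> and \<rho> :: "'i \<Rightarrow> cell"
  define u where "u \<rho> = a' False \<rho> * b' False \<rho>" for \<rho>
  define v where "v \<rho> = S bad (\<lambda>\<alpha>. a True \<alpha> \<rho>) (\<lambda>\<beta>. b True \<beta> \<rho>)" for \<rho>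
  define e where "e \<rho> = \<bar>a' True \<rho> - a' False \<rho>\<bar> + \<bar>b' True \<rho> - b' False \<rho>\<bar>" for \<rho>
  note ind01 = indicator_pos_le indicator_le_1
  have a01: "0 \<le> a s \<alpha> \<rho>" "a s \<alpha> \<rho> \<le> 1" "0 \<le> a' s \<rho>" "a' s \<rho> \<le> 1" for s \<alpha> \<rho>
    unfolding a_def a'_def using fin ans01 ind01 by (auto intro!: kavg_nonneg kavg_le_1)
  have b01: "0 \<le> b s \<alpha> \<rho>" "b s \<alpha> \<rho> \<le> 1" "0 \<le> b' s \<rho>" "b' s \<rho> \<le> 1" for s \<alpha> \<rho>
    unfolding b_def b'_def using fin ans01 ind01 by (auto intro!: kavg_nonneg kavg_le_1)
  have c01: "0 \<le> c s \<rho>" "c s \<rho> \<le> 1" for s \<rho> unfolding c_def by (auto simp: ind01)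
  have sum_a: "(\<Sum>\<alpha>\<in>AS. a s \<alpha> \<rho>) = a' s \<rho>" for s \<rho>
  proof -
    have "(\<Sum>\<alpha>\<in>AS. ans F A \<alpha> x) = indicat_real A x" for x
      using fin(2) FGH(1)[of x] by (auto simp: ans_def indicator_def)
    then show ?thesis by (simp add: a_def a'_def kavg_def avg_sum[symmetric])
  qed
  have sum_b: "(\<Sum>\<beta>\<in>BS. b s \<beta> \<rho>) = b' s \<rho>" for s \<rho>
  proof -
    have "(\<Sum>\<beta>\<in>BS. ans G B \<beta> x) = indicat_real B x" for x
      using fin(3) FGH(2)[of x] by (auto simp: ans_def indicator_def)
    then show ?thesis by (simp add: b_def b'_def kavg_def avg_sum[symmetric])
  qed
  have kavg2: "kavg kerX I (\<lambda>x. kavg kerY I (\<lambda>y. t * (f x * g y)) \<rho>) \<rho> = t * (kavg kerX I f \<rho> * kavg kerY I g \<rho>)"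
    for t f g \<rho> by (simp add: kavg_def avg_cmult avg_multc)
  have P: "4 * event_prob I A B C (\<lambda>x y. True) = Ecell I (\<lambda>\<rho>. \<Sum>s\<in>UNIV. \<Sum>t\<in>UNIV. c (s \<and> t) \<rho> * (a' s \<rho> * b' t \<rho>))"
  proof -
    have "event_prob I A B C (\<lambda>x y. True) = Ecoin I (\<lambda>x. Ecoin I (\<lambda>y. indicat_real C (\<lambda>j. x j \<and> y j) * (indicat_real A x * indicat_real B y)))"
      unfolding event_prob_def indicator_def of_bool_conj[symmetric] by (simp add: conj_ac)
    then show ?thesis
      using decoupling_at[OF fin(1) i, of "\<lambda>x y z. indicat_real C z * (indicat_real A x * indicat_real B y)"]
      by (simp add: kavg2 c_def a'_def b'_def)
  qed
  have L: "4 * event_prob I A B C (\<lambda>x y. \<not> V (x i) (y i) (F x) (G y) (H (\<lambda>j. x j \<and> y j))) =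
    Ecell I (\<lambda>\<rho>. \<Sum>s\<in>UNIV. \<Sum>t\<in>UNIV. c (s \<and> t) \<rho> * S (l s t \<rho>) (\<lambda>\<alpha>. a s \<alpha> \<rho>) (\<lambda>\<beta>. b t \<beta> \<rho>))"
  proof -
    \<comment> \<open>Summing over the possible answers turns the loss into products of a function
      of \<open>x\<close>, a function of \<open>y\<close> and a function of \<open>z\<close>, to
      which independence given the cells applies.\<close>
    define \<Psi> where "\<Psi> x y z = indicat_real C z * (\<Sum>\<alpha>\<in>AS. \<Sum>\<beta>\<in>BS. of_bool (\<not> V (x i) (y i) \<alpha> \<beta> (H z)) * (ans F A \<alpha> x * ans G B \<beta> y))" for x y z
    have "(\<Sum>\<alpha>\<in>AS. \<Sum>\<beta>\<in>BS. of_bool (\<not> V (x i) (y i) \<alpha> \<beta> (H z)) * (ans F A \<alpha> x * ans G B \<beta> y)) =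
      indicat_real A x * indicat_real B y * of_bool (\<not> V (x i) (y i) (F x) (G y) (H z))" for x y z
    proof -
      define t :: real where "t = indicat_real A x * indicat_real B y * of_bool (\<not> V (x i) (y i) (F x) (G y) (H z))"
      have "(\<Sum>\<beta>\<in>BS. of_bool (\<not> V (x i) (y i) \<alpha> \<beta> (H z)) * (ans F A \<alpha> x * ans G B \<beta> y)) = (if \<alpha> = F x then t else 0)" for \<alpha>
      proof -
        have "(\<Sum>\<beta>\<in>BS. of_bool (\<not> V (x i) (y i) \<alpha> \<beta> (H z)) * (ans F A \<alpha> x * ans G B \<beta> y)) =
          (\<Sum>\<beta>\<in>BS. if \<beta> = G y then (if \<alpha> = F x then t else 0) else 0)"
          by (intro sum.cong refl) (simp add: ans_def t_def indicator_def)
        then show ?thesis using fin(3) FGH(2) by simp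
      qed
      then show ?thesis using fin(2) FGH(1) by (simp add: t_def)
    qed
    then have \<Psi>: "\<Psi> x y z = of_bool (x \<in> A \<and> y \<in> B \<and> z \<in> C \<and> \<not> V (x i) (y i) (F x) (G y) (H z))" for x y z
      by (simp add: \<Psi>_def indicator_def)
    have "kavg kerX I (\<lambda>x. kavg kerY I (\<lambda>y. \<Psi> (x(i := s)) (y(i := t)) ((zpart \<rho>)(i := s \<and> t))) \<rho>) \<rho> =
      c (s \<and> t) \<rho> * S (l s t \<rho>) (\<lambda>\<alpha>. a s \<alpha> \<rho>) (\<lambda>\<beta>. b t \<beta> \<rho>)" for s t \<rho>
      by (simp add: \<Psi>_def S_def l_def a_def b_def c_def kavg_def avg_sum avg_cmult avg_multc)
    then show ?thesis
      using decoupling_at[OF fin(1) i, of \<Psi>] by (simp add: \<Psi> event_prob_def)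
  qed
  have S_nonneg: "0 \<le> S m (\<lambda>\<alpha>. a s \<alpha> \<rho>) (\<lambda>\<beta>. b t \<beta> \<rho>)" for m s t \<rho>
    unfolding S_def using a01 b01 by (intro sum_nonneg) auto
  have four: "u \<rho> - e \<rho> \<le> S (l False False \<rho>) (\<lambda>\<alpha>. a False \<alpha> \<rho>) (\<lambda>\<beta>. b False \<beta> \<rho>)
      + S (l True False \<rho>) (\<lambda>\<alpha>. a True \<alpha> \<rho>) (\<lambda>\<beta>. b False \<beta> \<rho>)
      + S (l False True \<rho>) (\<lambda>\<alpha>. a False \<alpha> \<rho>) (\<lambda>\<beta>. b True \<beta> \<rho>) + v \<rho>" for \<rho>
  proof -
    \<comment> \<open>The three questions with \<open>z i = 0\<close> meet the same third answer
      \<open>H ((zpart \<rho>)(i := False))\<close>. If all three are won, \<open>lose\<close> rules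
      out every \<open>\<gamma>\<close> at \<open>(1, 1)\<close>.\<close>
    have "l False False \<rho> \<alpha>0 \<beta>0 \<or> l True False \<rho> \<alpha>1 \<beta>0 \<or> l False True \<rho> \<alpha>0 \<beta>1 \<or> bad \<alpha>1 \<beta>1"
      if "\<alpha>0 \<in> AS" "\<alpha>1 \<in> AS" "\<beta>0 \<in> BS" "\<beta>1 \<in> BS" for \<alpha>0 \<alpha>1 \<beta>0 \<beta>1
      using lose[OF that FGH(3)[of "(zpart \<rho>)(i := False)"]] unfolding l_def bad_def by auto
    then show ?thesis
      using four_answers_lose[of "\<lambda>\<alpha>. a False \<alpha> \<rho>" "\<lambda>\<alpha>. a True \<alpha> \<rho>" "\<lambda>\<beta>. b False \<beta> \<rho>" "\<lambda>\<beta>. b True \<beta> \<rho>" AS BS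
          "l False False \<rho>" "l True False \<rho>" "l False True \<rho>" bad]
      by (simp add: a01 b01 sum_a sum_b u_def v_def e_def S_def)
  qed
  have S11: "v \<rho> \<le> S (l True True \<rho>) (\<lambda>\<alpha>. a True \<alpha> \<rho>) (\<lambda>\<beta>. b True \<beta> \<rho>)" for \<rho>
    unfolding v_def S_def using a01 b01 FGH(3)
    by (intro sum_mono mult_right_mono) (auto simp: bad_def l_def)
  have u01: "0 \<le> u \<rho>" "u \<rho> \<le> 1" for \<rho> unfolding u_def using a01 b01 by (auto intro: mult_le_one)
  have v0: "0 \<le> v \<rho>" for \<rho> unfolding v_def by (rule S_nonneg)
  have e0: "0 \<le> e \<rho>" for \<rho> unfolding e_def by simp
  \<comment> \<open>The first three losses share the factor \<open>c False\<close> and the last has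
    \<open>c True\<close>; since losses are nonnegative, the lower bound from \<open>four\<close>
    may be cut off at 0.\<close>
  have lower: "c False \<rho> * max 0 (u \<rho> - v \<rho> - e \<rho>) + c True \<rho> * v \<rho> \<le>
      (\<Sum>s\<in>UNIV. \<Sum>t\<in>UNIV. c (s \<and> t) \<rho> * S (l s t \<rho>) (\<lambda>\<alpha>. a s \<alpha> \<rho>) (\<lambda>\<beta>. b t \<beta> \<rho>))" for \<rho>
  proof -
    have "c False \<rho> * max 0 (u \<rho> - v \<rho> - e \<rho>) \<le> c False \<rho> *
       (S (l False False \<rho>) (\<lambda>\<alpha>. a False \<alpha> \<rho>) (\<lambda>\<beta>. b False \<beta> \<rho>)
      + S (l True False \<rho>) (\<lambda>\<alpha>. a True \<alpha> \<rho>) (\<lambda>\<beta>. b False \<beta> \<rho>)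
      + S (l False True \<rho>) (\<lambda>\<alpha>. a False \<alpha> \<rho>) (\<lambda>\<beta>. b True \<beta> \<rho>))"
      using four[of \<rho>] by (intro mult_left_mono c01) (auto intro!: add_nonneg_nonneg S_nonneg)
    moreover have "c True \<rho> * v \<rho> \<le> c True \<rho> * S (l True True \<rho>) (\<lambda>\<alpha>. a True \<alpha> \<rho>) (\<lambda>\<beta>. b True \<beta> \<rho>)"
      by (intro mult_left_mono c01 S11)
    ultimately show ?thesis by (simp add: UNIV_bool algebra_simps)
  qed
  have upper: "(\<Sum>s\<in>UNIV. \<Sum>t\<in>UNIV. c (s \<and> t) \<rho> * (a' s \<rho> * b' t \<rho>)) \<le>
      (3 * c False \<rho> + c True \<rho>) * u \<rho> + 4 * e \<rho>" for \<rho>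
  proof -
    have "a' s \<rho> * b' t \<rho> \<le> u \<rho> + e \<rho>" for s t
      using prod_diff_le[of "b' t \<rho>" "a' False \<rho>" "a' s \<rho>" "b' False \<rho>"] a01(3,4)[of False \<rho>] b01(3,4)[of t \<rho>]
      unfolding u_def e_def by (cases s; cases t) auto
    then have "c r \<rho> * (a' s \<rho> * b' t \<rho>) \<le> c r \<rho> * u \<rho> + e \<rho>" for r s t
      using mult_left_mono[of "a' s \<rho> * b' t \<rho>" "u \<rho> + e \<rho>" "c r \<rho>"] c01[of r \<rho>]
        mult_left_le_one_le[OF e0[of \<rho>] c01[of r \<rho>]] by (simp add: distrib_left)
    from this[of False False False] this[of False True False] this[of False False True] this[of True True True]
    show ?thesis by (simp add: UNIV_bool algebra_simps)
  qed
  have Ee: "Ecell I e \<le> 2 * \<eta>"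
  proof -
    have "e = (\<lambda>\<rho>. \<bar>kdiff kerX I i (indicat_real A) \<rho>\<bar> + \<bar>kdiff kerY I i (indicat_real B) \<rho>\<bar>)"
      by (simp add: fun_eq_iff e_def kdiff_def a'_def b'_def)
    then have "Ecell I e = Ecell I (\<lambda>\<rho>. \<bar>kdiff kerX I i (indicat_real A) \<rho>\<bar>) + Ecell I (\<lambda>\<rho>. \<bar>kdiff kerY I i (indicat_real B) \<rho>\<bar>)"
      by (simp add: avg_add)
    with self show ?thesis by simp
  qed
  have JI: "J \<subseteq> I" using J by auto
  have chg_a: "\<bar>a s \<alpha> \<rho> - a s \<alpha> (\<rho>(j := x))\<bar> \<le> \<bar>kdiff kerX I j (\<lambda>x. ans F A \<alpha> (x(i := s))) \<rho>\<bar>"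
    and chg_a': "\<bar>a' s \<rho> - a' s (\<rho>(j := x))\<bar> \<le> \<bar>kdiff kerX I j (\<lambda>x. indicat_real A (x(i := s))) \<rho>\<bar>"
    and chg_b: "\<bar>b s \<beta> \<rho> - b s \<beta> (\<rho>(j := x))\<bar> \<le> \<bar>kdiff kerY I j (\<lambda>x. ans G B \<beta> (x(i := s))) \<rho>\<bar>"
    and chg_b': "\<bar>b' s \<rho> - b' s (\<rho>(j := x))\<bar> \<le> \<bar>kdiff kerY I j (\<lambda>x. indicat_real B (x(i := s))) \<rho>\<bar>"
    if "j \<in> J" for s \<alpha> \<beta> \<rho> j x
    unfolding a_def a'_def b_def b'_def using that JI by (auto intro!: kavg_change fin)
  have Eu: "Ecell I (\<lambda>\<rho>. \<bar>u \<rho> - avg J (\<lambda>_. cellw) u \<rho>\<bar>) \<le> card J * (2 * \<eta>)"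
  proof (rule deviation_le[where D = "\<lambda>j \<rho>. \<bar>kdiff kerX I j (\<lambda>x. indicat_real A (x(i := False))) \<rho>\<bar> + \<bar>kdiff kerY I j (\<lambda>x. indicat_real B (x(i := False))) \<rho>\<bar>"])
    fix j \<rho> s assume j: "j \<in> J"
    show "\<bar>u \<rho> - u (\<rho>(j := s))\<bar> \<le> \<bar>kdiff kerX I j (\<lambda>x. indicat_real A (x(i := False))) \<rho>\<bar> + \<bar>kdiff kerY I j (\<lambda>x. indicat_real B (x(i := False))) \<rho>\<bar>"
      using prod_diff_le[of "b' False \<rho>" "a' False (\<rho>(j := s))" "a' False \<rho>" "b' False (\<rho>(j := s))"]
        chg_a'[OF j, of False \<rho> s] chg_b'[OF j, of False \<rho> s] a01 b01 unfolding u_def by fastforce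
  next
    fix j assume "j \<in> J"
    then show "Ecell I (\<lambda>\<rho>. \<bar>kdiff kerX I j (\<lambda>x. indicat_real A (x(i := False))) \<rho>\<bar> + \<bar>kdiff kerY I j (\<lambda>x. indicat_real B (x(i := False))) \<rho>\<bar>) \<le> 2 * \<eta>"
      using X0[of j] Y0[of j] by (simp add: avg_add)
  qed (use fin JI in auto)
  have Ev: "Ecell I (\<lambda>\<rho>. \<bar>v \<rho> - avg J (\<lambda>_. cellw) v \<rho>\<bar>) \<le> card J * (card AS * (card BS * (2 * \<eta>)))"
  proof (rule deviation_le[where D = "\<lambda>j \<rho>. \<Sum>\<alpha>\<in>AS. \<Sum>\<beta>\<in>BS. \<bar>kdiff kerX I j (\<lambda>x. ans F A \<alpha> (x(i := True))) \<rho>\<bar> + \<bar>kdiff kerY I j (\<lambda>x. ans G B \<beta> (x(i := True))) \<rho>\<bar>"])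
    fix j \<rho> s assume j: "j \<in> J"
    have "\<bar>v \<rho> - v (\<rho>(j := s))\<bar> \<le> (\<Sum>\<alpha>\<in>AS. \<Sum>\<beta>\<in>BS. \<bar>of_bool (bad \<alpha> \<beta>) * (a True \<alpha> \<rho> * b True \<beta> \<rho> - a True \<alpha> (\<rho>(j := s)) * b True \<beta> (\<rho>(j := s)))\<bar>)"
      unfolding v_def S_def sum_subtractf[symmetric] right_diff_distrib[symmetric]
      by (intro order_trans[OF sum_abs] sum_mono sum_abs)
    also have "\<dots> \<le> (\<Sum>\<alpha>\<in>AS. \<Sum>\<beta>\<in>BS. \<bar>kdiff kerX I j (\<lambda>x. ans F A \<alpha> (x(i := True))) \<rho>\<bar> + \<bar>kdiff kerY I j (\<lambda>x. ans G B \<beta> (x(i := True))) \<rho>\<bar>)"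
    proof (intro sum_mono)
      fix \<alpha> \<beta>
      have "\<bar>a True \<alpha> \<rho> * b True \<beta> \<rho> - a True \<alpha> (\<rho>(j := s)) * b True \<beta> (\<rho>(j := s))\<bar> \<le>
          \<bar>a True \<alpha> \<rho> - a True \<alpha> (\<rho>(j := s))\<bar> + \<bar>b True \<beta> \<rho> - b True \<beta> (\<rho>(j := s))\<bar>"
        by (rule prod_diff_le) (simp_all add: a01 b01)
      also have "\<dots> \<le> \<bar>kdiff kerX I j (\<lambda>x. ans F A \<alpha> (x(i := True))) \<rho>\<bar> + \<bar>kdiff kerY I j (\<lambda>x. ans G B \<beta> (x(i := True))) \<rho>\<bar>"
        by (intro add_mono chg_a chg_b j)
      finally show "\<bar>of_bool (bad \<alpha> \<beta>) * (a True \<alpha> \<rho> * b True \<beta> \<rho> - a True \<alpha> (\<rho>(j := s)) * b True \<beta> (\<rho>(j := s)))\<bar> \<le>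
          \<bar>kdiff kerX I j (\<lambda>x. ans F A \<alpha> (x(i := True))) \<rho>\<bar> + \<bar>kdiff kerY I j (\<lambda>x. ans G B \<beta> (x(i := True))) \<rho>\<bar>"
        by (simp add: abs_mult)
    qed
    finally show "\<bar>v \<rho> - v (\<rho>(j := s))\<bar> \<le> \<dots>" .
  next
    fix j assume j: "j \<in> J"
    have "Ecell I (\<lambda>\<rho>. \<Sum>\<alpha>\<in>AS. \<Sum>\<beta>\<in>BS. \<bar>kdiff kerX I j (\<lambda>x. ans F A \<alpha> (x(i := True))) \<rho>\<bar> + \<bar>kdiff kerY I j (\<lambda>x. ans G B \<beta> (x(i := True))) \<rho>\<bar>)
       \<le> (\<Sum>\<alpha>\<in>AS. \<Sum>\<beta>\<in>BS. 2 * \<eta>)"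
      unfolding avg_sum using X1[OF j] Y1[OF j] by (intro sum_mono) (simp add: avg_add add_mono[of _ \<eta> _ \<eta>, simplified])
    then show "Ecell I (\<lambda>\<rho>. \<Sum>\<alpha>\<in>AS. \<Sum>\<beta>\<in>BS. \<bar>kdiff kerX I j (\<lambda>x. ans F A \<alpha> (x(i := True))) \<rho>\<bar> + \<bar>kdiff kerY I j (\<lambda>x. ans G B \<beta> (x(i := True))) \<rho>\<bar>)
       \<le> card AS * (card BS * (2 * \<eta>))" by simp
  qed (use fin JI in auto)
  have "Ecell I (\<lambda>\<xi>. (3 * c False \<xi> + c True \<xi>) * u \<xi>) / 4
     - 3/4 * Ecell I (\<lambda>\<xi>. \<bar>avg J (\<lambda>_. cellw) (c False) \<xi> - avg J (\<lambda>_. cellw) (c True) \<xi>\<bar>)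
     - 2 * Ecell I (\<lambda>\<xi>. \<bar>u \<xi> - avg J (\<lambda>_. cellw) u \<xi>\<bar>) - 2 * Ecell I (\<lambda>\<xi>. \<bar>v \<xi> - avg J (\<lambda>_. cellw) v \<xi>\<bar>) - Ecell I e
    \<le> Ecell I (\<lambda>\<xi>. c False \<xi> * max 0 (u \<xi> - v \<xi> - e \<xi>) + c True \<xi> * v \<xi>)"
    by (rule combine_hidden) (simp_all add: fin JI u01 v0 e0 c01)
  also have "\<dots> \<le> 4 * event_prob I A B C (\<lambda>x y. \<not> V (x i) (y i) (F x) (G y) (H (\<lambda>j. x j \<and> y j)))"
    unfolding L by (intro avg_mono lower) simp
  finally have main: "Ecell I (\<lambda>\<xi>. (3 * c False \<xi> + c True \<xi>) * u \<xi>) / 4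
     - 3/4 * Ecell I (\<lambda>\<xi>. \<bar>avg J (\<lambda>_. cellw) (c False) \<xi> - avg J (\<lambda>_. cellw) (c True) \<xi>\<bar>)
     - 2 * Ecell I (\<lambda>\<xi>. \<bar>u \<xi> - avg J (\<lambda>_. cellw) u \<xi>\<bar>) - 2 * Ecell I (\<lambda>\<xi>. \<bar>v \<xi> - avg J (\<lambda>_. cellw) v \<xi>\<bar>) - Ecell I e
    \<le> 4 * event_prob I A B C (\<lambda>x y. \<not> V (x i) (y i) (F x) (G y) (H (\<lambda>j. x j \<and> y j)))" .
  \<comment> \<open>\<open>Ecell I e\<close> is paid once here and once in \<open>main\<close>,
    which accounts for the final \<open>4 * \<eta>\<close>.\<close>
  have "4 * event_prob I A B C (\<lambda>x y. True) \<le> Ecell I (\<lambda>\<rho>. (3 * c False \<rho> + c True \<rho>) * u \<rho> + 4 * e \<rho>)"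
    unfolding P by (intro avg_mono upper) simp
  then have "event_prob I A B C (\<lambda>x y. True) \<le> Ecell I (\<lambda>\<rho>. (3 * c False \<rho> + c True \<rho>) * u \<rho>) / 4 + Ecell I e"
    by (simp add: avg_add avg_cmult)
  moreover have "4 * card J * \<eta> * (1 + card AS * card BS) = 2 * (card J * (2 * \<eta>)) + 2 * (card J * (card AS * (card BS * (2 * \<eta>))))"
    by (simp add: algebra_simps)
  moreover have "(\<lambda>\<xi>. indicat_real C ((zpart \<xi>)(i := t))) = c t" for t by (simp add: c_def fun_eq_iff)
  ultimately show ?thesis using main Eu Ev Ee by simp
qed

section \<open>A hard coordinate\<close>

text \<open>Greedy choice in a directed graph. If all out-degrees are at most \<open>d\<close>, so
  is the average in-degree, hence some vertex has at most \<open>2 * d\<close> neighbours in both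
  directions together. Keeping it and deleting these consumes at most \<open>2 * d + 1\<close>
  vertices.\<close>

lemma independent_set:
  assumes "finite V" "\<And>i. i \<in> V \<Longrightarrow> card {j\<in>V. R i j} \<le> d" "k * (2 * d + 1) \<le> card V"
  shows "\<exists>J\<subseteq>V. card J = k \<and> (\<forall>i\<in>J. \<forall>j\<in>J. i \<noteq> j \<longrightarrow> \<not> R i j)"
  using assms
proof (induction k arbitrary: V)
  case 0
  then show ?case by (intro exI[of _ "{}"]) simp
next
  case (Suc k)
  have "(\<Sum>j\<in>V. card {i\<in>V. R i j}) = (\<Sum>i\<in>V. card {j\<in>V. R i j})"
  proof -
    have "card {i\<in>V. Q i} = (\<Sum>i\<in>V. of_bool (Q i))" for Q
      using Suc.prems(1) by (simp add: Int_def)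
    then show ?thesis by (simp only:) (rule sum.swap)
  qed
  also have "\<dots> \<le> card V * d" using Suc.prems(2) by (intro order_trans[OF sum_bounded_above]) auto
  finally have indeg: "(\<Sum>j\<in>V. card {i\<in>V. R i j}) \<le> card V * d" .
  have "\<exists>v\<in>V. card {i\<in>V. R i v} \<le> d"
  proof (rule ccontr)
    assume "\<not> ?thesis"
    then have "(\<Sum>j\<in>V. Suc d) \<le> (\<Sum>j\<in>V. card {i\<in>V. R i j})" by (intro sum_mono) (simp add: not_le Suc_le_eq)
    then have "card V = 0" using indeg by simp
    then show False using Suc.prems(3) by simp
  qed
  then obtain v where v: "v \<in> V" "card {i\<in>V. R i v} \<le> d" by blast
  define N where "N = insert v ({i\<in>V. R i v} \<union> {j\<in>V. R v j})"
  have N: "N \<subseteq> V" "card N \<le> 2 * d + 1"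
  proof -
    have "card N \<le> Suc (card ({i\<in>V. R i v} \<union> {j\<in>V. R v j}))" unfolding N_def by (rule card_insert_le_m1) simp_all
    also have "card ({i\<in>V. R i v} \<union> {j\<in>V. R v j}) \<le> card {i\<in>V. R i v} + card {j\<in>V. R v j}" by (rule card_Un_le)
    finally show "card N \<le> 2 * d + 1" using v Suc.prems(2)[OF v(1)] by simp
  qed (use v in \<open>auto simp: N_def\<close>)
  have "card (V - N) = card V - card N" using N Suc.prems(1) by (intro card_Diff_subset) (auto intro: finite_subset)
  then have "k * (2 * d + 1) \<le> card (V - N)" using N(2) Suc.prems(3) by simp
  moreover have "card {j\<in>V - N. R i j} \<le> d" if "i \<in> V - N" for i
    using Suc.prems(1) that by (intro order_trans[OF card_mono Suc.prems(2)[of i]]) auto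
  ultimately obtain J where J: "J \<subseteq> V - N" "card J = k" "\<forall>i\<in>J. \<forall>j\<in>J. i \<noteq> j \<longrightarrow> \<not> R i j"
    using Suc.IH[of "V - N"] Suc.prems(1) by auto
  have "finite J" "v \<notin> J" using J Suc.prems(1) by (auto simp: N_def intro: finite_subset)
  then have "card (insert v J) = Suc k" using J by simp
  moreover have "\<forall>i\<in>insert v J. \<forall>j\<in>insert v J. i \<noteq> j \<longrightarrow> \<not> R i j"
    using J v(1) unfolding N_def by blast
  ultimately show ?case using J(1) v(1) by (intro exI[of _ "insert v J"]) auto
qed

text \<open>Markov's inequality for counting; 16 is the bound of
  \<open>influence_sum\<close>.\<close>

lemma few_influential:
  assumes "finite I" "\<eta> > 0" "(\<Sum>j\<in>I. e j) \<le> (16 :: real)" "\<And>j. 0 \<le> e j"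
  shows "card {j\<in>I. e j > \<eta>} \<le> 16 / \<eta>"
proof -
  have "card {j\<in>I. e j > \<eta>} * \<eta> = (\<Sum>j\<in>{j\<in>I. e j > \<eta>}. \<eta>)" by simp
  also have "\<dots> \<le> (\<Sum>j\<in>{j\<in>I. e j > \<eta>}. e j)" by (intro sum_mono) auto
  also have "\<dots> \<le> (\<Sum>j\<in>I. e j)" using assms by (intro sum_mono2) auto
  finally show ?thesis using assms by (simp add: field_simps)
qed

lemma event_prob_nonneg: "0 \<le> event_prob I A B C L"
  unfolding event_prob_def by (intro avg_nonneg) auto

lemma event_prob_le_1: "finite I \<Longrightarrow> event_prob I A B C L \<le> 1"
  unfolding event_prob_def by (intro avg_le) auto

lemma card_pair_Un_image_le: "finite S \<Longrightarrow> card ({f, g} \<union> h ` S) \<le> card S + 2"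
proof -
  assume "finite S"
  then have "card (h ` S) \<le> card S" by (rule card_image_le)
  moreover have "card {f, g} \<le> 2" by (simp add: card_insert_if)
  ultimately show ?thesis using card_Un_le[of "{f, g}" "h ` S"] by linarith
qed

text \<open>Put an edge from \<open>i\<close> to \<open>j\<close> if \<open>j\<close> influences a
  function that \<open>loss_at_hidden_coordinate\<close> needs at \<open>i\<close>. Out-degrees are
  bounded, so there is an edge-free set \<open>K\<close> of size \<open>k\<close>; a member on which
  the third player's event hardly depends becomes \<open>i\<close>, and the rest of \<open>K\<close>
  is hidden. With \<open>k\<close> of order \<open>1 / \<delta>^2\<close>, \<open>\<eta>\<close> of
  order \<open>\<delta>^3 / m\<close> and \<open>d\<close> of order \<open>m^3 / \<delta>^6\<close>,
  this takes about \<open>m^3 / \<delta>^8\<close> coordinates, as provided by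
  \<open>large\<close>.\<close>

lemma hard_coordinate:
  fixes F :: "'i \<Rightarrow> ('i \<Rightarrow> bool) \<Rightarrow> 'a" and G :: "'i \<Rightarrow> ('i \<Rightarrow> bool) \<Rightarrow> 'b" and H :: "'i \<Rightarrow> ('i \<Rightarrow> bool) \<Rightarrow> 'c"
    and V :: "bool \<Rightarrow> bool \<Rightarrow> 'a \<Rightarrow> 'b \<Rightarrow> 'c \<Rightarrow> bool"
    and \<delta> :: real
  assumes fin: "finite I" "finite AS" "finite BS"
    and FGH: "\<And>i x. F i x \<in> AS" "\<And>i y. G i y \<in> BS" "\<And>i z. H i z \<in> CS"
    and lose: "\<And>\<alpha>0 \<alpha>1 \<beta>0 \<beta>1 \<gamma>0 \<gamma>1. \<lbrakk>\<alpha>0 \<in> AS; \<alpha>1 \<in> AS; \<beta>0 \<in> BS; \<beta>1 \<in> BS; \<gamma>0 \<in> CS; \<gamma>1 \<in> CS;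
        V False False \<alpha>0 \<beta>0 \<gamma>0; V True False \<alpha>1 \<beta>0 \<gamma>0; V False True \<alpha>0 \<beta>1 \<gamma>0; V True True \<alpha>1 \<beta>1 \<gamma>1\<rbrakk> \<Longrightarrow> False"
    and m: "m = card AS * card BS"
    and \<delta>_eq: "\<delta> = event_prob I A B C (\<lambda>x y. True)" and \<delta>: "\<delta> > 0"
    and large: "3 * 96^3 * 33^3 * real m^3 \<le> real (card I) * \<delta>^8"
  shows "\<exists>i\<in>I. \<delta> / 8 \<le> event_prob I A B C (\<lambda>x y. \<not> V (x i) (y i) (F i x) (G i y) (H i (\<lambda>j. x j \<and> y j)))"
proof -
  have ne: "card AS \<ge> 1" "card BS \<ge> 1" using FGH fin by (auto simp: Suc_le_eq card_gt_0_iff)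
  then have m1: "m \<ge> 1" by (simp add: m)
  have \<delta>1: "\<delta> \<le> 1" using \<delta>_eq fin by (simp add: event_prob_le_1)
  \<comment> \<open>On average over \<open>K\<close>, the squared effect of \<open>z i\<close> on
    the third player's event is at most \<open>16 / (3 * k)\<close>; this \<open>k\<close> makes it
    at most \<open>\<delta>\<^sup>2 / 6\<close>.\<close>
  define k where "k = nat \<lceil>32 / \<delta>\<^sup>2\<rceil>"
  have k_ge: "32 / \<delta>\<^sup>2 \<le> k" unfolding k_def by linarith
  have "32 \<le> 32 / \<delta>\<^sup>2" using \<delta> \<delta>1 by (simp add: field_simps power_le_one)
  then have k32: "32 \<le> k" using k_ge by linarith
  have k_le: "k \<le> 33 / \<delta>\<^sup>2"
  proof -
    have "k \<le> 32 / \<delta>\<^sup>2 + 1" unfolding k_def using \<delta> by (simp add: of_nat_ceiling)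
    also have "\<dots> \<le> 33 / \<delta>\<^sup>2"
    proof -
      have "1 \<le> 1 / \<delta>\<^sup>2" using \<delta> \<delta>1 by (simp add: power_le_one)
      moreover have "33 / \<delta>\<^sup>2 = 32 / \<delta>\<^sup>2 + 1 / \<delta>\<^sup>2" by (simp add: add_divide_distrib[symmetric])
      ultimately show ?thesis by linarith
    qed
    finally show ?thesis .
  qed
  \<comment> \<open>The insensitivity errors add up to at most \<open>12 * k * m * \<eta>\<close>,
    which this choice turns into \<open>\<delta> / 8\<close>.\<close>
  define \<eta> where "\<eta> = \<delta> / (96 * k * m)"
  have \<eta>0: "\<eta> > 0" using \<delta> k32 m1 by (simp add: \<eta>_def)
  define \<Phi> where "\<Phi> i = {indicat_real A, \<lambda>x. indicat_real A (x(i := False))} \<union> (\<lambda>\<alpha> x. ans (F i) A \<alpha> (x(i := True))) ` AS" for i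
  define \<Gamma> where "\<Gamma> i = {indicat_real B, \<lambda>x. indicat_real B (x(i := False))} \<union> (\<lambda>\<beta> x. ans (G i) B \<beta> (x(i := True))) ` BS" for i
  define iX where "iX j \<phi> = Ecell I (\<lambda>\<rho>. (kdiff kerX I j \<phi> \<rho>)\<^sup>2)" for j \<phi>
  define iY where "iY j \<phi> = Ecell I (\<lambda>\<rho>. (kdiff kerY I j \<phi> \<rho>)\<^sup>2)" for j \<phi>
  define R where "R i j \<longleftrightarrow> (\<exists>\<phi>\<in>\<Phi> i. iX j \<phi> > \<eta>\<^sup>2) \<or> (\<exists>\<phi>\<in>\<Gamma> i. iY j \<phi> > \<eta>\<^sup>2)" for i j
  \<comment> \<open>\<open>\<Phi> i\<close> and \<open>\<Gamma> i\<close> contain at most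
    \<open>6 * m\<close> functions together, each with at most \<open>16 / \<eta>\<^sup>2\<close>
    influential coordinates.\<close>
  define d where "d = nat \<lfloor>96 * m / \<eta>\<^sup>2\<rfloor>"
  have outdeg: "card {j\<in>I. R i j} \<le> d" for i
  proof -
    have f: "finite (\<Phi> i)" "finite (\<Gamma> i)" unfolding \<Phi>_def \<Gamma>_def using fin by auto
    have c\<Phi>: "card (\<Phi> i) \<le> card AS + 2"
      unfolding \<Phi>_def by (rule card_pair_Un_image_le) (rule fin)
    have c\<Gamma>: "card (\<Gamma> i) \<le> card BS + 2"
      unfolding \<Gamma>_def by (rule card_pair_Un_image_le) (rule fin)
    have bX: "card {j\<in>I. iX j \<phi> > \<eta>\<^sup>2} \<le> 16 / \<eta>\<^sup>2" if "\<phi> \<in> \<Phi> i" for \<phi>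
    proof (rule few_influential)
      have "\<bar>\<phi> x\<bar> \<le> 1" for x using that by (auto simp: \<Phi>_def ans_def indicator_def)
      then show "(\<Sum>j\<in>I. iX j \<phi>) \<le> 16" unfolding iX_def using fin by (intro influence_sum_X)
    qed (use fin \<eta>0 in \<open>auto simp: iX_def intro!: avg_nonneg\<close>)
    have bY: "card {j\<in>I. iY j \<phi> > \<eta>\<^sup>2} \<le> 16 / \<eta>\<^sup>2" if "\<phi> \<in> \<Gamma> i" for \<phi>
    proof (rule few_influential)
      have "\<bar>\<phi> x\<bar> \<le> 1" for x using that by (auto simp: \<Gamma>_def ans_def indicator_def)
      then show "(\<Sum>j\<in>I. iY j \<phi>) \<le> 16" unfolding iY_def using fin by (intro influence_sum_Y)
    qed (use fin \<eta>0 in \<open>auto simp: iY_def intro!: avg_nonneg\<close>)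
    have "{j\<in>I. R i j} = (\<Union>\<phi>\<in>\<Phi> i. {j\<in>I. iX j \<phi> > \<eta>\<^sup>2}) \<union> (\<Union>\<phi>\<in>\<Gamma> i. {j\<in>I. iY j \<phi> > \<eta>\<^sup>2})"
      by (auto simp: R_def)
    then have "card {j\<in>I. R i j} \<le> (\<Sum>\<phi>\<in>\<Phi> i. card {j\<in>I. iX j \<phi> > \<eta>\<^sup>2}) + (\<Sum>\<phi>\<in>\<Gamma> i. card {j\<in>I. iY j \<phi> > \<eta>\<^sup>2})"
      using card_UN_le[OF f(1), of "\<lambda>\<phi>. {j\<in>I. iX j \<phi> > \<eta>\<^sup>2}"] card_UN_le[OF f(2), of "\<lambda>\<phi>. {j\<in>I. iY j \<phi> > \<eta>\<^sup>2}"]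
      by (simp add: order_trans[OF card_Un_le] add_mono)
    then have "real (card {j\<in>I. R i j}) \<le> real ((\<Sum>\<phi>\<in>\<Phi> i. card {j\<in>I. iX j \<phi> > \<eta>\<^sup>2}) + (\<Sum>\<phi>\<in>\<Gamma> i. card {j\<in>I. iY j \<phi> > \<eta>\<^sup>2}))"
      by (rule of_nat_mono)
    also have "\<dots> \<le> card (\<Phi> i) * (16 / \<eta>\<^sup>2) + card (\<Gamma> i) * (16 / \<eta>\<^sup>2)"
      unfolding of_nat_add of_nat_sum using bX bY by (intro add_mono sum_bounded_above) auto
    also have "\<dots> = (card (\<Phi> i) + card (\<Gamma> i)) * (16 / \<eta>\<^sup>2)" by (simp add: distrib_right add_divide_distrib)
    also have "\<dots> \<le> (6 * m) * (16 / \<eta>\<^sup>2)"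
    proof (rule mult_right_mono)
      \<comment> \<open>This product shows that the two cardinalities sum to at most
        \<open>m + 1\<close>; the four additional functions give
        \<open>m + 5 \<le> 6 * m\<close>.\<close>
      have "(card AS - 1) * (card BS - 1) \<ge> 0" by simp
      then have "card AS + card BS \<le> m + 1" using ne unfolding m
        by (cases "card AS"; cases "card BS") auto
      then show "real (card (\<Phi> i) + card (\<Gamma> i)) \<le> real (6 * m)" using c\<Phi> c\<Gamma> m1 by linarith
    qed simp
    finally have "real (card {j\<in>I. R i j}) \<le> 96 * m / \<eta>\<^sup>2" by simp
    then show ?thesis unfolding d_def by (simp add: le_nat_floor)
  qed
  have "k * (2 * d + 1) \<le> card I"
  proof -
    define q where "q = 96^3 * real k^2 * real m^3 / \<delta>\<^sup>2"
    have q: "96 * m / \<eta>\<^sup>2 = q"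
    proof -
      have "96 * m / \<eta>\<^sup>2 = 96 * m * (96 * k * m)\<^sup>2 / \<delta>\<^sup>2" by (simp add: \<eta>_def power_divide)
      also have "\<dots> = q" by (simp add: q_def power_mult_distrib power2_eq_square power3_eq_cube)
      finally show ?thesis .
    qed
    have "d \<le> q" unfolding d_def q[symmetric] by (simp add: of_nat_floor)
    \<comment> \<open>This absorbs the summand 1 of \<open>2 * d + 1\<close> into
      \<open>3 * q\<close>.\<close>
    moreover have "1 \<le> q"
    proof -
      have "1 \<le> 96^3 * real k^2 * real m^3" using k32 m1
        by (intro mult_ge1_I one_le_power) auto
      moreover have "\<delta>\<^sup>2 \<le> 1" using \<delta> \<delta>1 by (simp add: power_le_one)
      ultimately show ?thesis unfolding q_def using \<delta> by (simp add: field_simps)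
    qed
    ultimately have "real k * (2 * real d + 1) \<le> real k * (3 * q)" by (intro mult_left_mono) linarith+
    also have "\<dots> = 3 * 96^3 * real m^3 / \<delta>\<^sup>2 * real k^3" by (simp add: q_def power2_eq_square power3_eq_cube)
    also have "\<dots> \<le> 3 * 96^3 * real m^3 / \<delta>\<^sup>2 * (33 / \<delta>\<^sup>2)^3"
      by (intro mult_left_mono power_mono k_le) auto
    also have "\<dots> = 3 * 96^3 * 33^3 * real m^3 / \<delta>^8"
    proof -
      have "(33 / \<delta>\<^sup>2)^3 = 33^3 / \<delta>^6" by (simp add: power_divide flip: power_mult)
      moreover have "\<delta>\<^sup>2 * \<delta>^6 = \<delta>^8" by (simp flip: power_add)
      ultimately show ?thesis by (simp only: times_divide_times_eq mult_ac)
    qed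
    also have "\<dots> \<le> card I" using large \<delta> by (simp add: field_simps)
    finally have "real (k * (2 * d + 1)) \<le> real (card I)" by (simp add: algebra_simps)
    then show ?thesis by (simp only: of_nat_le_iff)
  qed
  then have "\<exists>J\<subseteq>I. card J = k \<and> (\<forall>i\<in>J. \<forall>j\<in>J. i \<noteq> j \<longrightarrow> \<not> R i j)"
    by (intro independent_set[where d = d]) (simp_all only: fin outdeg)
  then obtain K where K: "K \<subseteq> I" "card K = k" and "\<forall>i\<in>K. \<forall>j\<in>K. i \<noteq> j \<longrightarrow> \<not> R i j"
    by (elim exE conjE)
  then have indep: "\<not> R i j" if "i \<in> K" "j \<in> K" "i \<noteq> j" for i j
    using that by simp
  have finK: "finite K" using K fin finite_subset by blast
  define D where "D i = Ecell I (\<lambda>\<rho>. (avg (K - {i}) (\<lambda>_. cellw) (\<lambda>\<xi>. indicat_real C ((zpart \<xi>)(i := True)) - indicat_real C ((zpart \<xi>)(i := False))) \<rho>)\<^sup>2)" for i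
  have "\<exists>i\<in>K. D i \<le> 16 / 3 / k"
  proof (rule ccontr)
    assume "\<not> ?thesis"
    moreover have "K \<noteq> {}" using K(2) k32 by auto
    ultimately have "(\<Sum>i\<in>K. 16 / 3 / real k) < (\<Sum>i\<in>K. D i)"
      using finK by (intro sum_strict_mono) (auto simp: not_le)
    moreover have "(\<Sum>i\<in>K. 16 / 3 / real k) = 16 / 3" using K(2) k32 by simp
    moreover have "(\<Sum>i\<in>K. D i) \<le> 16/3" unfolding D_def by (rule hidden_coordinate_sum) (use fin K in auto)
    ultimately show False by linarith
  qed
  then obtain i where i: "i \<in> K" "D i \<le> 16 / 3 / k" by blast
  define J where "J = K - {i}"
  have cardJ: "card J \<le> k" unfolding J_def K(2)[symmetric] using finK by (intro card_mono) auto
  \<comment> \<open>The relation constrains only distinct coordinates. The indicators of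
    \<open>A\<close> and \<open>B\<close> also belong to \<open>\<Phi> i'\<close> and
    \<open>\<Gamma> i'\<close>, so \<open>\<not> R i' i\<close> shows that they are insensitive at
    \<open>i\<close> itself.\<close>
  obtain i' where i': "i' \<in> K" "i' \<noteq> i"
  proof -
    have "K \<noteq> {i}" using K k32 by auto
    then show ?thesis using that i by blast
  qed
  have root: "Ecell I (\<lambda>\<rho>. \<bar>f \<rho>\<bar>) \<le> \<eta>" if "Ecell I (\<lambda>\<rho>. (f \<rho>)\<^sup>2) \<le> \<eta>\<^sup>2" for f
  proof -
    have "Ecell I (\<lambda>\<rho>. \<bar>f \<rho>\<bar>) \<le> Ecell I (\<lambda>\<rho>. (f \<rho>)\<^sup>2) / (2 * \<eta>) + \<eta> / 2"
      by (rule avg_abs_le_of_square) (use fin \<eta>0 in auto)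
    also have "\<dots> \<le> \<eta>\<^sup>2 / (2 * \<eta>) + \<eta> / 2" using that \<eta>0 by (intro add_mono divide_right_mono) auto
    also have "\<dots> = \<eta>" using \<eta>0 by (simp add: power2_eq_square)
    finally show ?thesis .
  qed
  have smallX: "Ecell I (\<lambda>\<rho>. \<bar>kdiff kerX I j \<phi> \<rho>\<bar>) \<le> \<eta>"
    if "i \<in> K" "j \<in> K" "i \<noteq> j" "\<phi> \<in> \<Phi> i" for i j \<phi>
    using indep[OF that(1-3)] that(4) unfolding R_def iX_def by (intro root) (auto simp: not_less)
  have smallY: "Ecell I (\<lambda>\<rho>. \<bar>kdiff kerY I j \<phi> \<rho>\<bar>) \<le> \<eta>"
    if "i \<in> K" "j \<in> K" "i \<noteq> j" "\<phi> \<in> \<Gamma> i" for i j \<phi>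
    using indep[OF that(1-3)] that(4) unfolding R_def iY_def by (intro root) (auto simp: not_less)
  have bound: "\<delta>
     - 3/4 * Ecell I (\<lambda>\<rho>. \<bar>avg J (\<lambda>_. cellw) (\<lambda>\<xi>. indicat_real C ((zpart \<xi>)(i := False))) \<rho>
                         - avg J (\<lambda>_. cellw) (\<lambda>\<xi>. indicat_real C ((zpart \<xi>)(i := True))) \<rho>\<bar>)
     - 4 * card J * \<eta> * (1 + card AS * card BS) - 4 * \<eta>
     \<le> 4 * event_prob I A B C (\<lambda>x y. \<not> V (x i) (y i) (F i x) (G i y) (H i (\<lambda>j. x j \<and> y j)))"
    unfolding \<delta>_eq
  proof (rule loss_at_hidden_coordinate)
    show "finite I" "finite AS" "finite BS" by (fact fin)+
    show "i \<in> I" "J \<subseteq> I - {i}" using i K by (auto simp: J_def)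
    show "\<And>x. F i x \<in> AS" "\<And>y. G i y \<in> BS" "\<And>z. H i z \<in> CS" by (fact FGH)+
    show "Ecell I (\<lambda>\<rho>. \<bar>kdiff kerX I i (indicat_real A) \<rho>\<bar>) \<le> \<eta>"
      by (rule smallX[OF i'(1) i(1) i'(2)]) (simp add: \<Phi>_def)
    show "Ecell I (\<lambda>\<rho>. \<bar>kdiff kerY I i (indicat_real B) \<rho>\<bar>) \<le> \<eta>"
      by (rule smallY[OF i'(1) i(1) i'(2)]) (simp add: \<Gamma>_def)
  next
    fix j assume j: "j \<in> J"
    show "Ecell I (\<lambda>\<rho>. \<bar>kdiff kerX I j (\<lambda>x. indicat_real A (x(i := False))) \<rho>\<bar>) \<le> \<eta>"
      by (rule smallX[OF i(1)]) (use j in \<open>auto simp: \<Phi>_def J_def\<close>)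
    show "Ecell I (\<lambda>\<rho>. \<bar>kdiff kerY I j (\<lambda>x. indicat_real B (x(i := False))) \<rho>\<bar>) \<le> \<eta>"
      by (rule smallY[OF i(1)]) (use j in \<open>auto simp: \<Gamma>_def J_def\<close>)
    show "Ecell I (\<lambda>\<rho>. \<bar>kdiff kerX I j (\<lambda>x. ans (F i) A \<alpha> (x(i := True))) \<rho>\<bar>) \<le> \<eta>" if "\<alpha> \<in> AS" for \<alpha>
      by (rule smallX[OF i(1)]) (use j that in \<open>auto simp: \<Phi>_def J_def\<close>)
    show "Ecell I (\<lambda>\<rho>. \<bar>kdiff kerY I j (\<lambda>x. ans (G i) B \<beta> (x(i := True))) \<rho>\<bar>) \<le> \<eta>" if "\<beta> \<in> BS" for \<beta>
      by (rule smallY[OF i(1)]) (use j that in \<open>auto simp: \<Gamma>_def J_def\<close>)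
  qed (rule lose)
  have D_eq: "D i = Ecell I (\<lambda>\<rho>. (avg J (\<lambda>_. cellw) (\<lambda>\<xi>. indicat_real C ((zpart \<xi>)(i := False))) \<rho>
        - avg J (\<lambda>_. cellw) (\<lambda>\<xi>. indicat_real C ((zpart \<xi>)(i := True))) \<rho>)\<^sup>2)"
    unfolding D_def J_def avg_diff by (simp only: power2_commute)
  \<comment> \<open>The parameter \<open>\<delta> / 2\<close> turns the bound into
    \<open>D i / \<delta> + \<delta> / 4\<close>.\<close>
  have "Ecell I (\<lambda>\<rho>. \<bar>avg J (\<lambda>_. cellw) (\<lambda>\<xi>. indicat_real C ((zpart \<xi>)(i := False))) \<rho>
        - avg J (\<lambda>_. cellw) (\<lambda>\<xi>. indicat_real C ((zpart \<xi>)(i := True))) \<rho>\<bar>) \<le> D i / (2 * (\<delta> / 2)) + (\<delta> / 2) / 2"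
    unfolding D_eq by (rule avg_abs_le_of_square) (use fin \<delta> in auto)
  also have "\<dots> \<le> \<delta> / 6 + \<delta> / 4"
  proof -
    have "16 / 3 / real k \<le> \<delta>\<^sup>2 / 6" using k_ge k32 \<delta> by (simp add: field_simps)
    then have "D i \<le> \<delta>\<^sup>2 / 6" using i by linarith
    then have "D i / \<delta> \<le> (\<delta>\<^sup>2 / 6) / \<delta>" using \<delta> by (intro divide_right_mono) auto
    also have "(\<delta>\<^sup>2 / 6) / \<delta> = \<delta> / 6" using \<delta> by (simp add: power2_eq_square)
    finally have "D i / \<delta> \<le> \<delta> / 6" .
    moreover have "2 * (\<delta> / 2) = \<delta>" by simp
    ultimately show ?thesis by (simp only:)
  qed
  finally have hid: "Ecell I (\<lambda>\<rho>. \<bar>avg J (\<lambda>_. cellw) (\<lambda>\<xi>. indicat_real C ((zpart \<xi>)(i := False))) \<rho>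
        - avg J (\<lambda>_. cellw) (\<lambda>\<xi>. indicat_real C ((zpart \<xi>)(i := True))) \<rho>\<bar>) \<le> 5 / 12 * \<delta>" by simp
  have "4 * card J * \<eta> * (1 + card AS * card BS) + 4 * \<eta> \<le> \<delta> / 8"
  proof -
    have "4 * real (card J) * \<eta> * (1 + real m) \<le> 4 * real k * \<eta> * (2 * real m)"
      using cardJ \<eta>0 m1 by (intro mult_mono) auto
    moreover have "4 * \<eta> * 1 \<le> 4 * \<eta> * (real k * real m)"
      using \<eta>0 k32 m1 by (intro mult_left_mono mult_ge1_I) auto
    moreover have "4 * real k * \<eta> * (2 * real m) + 4 * \<eta> * (real k * real m) = \<delta> / 8"
      using k32 m1 by (simp add: \<eta>_def field_simps)
    moreover have "4 * card J * \<eta> * (1 + card AS * card BS) = 4 * real (card J) * \<eta> * (1 + real m)"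
      by (simp add: m)
    ultimately show ?thesis by linarith
  qed
  \<comment> \<open>There remains
    \<open>\<delta> * (1 - 3/4 * 5/12 - 1/8) = 9/16 * \<delta>\<close>, more than the required
    \<open>4 * (\<delta> / 8)\<close>.\<close>
  with bound hid \<delta> have "\<delta> / 8 \<le> event_prob I A B C (\<lambda>x y. \<not> V (x i) (y i) (F i x) (G i y) (H i (\<lambda>j. x j \<and> y j)))"
    by simp
  then show ?thesis using i K by blast
qed

section \<open>From a hard coordinate to decay\<close>

text \<open>Fixing the first two bits and all three answers at \<open>i\<close> cuts a product event
  into product events, because each condition concerns one player's input alone; the third bit is
  \<open>s \<and> t\<close>.\<close>

lemma event_prob_split:
  fixes F :: "('i \<Rightarrow> bool) \<Rightarrow> 'a" and G :: "('i \<Rightarrow> bool) \<Rightarrow> 'b" and H :: "('i \<Rightarrow> bool) \<Rightarrow> 'c"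
  assumes fin: "finite AS" "finite BS" "finite CS"
    and FGH: "\<And>x. F x \<in> AS" "\<And>y. G y \<in> BS" "\<And>z. H z \<in> CS"
  shows "event_prob I A B C (\<lambda>x y. L x y \<and> V (x i) (y i) (F x) (G y) (H (\<lambda>j. x j \<and> y j))) =
    (\<Sum>(s, t, \<alpha>, \<beta>, \<gamma>)\<in>{(s, t, \<alpha>, \<beta>, \<gamma>). V s t \<alpha> \<beta> \<gamma>} \<inter> (UNIV \<times> UNIV \<times> AS \<times> BS \<times> CS).
      event_prob I {x\<in>A. x i = s \<and> F x = \<alpha>} {y\<in>B. y i = t \<and> G y = \<beta>} {z\<in>C. H z = \<gamma>} L)"
proof -
  define Q where "Q = {(s, t, \<alpha>, \<beta>, \<gamma>). V s t \<alpha> \<beta> \<gamma>} \<inter> (UNIV \<times> UNIV \<times> AS \<times> BS \<times> CS)"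
  have finQ: "finite Q" unfolding Q_def using fin by auto
  have "of_bool (x \<in> A \<and> y \<in> B \<and> (\<lambda>j. x j \<and> y j) \<in> C \<and> L x y \<and> V (x i) (y i) (F x) (G y) (H (\<lambda>j. x j \<and> y j))) =
    (\<Sum>(s, t, \<alpha>, \<beta>, \<gamma>)\<in>Q. of_bool (x \<in> {x\<in>A. x i = s \<and> F x = \<alpha>} \<and> y \<in> {y\<in>B. y i = t \<and> G y = \<beta>}
      \<and> (\<lambda>j. x j \<and> y j) \<in> {z\<in>C. H z = \<gamma>} \<and> L x y) :: real)" for x y
  proof -
    define p where "p = (x i, y i, F x, G y, H (\<lambda>j. x j \<and> y j))"
    have "(\<Sum>(s, t, \<alpha>, \<beta>, \<gamma>)\<in>Q. of_bool (x \<in> {x\<in>A. x i = s \<and> F x = \<alpha>} \<and> y \<in> {y\<in>B. y i = t \<and> G y = \<beta>}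
      \<and> (\<lambda>j. x j \<and> y j) \<in> {z\<in>C. H z = \<gamma>} \<and> L x y) :: real) =
      (\<Sum>q\<in>Q. if q = p then of_bool (x \<in> A \<and> y \<in> B \<and> (\<lambda>j. x j \<and> y j) \<in> C \<and> L x y) else 0)"
      by (intro sum.cong refl) (auto simp: p_def)
    moreover have "p \<in> Q \<longleftrightarrow> V (x i) (y i) (F x) (G y) (H (\<lambda>j. x j \<and> y j))"
      using FGH by (simp add: p_def Q_def)
    ultimately show ?thesis using finQ by simp
  qed
  then show ?thesis
    unfolding event_prob_def Q_def[symmetric] by (simp only: case_prod_unfold avg_sum)
qed

text \<open>Recursion on product events. A large one has a hard coordinate; winning there keeps at
  most a fraction \<open>1 - \<epsilon>\<close>, and the winning part splits into at most
  \<open>4 * card AS * card BS * card CS\<close> product events, to which the bound for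
  \<open>k\<close> applies. An event below \<open>\<alpha>0\<close> is charged
  \<open>\<alpha>0\<close>. The hard coordinate may vary from piece to piece.\<close>

lemma repetition_bound:
  fixes F :: "'i \<Rightarrow> ('i \<Rightarrow> bool) \<Rightarrow> 'a" and G :: "'i \<Rightarrow> ('i \<Rightarrow> bool) \<Rightarrow> 'b" and H :: "'i \<Rightarrow> ('i \<Rightarrow> bool) \<Rightarrow> 'c"
    and V :: "bool \<Rightarrow> bool \<Rightarrow> 'a \<Rightarrow> 'b \<Rightarrow> 'c \<Rightarrow> bool" and \<epsilon> \<alpha>0 :: real
  defines "win \<equiv> \<lambda>i x y. V (x i) (y i) (F i x) (G i y) (H i (\<lambda>j. x j \<and> y j))"
  assumes fin: "finite AS" "finite BS" "finite CS"
    and FGH: "\<And>i x. F i x \<in> AS" "\<And>i y. G i y \<in> BS" "\<And>i z. H i z \<in> CS"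
    and \<alpha>0: "\<alpha>0 \<ge> 0" and \<epsilon>: "\<epsilon> \<le> 1"
    and hard: "\<And>A B C. \<alpha>0 \<le> event_prob I A B C (\<lambda>x y. True) \<Longrightarrow>
      \<exists>i\<in>I. \<epsilon> * event_prob I A B C (\<lambda>x y. True) \<le> event_prob I A B C (\<lambda>x y. \<not> win i x y)"
  shows "event_prob I A B C (\<lambda>x y. \<forall>i\<in>I. win i x y) \<le>
    (1 - \<epsilon>) ^ k * event_prob I A B C (\<lambda>x y. True) + real (4 * card AS * card BS * card CS) ^ k * \<alpha>0"
proof (induction k arbitrary: A B C)
  case 0
  have "event_prob I A B C (\<lambda>x y. \<forall>i\<in>I. win i x y) \<le> event_prob I A B C (\<lambda>x y. True)"
    unfolding event_prob_def by (intro avg_mono) auto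
  then show ?case using \<alpha>0 by simp
next
  case (Suc k)
  define M where "M = 4 * card AS * card BS * card CS"
  have M1: "M \<ge> 1"
  proof -
    have "AS \<noteq> {}" "BS \<noteq> {}" "CS \<noteq> {}" using FGH by auto
    then show ?thesis using fin by (simp add: M_def Suc_le_eq card_gt_0_iff)
  qed
  show ?case
  proof (cases "\<alpha>0 \<le> event_prob I A B C (\<lambda>x y. True)")
    case False
    have "event_prob I A B C (\<lambda>x y. \<forall>i\<in>I. win i x y) \<le> event_prob I A B C (\<lambda>x y. True)"
      unfolding event_prob_def by (intro avg_mono) auto
    also have "\<dots> \<le> 1 * \<alpha>0" using False by simp
    also have "\<dots> \<le> real M ^ Suc k * \<alpha>0" using M1 \<alpha>0 by (intro mult_right_mono one_le_power) auto
    finally have "event_prob I A B C (\<lambda>x y. \<forall>i\<in>I. win i x y) \<le> real M ^ Suc k * \<alpha>0" .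
    moreover have "0 \<le> (1 - \<epsilon>) ^ Suc k * event_prob I A B C (\<lambda>x y. True)"
      using \<epsilon> by (intro mult_nonneg_nonneg zero_le_power event_prob_nonneg) auto
    ultimately show ?thesis by (simp add: M_def)
  next
    case True
    then obtain i where i: "i \<in> I" "\<epsilon> * event_prob I A B C (\<lambda>x y. True) \<le> event_prob I A B C (\<lambda>x y. \<not> win i x y)"
      using hard by blast
    define Q where "Q = {(s, t, \<alpha>, \<beta>, \<gamma>). V s t \<alpha> \<beta> \<gamma>} \<inter> (UNIV \<times> UNIV \<times> AS \<times> BS \<times> CS)"
    define AA where "AA p = {x\<in>A. x i = fst p \<and> F i x = fst (snd (snd p))}" for p :: "bool \<times> bool \<times> 'a \<times> 'b \<times> 'c"
    define BB where "BB p = {y\<in>B. y i = fst (snd p) \<and> G i y = fst (snd (snd (snd p)))}" for p :: "bool \<times> bool \<times> 'a \<times> 'b \<times> 'c"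
    define CC where "CC p = {z\<in>C. H i z = snd (snd (snd (snd p)))}" for p :: "bool \<times> bool \<times> 'a \<times> 'b \<times> 'c"
    have split: "event_prob I A B C (\<lambda>x y. L x y \<and> win i x y) = (\<Sum>p\<in>Q. event_prob I (AA p) (BB p) (CC p) L)" for L
      unfolding win_def
      by (subst event_prob_split[OF fin, of "F i" "G i" "H i" I A B C L V i])
        (simp_all add: FGH Q_def AA_def BB_def CC_def case_prod_unfold)
    have cardQ: "card Q \<le> M"
    proof -
      have "card Q \<le> card ((UNIV :: bool set) \<times> (UNIV :: bool set) \<times> AS \<times> BS \<times> CS)"
        unfolding Q_def using fin by (intro card_mono) auto
      then show ?thesis by (simp add: card_cartesian_product M_def mult.assoc)
    qed
    \<comment> \<open>The condition at \<open>i\<close> is duplicated: one copy is spent on the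
      split, the other keeps the pieces in the form of the induction hypothesis.\<close>
    have "(\<lambda>x y. \<forall>j\<in>I. win j x y) = (\<lambda>x y. (\<forall>j\<in>I. win j x y) \<and> win i x y)"
      using i by (auto simp: fun_eq_iff)
    then have "event_prob I A B C (\<lambda>x y. \<forall>j\<in>I. win j x y) = (\<Sum>p\<in>Q. event_prob I (AA p) (BB p) (CC p) (\<lambda>x y. \<forall>j\<in>I. win j x y))"
      using split by metis
    also have "\<dots> \<le> (\<Sum>p\<in>Q. (1 - \<epsilon>) ^ k * event_prob I (AA p) (BB p) (CC p) (\<lambda>x y. True) + real M ^ k * \<alpha>0)"
      unfolding M_def by (intro sum_mono Suc.IH)
    also have "\<dots> = (1 - \<epsilon>) ^ k * (\<Sum>p\<in>Q. event_prob I (AA p) (BB p) (CC p) (\<lambda>x y. True)) + card Q * (real M ^ k * \<alpha>0)"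
      by (simp add: sum.distrib sum_distrib_left)
    also have "(\<Sum>p\<in>Q. event_prob I (AA p) (BB p) (CC p) (\<lambda>x y. True)) = event_prob I A B C (win i)"
      using split[of "\<lambda>x y. True"] by simp
    also have "(1 - \<epsilon>) ^ k * event_prob I A B C (win i) + card Q * (real M ^ k * \<alpha>0) \<le>
        (1 - \<epsilon>) ^ k * ((1 - \<epsilon>) * event_prob I A B C (\<lambda>x y. True)) + real M * (real M ^ k * \<alpha>0)"
    proof (intro add_mono mult_left_mono mult_right_mono)
      have "event_prob I A B C (\<lambda>x y. True) = event_prob I A B C (win i) + event_prob I A B C (\<lambda>x y. \<not> win i x y)"
        unfolding event_prob_def avg_add[symmetric] by (intro avg_cong) auto
      then show "event_prob I A B C (win i) \<le> (1 - \<epsilon>) * event_prob I A B C (\<lambda>x y. True)"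
        using i(2) by (simp add: algebra_simps)
    qed (use cardQ \<epsilon> \<alpha>0 in auto)
    finally show ?thesis by (simp add: M_def mult.assoc mult.left_commute)
  qed
qed

text \<open>By \<open>decoupling_at\<close>, coordinate \<open>i\<close> runs through its four
  questions while all else is fixed. The third player's answer is the same for the three questions
  with \<open>z = 0\<close>, so \<open>lose\<close> forbids winning all four. This serves the small
  \<open>n\<close> that the asymptotic bound does not reach.\<close>

lemma single_coordinate_loss:
  fixes F :: "('i \<Rightarrow> bool) \<Rightarrow> 'a" and G :: "('i \<Rightarrow> bool) \<Rightarrow> 'b" and H :: "('i \<Rightarrow> bool) \<Rightarrow> 'c"
  assumes fin: "finite I" and i: "i \<in> I"
    and FGH: "\<And>x. F x \<in> AS" "\<And>y. G y \<in> BS" "\<And>z. H z \<in> CS"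
    and lose: "\<And>\<alpha>0 \<alpha>1 \<beta>0 \<beta>1 \<gamma>0 \<gamma>1. \<lbrakk>\<alpha>0 \<in> AS; \<alpha>1 \<in> AS; \<beta>0 \<in> BS; \<beta>1 \<in> BS; \<gamma>0 \<in> CS; \<gamma>1 \<in> CS;
        V False False \<alpha>0 \<beta>0 \<gamma>0; V True False \<alpha>1 \<beta>0 \<gamma>0; V False True \<alpha>0 \<beta>1 \<gamma>0; V True True \<alpha>1 \<beta>1 \<gamma>1\<rbrakk> \<Longrightarrow> False"
  shows "Ecoin I (\<lambda>x. Ecoin I (\<lambda>y. of_bool (V (x i) (y i) (F x) (G y) (H (\<lambda>j. x j \<and> y j))))) \<le> 3 / 4"
proof -
  define \<Psi> :: "('i \<Rightarrow> bool) \<Rightarrow> ('i \<Rightarrow> bool) \<Rightarrow> ('i \<Rightarrow> bool) \<Rightarrow> real" where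
    "\<Psi> x y z = of_bool (V (x i) (y i) (F x) (G y) (H z))" for x y z
  have pt: "(\<Sum>s\<in>UNIV. \<Sum>t\<in>UNIV. \<Psi> (x(i := s)) (y(i := t)) (z(i := s \<and> t))) \<le> 3" for x y z
    using lose[of "F (x(i := False))" "F (x(i := True))" "G (y(i := False))" "G (y(i := True))"
        "H (z(i := False))" "H (z(i := True))"] FGH
    by (auto simp: \<Psi>_def UNIV_bool simp del: sum_of_bool_eq)
  have "(\<Sum>s\<in>UNIV. \<Sum>t\<in>UNIV. kavg kerX I (\<lambda>x. kavg kerY I (\<lambda>y. \<Psi> (x(i := s)) (y(i := t)) ((zpart \<rho>)(i := s \<and> t))) \<rho>) \<rho>) \<le> 3" for \<rho>
    unfolding kavg_def avg_sum[symmetric] using pt fin by (intro avg_le) auto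
  then have "4 * Ecoin I (\<lambda>x. Ecoin I (\<lambda>y. \<Psi> x y (\<lambda>j. x j \<and> y j))) \<le> 3"
    unfolding decoupling_at[OF fin i] using fin by (intro avg_le) auto
  then show ?thesis by (simp add: \<Psi>_def)
qed

text \<open>Take \<open>k\<close> proportional to \<open>ln n\<close>, slowly enough that
  \<open>M ^ k\<close> spends only half of the exponent \<open>1/8\<close>. The remaining constant
  factor is removed by halving the exponent for large \<open>n\<close>, and \<open>small\<close>
  covers the other \<open>n\<close>.\<close>

lemma polynomial_decay:
  fixes v :: "nat \<Rightarrow> real" and M B :: real
  assumes M: "M \<ge> 4" and B: "B \<ge> 0"
    and small: "\<And>n. n \<ge> 1 \<Longrightarrow> v n \<le> 3 / 4"
    and bound: "\<And>n k. n \<ge> 1 \<Longrightarrow> v n \<le> (7 / 8) ^ k + M ^ k * (B * real n powr (- 1 / 8))"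
  shows "\<exists>c>0. \<forall>n\<ge>1. v n \<le> real n powr (- c)"
proof -
  have lnM: "ln M > 0" using M by simp
  \<comment> \<open>From \<open>k \<le> ln n / L\<close> it follows that \<open>M ^ k\<close> is at
    most \<open>n powr (1/16)\<close>.\<close>
  define L where "L = 16 * ln M"
  have L0: "L > 0" using lnM by (simp add: L_def)
  define c1 where "c1 = ln (8 / 7) / L"
  define c2 where "c2 = min c1 (1 / 16)"
  have c2: "c2 > 0" "c2 \<le> c1" "c2 \<le> 1 / 16"
  proof -
    show "c2 > 0" using L0 by (simp add: c2_def c1_def)
  qed (simp_all only: c2_def min.cobounded1 min.cobounded2)
  define D where "D = 8 / 7 + B"
  have D1: "D > 1" using B by (simp add: D_def)
  have decay: "v n \<le> D * real n powr (- c2)" if n: "n \<ge> 1" for n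
  proof -
    define k where "k = nat \<lfloor>ln n / L\<rfloor>"
    have "ln n / L \<ge> 0" using n L0 by simp
    then have k: "real k \<le> ln n / L" "ln n / L - 1 \<le> real k"
      unfolding k_def by (simp add: of_nat_floor) linarith
    have "(7 / 8 :: real) ^ k = (7 / 8) powr real k" by (simp add: powr_realpow)
    \<comment> \<open>Rounding \<open>k\<close> down costs the factor \<open>8 / 7\<close> that
      appears in \<open>D\<close>.\<close>
    also have "\<dots> \<le> (7 / 8) powr (ln n / L - 1)" using k by (intro powr_mono') auto
    also have "\<dots> = 8 / 7 * real n powr (- c1)"
    proof -
      have "ln (7 / 8 :: real) = - ln (8 / 7)" by (simp add: ln_div)
      then have "(7 / 8) powr (ln n / L) = real n powr (- c1)" using n by (simp add: powr_def c1_def)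
      then show ?thesis by (simp add: powr_diff)
    qed
    also have "\<dots> \<le> 8 / 7 * real n powr (- c2)" using c2 n by (intro mult_left_mono powr_mono) auto
    finally have first: "(7 / 8 :: real) ^ k \<le> 8 / 7 * real n powr (- c2)" .
    have "M ^ k = M powr real k" using M by (simp add: powr_realpow)
    also have "\<dots> \<le> M powr (ln n / L)" using M k by (intro powr_mono) auto
    also have "\<dots> = real n powr (1 / 16)" using M n lnM by (simp add: powr_def L_def)
    finally have "M ^ k * (B * real n powr (- 1 / 8)) \<le> real n powr (1 / 16) * (B * real n powr (- 1 / 8))"
      using B by (intro mult_right_mono) auto
    also have "\<dots> = B * (real n powr (1 / 16) * real n powr (- 1 / 8))" by simp
    also have "real n powr (1 / 16) * real n powr (- 1 / 8) = real n powr (- (1 / 16))"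
      by (simp add: powr_add[symmetric])
    also have "B * real n powr (- (1 / 16)) \<le> B * real n powr (- c2)"
      using B c2 n by (intro mult_left_mono powr_mono) auto
    finally show ?thesis using bound[OF n, of k] first by (simp add: D_def distrib_right)
  qed
  \<comment> \<open>From \<open>N\<close> on, \<open>D\<close> is at most
    \<open>n powr (c2 / 2)\<close>.\<close>
  define N where "N = D powr (2 / c2)"
  have N1: "N > 1" using D1 c2 by (simp add: N_def)
  \<comment> \<open>The second bound gives \<open>N powr c \<le> 4 / 3\<close>, hence
    \<open>n powr (- c) \<ge> 3 / 4\<close> for all \<open>n\<close> below \<open>N\<close>.\<close>
  define c where "c = min (c2 / 2) (ln (4 / 3) / ln N)"
  have c: "c > 0" "c \<le> c2 / 2" "c \<le> ln (4 / 3) / ln N"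
  proof -
    show "c > 0" using c2 N1 by (simp add: c_def)
  qed (simp_all only: c_def min.cobounded1 min.cobounded2)
  have "v n \<le> real n powr (- c)" if n: "n \<ge> 1" for n
  proof (cases "real n \<ge> N")
    case True
    have "D = N powr (c2 / 2)" using D1 c2 by (simp add: N_def powr_powr)
    also have "\<dots> \<le> real n powr (c2 / 2)" using True N1 c2 by (intro powr_mono2) auto
    finally have "D * real n powr (- c2) \<le> real n powr (c2 / 2) * real n powr (- c2)" by (intro mult_right_mono) auto
    also have "\<dots> = real n powr (- (c2 / 2))" by (simp add: powr_add[symmetric])
    also have "\<dots> \<le> real n powr (- c)" using c n by (intro powr_mono) auto
    finally show ?thesis using decay[OF n] by linarith
  next
    case False
    have "real n powr c \<le> N powr c" using False c n by (intro powr_mono2) auto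
    also have "\<dots> \<le> N powr (ln (4 / 3) / ln N)" using c N1 by (intro powr_mono) auto
    also have "\<dots> = 4 / 3" using N1 by (simp add: powr_def)
    finally have "3 / 4 \<le> 1 / real n powr c" using n by (simp add: field_simps)
    then show ?thesis using small[OF n] by (simp add: powr_minus_divide)
  qed
  then show ?thesis using c(1) by blast
qed

section \<open>From the repeated game to averages over fair coins\<close>

abbreviation nat_bit :: "bool \<Rightarrow> nat" where "nat_bit b \<equiv> of_bool b"

abbreviation and_support :: "(nat \<times> nat \<times> nat) set" where
  "and_support \<equiv> {(0, 0, 0), (1, 0, 0), (0, 1, 0), (1, 1, 1)}"

text \<open>Each triple of the support belongs to exactly one pair of bits, so a uniform triple is a
  pair of fair coins with its conjunction. The base points are arbitrary because the induction step
  writes the new pair of bits into them.\<close>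

lemma expectation_replicate_and:
  "measure_pmf.expectation (replicate_pmf n (pmf_of_set and_support)) f =
    avg {..<n} (\<lambda>_. coin) (\<lambda>x. avg {..<n} (\<lambda>_. coin)
      (\<lambda>y. f (map (\<lambda>j. (nat_bit (x j), nat_bit (y j), nat_bit (x j \<and> y j))) [0..<n])) y0) x0" for f :: "_ \<Rightarrow> real"
proof (induction n arbitrary: f x0 y0)
  case 0
  then show ?case by simp
next
  case (Suc n)
  let ?p = "pmf_of_set and_support"
  define tr :: "(nat \<Rightarrow> bool) \<Rightarrow> (nat \<Rightarrow> bool) \<Rightarrow> nat \<Rightarrow> nat \<times> nat \<times> nat" where
    "tr x y = (\<lambda>j. (nat_bit (x j), nat_bit (y j), nat_bit (x j \<and> y j)))" for x y
  \<comment> \<open>The new coordinate \<open>n\<close> is the last one in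
    \<open>[0..<Suc n]\<close>, whereas \<open>replicate_pmf\<close> grows in front; so the new
    triple is appended instead.\<close>
  have "replicate_pmf (n + 1) ?p = do {xs \<leftarrow> replicate_pmf n ?p; q \<leftarrow> ?p; return_pmf (xs @ [q])}"
    unfolding replicate_pmf_distrib replicate_pmf_1 map_pmf_def
    by (simp only: bind_assoc_pmf bind_return_pmf)
  also have "\<dots> = do {q \<leftarrow> ?p; map_pmf (\<lambda>xs. xs @ [q]) (replicate_pmf n ?p)}"
    unfolding map_pmf_def by (rule bind_commute_pmf)
  finally have "measure_pmf.expectation (replicate_pmf (Suc n) ?p) f =
      measure_pmf.expectation (do {q \<leftarrow> ?p; map_pmf (\<lambda>xs. xs @ [q]) (replicate_pmf n ?p)}) f" by (simp only: Suc_eq_plus1)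
  also have "\<dots> = (\<Sum>q\<in>and_support. pmf ?p q *\<^sub>R measure_pmf.expectation (map_pmf (\<lambda>xs. xs @ [q]) (replicate_pmf n ?p)) f)"
  proof (rule pmf_expectation_bind)
    have "set_pmf (replicate_pmf n ?p) = {xs. set xs \<subseteq> and_support \<and> length xs = n}"
      by (auto simp: set_replicate_pmf lists_eq_set)
    moreover have "finite {xs. set xs \<subseteq> and_support \<and> length xs = n}" by (rule finite_lists_length_eq) simp
    ultimately show "finite (set_pmf (map_pmf (\<lambda>xs. xs @ [q]) (replicate_pmf n ?p)))" for q by simp
  qed simp_all
  also have "\<dots> = (\<Sum>q\<in>and_support. 1 / 4 * measure_pmf.expectation (replicate_pmf n ?p) (\<lambda>xs. f (xs @ [q])))"
  proof (rule sum.cong[OF refl])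
    fix q :: "nat \<times> nat \<times> nat" assume "q \<in> and_support"
    then have "pmf ?p q = 1 / 4" by (simp add: pmf_of_set)
    then show "pmf ?p q *\<^sub>R measure_pmf.expectation (map_pmf (\<lambda>xs. xs @ [q]) (replicate_pmf n ?p)) f =
      1 / 4 * measure_pmf.expectation (replicate_pmf n ?p) (\<lambda>xs. f (xs @ [q]))"
      by (simp only: integral_map_pmf real_scaleR_def)
  qed
  also have "\<dots> = (\<Sum>s\<in>UNIV. \<Sum>t\<in>UNIV. 1 / 4 * measure_pmf.expectation (replicate_pmf n ?p) (\<lambda>xs. f (xs @ [(nat_bit s, nat_bit t, nat_bit (s \<and> t))])))"
    by (simp add: UNIV_bool)
  also have "\<dots> = (\<Sum>s\<in>UNIV. \<Sum>t\<in>UNIV. 1 / 4 * avg {..<n} (\<lambda>_. coin) (\<lambda>x. avg {..<n} (\<lambda>_. coin)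
      (\<lambda>y. f (map (tr x y) [0..<n] @ [(nat_bit s, nat_bit t, nat_bit (s \<and> t))])) (y0(n := t))) (x0(n := s)))"
    unfolding tr_def by (intro sum.cong refl arg_cong2[of _ _ _ _ "(*)"] Suc.IH)
  also have "\<dots> = (\<Sum>s\<in>UNIV. \<Sum>t\<in>UNIV. 1 / 4 * avg {..<n} (\<lambda>_. coin) (\<lambda>x. avg {..<n} (\<lambda>_. coin)
      (\<lambda>y. f (map (tr x y) [0..<Suc n])) (y0(n := t))) (x0(n := s)))"
  proof (intro sum.cong refl arg_cong2[of _ _ _ _ "(*)"] avg_cong[OF _ refl])
    fix s t :: bool and x y :: "nat \<Rightarrow> bool"
    assume "\<And>j. j \<notin> {..<n} \<Longrightarrow> x j = (x0(n := s)) j" "\<And>j. j \<notin> {..<n} \<Longrightarrow> y j = (y0(n := t)) j"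
    then have "x n = s" "y n = t" by simp_all
    then show "f (map (tr x y) [0..<n] @ [(nat_bit s, nat_bit t, nat_bit (s \<and> t))]) = f (map (tr x y) [0..<Suc n])"
      by (simp only: upt_Suc_append[OF le0] map_append list.map tr_def)
  qed
  also have "\<dots> = avg (insert n {..<n}) (\<lambda>_. coin) (\<lambda>x. avg (insert n {..<n}) (\<lambda>_. coin)
      (\<lambda>y. f (map (tr x y) [0..<Suc n])) y0) x0"
    by (simp add: avg_insert avg_add avg_divide UNIV_bool add_divide_distrib)
  finally show ?case by (simp only: lessThan_Suc tr_def)
qed

lemma win_prob_repetition:
  fixes G :: "(nat, nat, nat, 'a, 'b, 'c) game3"
  assumes "qdist G = pmf_of_set and_support"
  defines "word \<equiv> \<lambda>n x. map (\<lambda>j. nat_bit (x j)) [0..<n]"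
  shows "win_prob (repetition n G) f g h =
    Ecoin {..<n} (\<lambda>x. Ecoin {..<n} (\<lambda>y. of_bool (\<forall>i<n. wins G (nat_bit (x i), nat_bit (y i), nat_bit (x i \<and> y i))
      (f (word n x) ! i, g (word n y) ! i, h (word n (\<lambda>j. x j \<and> y j)) ! i))))"
proof -
  define T :: "(nat \<times> nat \<times> nat) list \<Rightarrow> nat list \<times> nat list \<times> nat list" where
    "T qs = (map fst qs, map (fst \<circ> snd) qs, map (snd \<circ> snd) qs)" for qs
  define W where "W = {(x, y, z). wins (repetition n G) (x, y, z) (f x, g y, h z)}"
  have win: "indicator (T -` W) (map (\<lambda>j. (nat_bit (x j), nat_bit (y j), nat_bit (x j \<and> y j))) [0..<n]) =
      (of_bool (\<forall>i<n. wins G (nat_bit (x i), nat_bit (y i), nat_bit (x i \<and> y i))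
      (f (word n x) ! i, g (word n y) ! i, h (word n (\<lambda>j. x j \<and> y j)) ! i)) :: real)" for x y
  proof -
    have "T (map (\<lambda>j. (nat_bit (x j), nat_bit (y j), nat_bit (x j \<and> y j))) [0..<n]) = (word n x, word n y, word n (\<lambda>j. x j \<and> y j))"
      by (simp add: T_def word_def o_def)
    then show ?thesis by (simp add: indicator_def W_def repetition_def word_def)
  qed
  have "win_prob (repetition n G) f g h = measure_pmf.prob (map_pmf T (replicate_pmf n (qdist G))) W"
    unfolding win_prob_def W_def T_def[abs_def] by (simp add: repetition_def)
  also have "\<dots> = measure_pmf.expectation (replicate_pmf n (pmf_of_set and_support)) (indicator (T -` W))"
    using assms(1) by simp
  also have "\<dots> = Ecoin {..<n} (\<lambda>x. Ecoin {..<n} (\<lambda>y. indicator (T -` W) (map (\<lambda>j. (nat_bit (x j), nat_bit (y j), nat_bit (x j \<and> y j))) [0..<n])))"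
    by (rule expectation_replicate_and)
  finally show ?thesis by (simp only: win)
qed

lemma nth_tuples: "xs \<in> tuples n A \<Longrightarrow> i < n \<Longrightarrow> xs ! i \<in> A"
  by (auto simp: tuples_def)

text \<open>Six such answers, one per player and bit, would form a strategy that wins with
  probability 1. It is here that the value being below 1 enters.\<close>

lemma no_perfect_answers:
  fixes G :: "(nat, nat, nat, 'a, 'b, 'c) game3"
  assumes game: "is_game3 G" and q: "qset1 G = {0, 1}" "qset2 G = {0, 1}" "qset3 G = {0, 1}"
    and dist: "qdist G = pmf_of_set and_support" and val: "val G < 1"
    and ans: "\<alpha>0 \<in> aset1 G" "\<alpha>1 \<in> aset1 G" "\<beta>0 \<in> aset2 G" "\<beta>1 \<in> aset2 G" "\<gamma>0 \<in> aset3 G" "\<gamma>1 \<in> aset3 G"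
    and win: "wins G (0, 0, 0) (\<alpha>0, \<beta>0, \<gamma>0)" "wins G (1, 0, 0) (\<alpha>1, \<beta>0, \<gamma>0)"
      "wins G (0, 1, 0) (\<alpha>0, \<beta>1, \<gamma>0)" "wins G (1, 1, 1) (\<alpha>1, \<beta>1, \<gamma>1)"
  shows False
proof -
  define f where "f = (\<lambda>x\<in>{0, 1 :: nat}. if x = 0 then \<alpha>0 else \<alpha>1)"
  define g where "g = (\<lambda>x\<in>{0, 1 :: nat}. if x = 0 then \<beta>0 else \<beta>1)"
  define h where "h = (\<lambda>x\<in>{0, 1 :: nat}. if x = 0 then \<gamma>0 else \<gamma>1)"
  have "set_pmf (qdist G) \<subseteq> {(x, y, z). wins G (x, y, z) (f x, g y, h z)}"
    using win by (auto simp: dist f_def g_def h_def)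
  then have "win_prob G f g h = 1"
    unfolding win_prob_def by (intro measure_pmf.prob_eq_1[THEN iffD2]) (auto intro!: AE_pmfI)
  moreover have "f \<in> qset1 G \<rightarrow>\<^sub>E aset1 G" "g \<in> qset2 G \<rightarrow>\<^sub>E aset2 G" "h \<in> qset3 G \<rightarrow>\<^sub>E aset3 G"
    using ans by (auto simp: q f_def g_def h_def)
  ultimately have "1 \<le> val G"
    unfolding val_def by (intro Max_ge finite_win_probs[OF game]) (metis (mono_tags, lifting) mem_Collect_eq)
  with val show False by simp
qed

theorem theorem5p1:
  fixes G :: "(nat, nat, nat, 'a, 'b, 'c) game3"
  assumes "is_game3 G"
    and "qset1 G = {0, 1}" and "qset2 G = {0, 1}" and "qset3 G = {0, 1}"
    and "qdist G = pmf_of_set {(0, 0, 0), (1, 0, 0), (0, 1, 0), (1, 1, 1)}"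
    and "val G < 1"
  shows "\<exists>c::real. c > 0 \<and> (\<forall>n::nat. n \<ge> 1 \<longrightarrow> val (repetition n G) \<le> real n powr (- c))"
proof -
  define AS BS CS where sets: "AS = aset1 G" "BS = aset2 G" "CS = aset3 G"
  have fin: "finite AS" "finite BS" "finite CS" and ne: "AS \<noteq> {}" "BS \<noteq> {}" "CS \<noteq> {}"
    using assms(1) by (auto simp: is_game3_def sets)
  define V where "V s t \<alpha> \<beta> \<gamma> = wins G (nat_bit s, nat_bit t, nat_bit (s \<and> t)) (\<alpha>, \<beta>, \<gamma>)" for s t \<alpha> \<beta> \<gamma>
  have lose: False if "\<alpha>0 \<in> AS" "\<alpha>1 \<in> AS" "\<beta>0 \<in> BS" "\<beta>1 \<in> BS" "\<gamma>0 \<in> CS" "\<gamma>1 \<in> CS"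
    "V False False \<alpha>0 \<beta>0 \<gamma>0" "V True False \<alpha>1 \<beta>0 \<gamma>0" "V False True \<alpha>0 \<beta>1 \<gamma>0" "V True True \<alpha>1 \<beta>1 \<gamma>1"
    for \<alpha>0 \<alpha>1 \<beta>0 \<beta>1 \<gamma>0 \<gamma>1
    by (rule no_perfect_answers[OF assms, of \<alpha>0 \<alpha>1 \<beta>0 \<beta>1 \<gamma>0 \<gamma>1]) (use that in \<open>simp_all add: V_def sets\<close>)
  define m where "m = card AS * card BS"
  define M where "M = 4 * card AS * card BS * card CS"
  define K where "K = 3 * 96^3 * 33^3 * real m^3"
  have m1: "m \<ge> 1" using fin ne by (simp add: m_def Suc_le_eq card_gt_0_iff)
  have M4: "real M \<ge> 4"
  proof -
    have "card AS * card BS * card CS \<ge> 1" using fin ne by (simp add: Suc_le_eq card_gt_0_iff)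
    then have "4 \<le> M" by (simp only: M_def mult.assoc)
    then show ?thesis by simp
  qed
  have K0: "K > 0" using m1 by (simp add: K_def)
  have val_le: "val (repetition n G) \<le> 3 / 4 \<and>
      (\<forall>k. val (repetition n G) \<le> (7 / 8) ^ k + real M ^ k * (K powr (1 / 8) * real n powr (- 1 / 8)))"
    if n: "n \<ge> 1" for n
  proof -
    define word where "word x = map (\<lambda>j. nat_bit (x j)) [0..<n]" for x
    \<comment> \<open>The smallest mass for which \<open>hard_coordinate\<close> applies with
      \<open>n\<close> coordinates: it satisfies \<open>n * \<alpha>0 ^ 8 = K\<close>, and
      \<open>K\<close> is the left side of \<open>large\<close>.\<close>
    define \<alpha>0 where "\<alpha>0 = K powr (1 / 8) * real n powr (- 1 / 8)"
    have \<alpha>0: "\<alpha>0 > 0" using K0 n by (simp add: \<alpha>0_def)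
    have \<alpha>0_8: "real n * \<alpha>0 ^ 8 = K"
    proof -
      have "\<alpha>0 ^ 8 = (K powr (1 / 8)) ^ 8 * (real n powr (- 1 / 8)) ^ 8" by (simp add: \<alpha>0_def power_mult_distrib)
      also have "(K powr (1 / 8)) ^ 8 = K" using K0 by (simp add: powr_power)
      also have "(real n powr (- 1 / 8)) ^ 8 = 1 / real n"
      proof -
        have "(real n powr (- 1 / 8)) ^ 8 = real n powr (- 1)" using n by (subst powr_power) auto
        then show ?thesis using n by (simp add: powr_minus_divide)
      qed
      finally show ?thesis using n by simp
    qed
    have strategy: "win_prob (repetition n G) f g h \<le> 3 / 4 \<and>
        (\<forall>k. win_prob (repetition n G) f g h \<le> (7 / 8) ^ k + real M ^ k * \<alpha>0)"
      if f: "f \<in> qset1 (repetition n G) \<rightarrow>\<^sub>E aset1 (repetition n G)"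
        and g: "g \<in> qset2 (repetition n G) \<rightarrow>\<^sub>E aset2 (repetition n G)"
        and h: "h \<in> qset3 (repetition n G) \<rightarrow>\<^sub>E aset3 (repetition n G)" for f g h
    proof -
      \<comment> \<open>Coordinates outside \<open>{..<n}\<close> are redirected to \<open>0\<close> so that every answer is legal.\<close>
      define clip where "clip i = (if i < n then i else 0)" for i
      define F where "F i x = f (word x) ! clip i" for i x
      define Gs where "Gs i x = g (word x) ! clip i" for i x
      define H where "H i x = h (word x) ! clip i" for i x
      have clip: "clip i < n" for i using n by (simp add: clip_def)
      have word: "word x \<in> tuples n {0, 1}" for x by (auto simp: word_def tuples_def)
      have "f (word x) \<in> tuples n AS" "g (word x) \<in> tuples n BS" "h (word x) \<in> tuples n CS" for x
        using PiE_mem[OF f, of "word x"] PiE_mem[OF g, of "word x"] PiE_mem[OF h, of "word x"] word[of x]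
        by (simp_all add: repetition_def sets assms(2-4))
      then have FGH: "F i x \<in> AS" "Gs i x \<in> BS" "H i x \<in> CS" for i x
        unfolding F_def Gs_def H_def by (auto intro!: nth_tuples clip)
      have "(\<forall>i<n. wins G (nat_bit (x i), nat_bit (y i), nat_bit (x i \<and> y i))
          (f (word x) ! i, g (word y) ! i, h (word (\<lambda>j. x j \<and> y j)) ! i)) \<longleftrightarrow>
        x \<in> UNIV \<and> y \<in> UNIV \<and> (\<lambda>j. x j \<and> y j) \<in> UNIV \<and>
        (\<forall>i\<in>{..<n}. V (x i) (y i) (F i x) (Gs i y) (H i (\<lambda>j. x j \<and> y j)))" for x y
      proof -
        have "V (x i) (y i) (F i x) (Gs i y) (H i (\<lambda>j. x j \<and> y j)) \<longleftrightarrow>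
          wins G (nat_bit (x i), nat_bit (y i), nat_bit (x i \<and> y i))
            (f (word x) ! i, g (word y) ! i, h (word (\<lambda>j. x j \<and> y j)) ! i)" if "i < n" for i
          using that by (simp only: V_def F_def Gs_def H_def clip_def if_True)
        then show ?thesis by blast
      qed
      then have wp: "win_prob (repetition n G) f g h =
          event_prob {..<n} UNIV UNIV UNIV (\<lambda>x y. \<forall>i\<in>{..<n}. V (x i) (y i) (F i x) (Gs i y) (H i (\<lambda>j. x j \<and> y j)))"
        unfolding win_prob_repetition[OF assms(5), where n = n, folded word_def] event_prob_def by (simp only:)
      have "event_prob {..<n} UNIV UNIV UNIV (\<lambda>x y. \<forall>i\<in>{..<n}. V (x i) (y i) (F i x) (Gs i y) (H i (\<lambda>j. x j \<and> y j)))
        \<le> Ecoin {..<n} (\<lambda>x. Ecoin {..<n} (\<lambda>y. of_bool (V (x 0) (y 0) (F 0 x) (Gs 0 y) (H 0 (\<lambda>j. x j \<and> y j)))))"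
        unfolding event_prob_def using n by (intro avg_mono) auto
      also have "\<dots> \<le> 3 / 4"
      proof (rule single_coordinate_loss)
        show "finite {..<n}" "0 \<in> {..<n}" using n by auto
        show "\<And>x. F 0 x \<in> AS" "\<And>x. Gs 0 x \<in> BS" "\<And>x. H 0 x \<in> CS" by (fact FGH)+
      qed (rule lose)
      finally have "win_prob (repetition n G) f g h \<le> 3 / 4" by (simp only: wp)
      moreover have "win_prob (repetition n G) f g h \<le> (7 / 8) ^ k + real M ^ k * \<alpha>0" for k
      proof -
        \<comment> \<open>The recursion starts from the full event, with
          \<open>\<epsilon> = 1/8\<close> the lost fraction from
          \<open>hard_coordinate\<close>.\<close>
        have "event_prob {..<n} UNIV UNIV UNIV (\<lambda>x y. \<forall>i\<in>{..<n}. V (x i) (y i) (F i x) (Gs i y) (H i (\<lambda>j. x j \<and> y j)))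
          \<le> (1 - 1 / 8) ^ k * event_prob {..<n} UNIV UNIV UNIV (\<lambda>x y. True) + real (4 * card AS * card BS * card CS) ^ k * \<alpha>0"
        proof (rule repetition_bound)
          fix A B C
          assume A: "\<alpha>0 \<le> event_prob {..<n} A B C (\<lambda>x y. True)"
          define \<delta> where "\<delta> = event_prob {..<n} A B C (\<lambda>x y. True)"
          have "real n * \<alpha>0 ^ 8 \<le> real n * \<delta> ^ 8"
            using A \<alpha>0 by (intro mult_left_mono power_mono) (auto simp: \<delta>_def)
          then have large: "3 * 96^3 * 33^3 * real m^3 \<le> real (card {..<n}) * \<delta>^8"
            by (simp add: \<alpha>0_8 K_def)
          have "\<exists>i\<in>{..<n}. \<delta> / 8 \<le> event_prob {..<n} A B C (\<lambda>x y. \<not> V (x i) (y i) (F i x) (Gs i y) (H i (\<lambda>j. x j \<and> y j)))"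
            by (rule hard_coordinate[OF _ fin(1,2) FGH lose m_def \<delta>_def _ large]) (use A \<alpha>0 in \<open>auto simp: \<delta>_def\<close>)
          then show "\<exists>i\<in>{..<n}. 1 / 8 * event_prob {..<n} A B C (\<lambda>x y. True)
            \<le> event_prob {..<n} A B C (\<lambda>x y. \<not> V (x i) (y i) (F i x) (Gs i y) (H i (\<lambda>j. x j \<and> y j)))"
            by (simp add: \<delta>_def)
        qed (use fin FGH \<alpha>0 in auto)
        also have "\<dots> \<le> (7 / 8) ^ k * 1 + real M ^ k * \<alpha>0"
          unfolding M_def by (intro add_mono mult_mono event_prob_le_1 event_prob_nonneg) (use \<alpha>0 in auto)
        finally show ?thesis by (simp add: wp)
      qed
      ultimately show ?thesis by blast
    qed
    have "val (repetition n G) \<in> {win_prob (repetition n G) f g h | f g h.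
       f \<in> qset1 (repetition n G) \<rightarrow>\<^sub>E aset1 (repetition n G) \<and> g \<in> qset2 (repetition n G) \<rightarrow>\<^sub>E aset2 (repetition n G)
       \<and> h \<in> qset3 (repetition n G) \<rightarrow>\<^sub>E aset3 (repetition n G)}"
      unfolding val_def using is_game3_repetition[OF assms(1)]
      by (intro Max_in finite_win_probs win_probs_nonempty)
    then obtain f g h where "val (repetition n G) = win_prob (repetition n G) f g h"
      "f \<in> qset1 (repetition n G) \<rightarrow>\<^sub>E aset1 (repetition n G)" "g \<in> qset2 (repetition n G) \<rightarrow>\<^sub>E aset2 (repetition n G)"
      "h \<in> qset3 (repetition n G) \<rightarrow>\<^sub>E aset3 (repetition n G)"
      by (elim CollectE exE conjE)
    from this(1) strategy[OF this(2-4)] show ?thesis by (simp only: \<alpha>0_def simp_thms)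
  qed
  show ?thesis
    using polynomial_decay[of "real M" "K powr (1 / 8)" "\<lambda>n. val (repetition n G)"] M4 val_le by simp
qed

end
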